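(* For each $\rho>2$ there is a constant $C>0$ such that for all $f\in L^1(\gamma_\infty)$ and all $\alpha>0$, \[ \gamma_\infty\bigl\{x\in\mathbb R:\ \|H_tf(x)\|_{v(\rho),\mathbb R_+}>\alpha\bigr\}\le \frac{C}{\alpha}\,\|f\|_{L^1(\gamma_\infty)}, \] where the $v(\rho)$ seminorm is taken in the variable $t\in\mathbb R_+=(0,\infty)$. That is, $f\mapsto \|H_tf(\cdot)\|_{v(\rho),\mathbb R_+}$ is of weak type $(1,1)$ with respect to $\gamma_\infty$.
   Context: Let $R(x)=x^2/2$ and $d\gamma_\infty(u)=(2\pi)^{-1/2}e^{-R(u)}\,du$ on $\mathbb R$. For $t>0$ and $x,u\in\mathbb R$ let \[K_t(x,u)=\frac{e^{R(x)}}{\sqrt{1-e^{-2t}}}\exp\Bigl(-\frac12\frac{(e^{-t}u-x)^2}{1-e^{-2t}}\Bigr),\] and for $f\in L^1(\gamma_\infty)$ let $H_tf(x)=\int f(u)K_t(x,u)\,d\gamma_\infty(u)$ (the one-dimensional Ornstein–Uhlenbeck semigroup). For a function $\phi$ on an interval $I$ and $1\le\rho<\infty$, the variation seminorm is $\|\phi\|_{v(\rho),I}=\sup\bigl(\sum_{i=1}^n|\phi(t_i)-\phi(t_{i-1})|^\rho\bigr)^{1/\rho}$, the supremum over all finite increasing sequences $t_0<t_1<\dots<t_n$ in $I$. *)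

theory Defs
  imports "HOL-Probability.Probability"
begin

definition R :: "real \<Rightarrow> real" where
  "R x = x\<^sup>2 / 2"

definition gauss :: "real measure" where
  "gauss = density lborel (\<lambda>u. ennreal (exp (- R u) / sqrt (2 * pi)))"

definition OU_kernel :: "real \<Rightarrow> real \<Rightarrow> real \<Rightarrow> real" where
  "OU_kernel t x u = exp (R x) / sqrt (1 - exp (-2 * t))
      * exp (- (1/2) * (exp (- t) * u - x)\<^sup>2 / (1 - exp (-2 * t)))"

definition OU :: "real \<Rightarrow> (real \<Rightarrow> real) \<Rightarrow> real \<Rightarrow> real" where
  "OU t f x = (\<integral>u. f u * OU_kernel t x u \<partial>gauss)"

definition variation :: "real \<Rightarrow> real set \<Rightarrow> (real \<Rightarrow> real) \<Rightarrow> ereal" where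
  "variation \<rho> I \<phi> = (SUP (n, t) \<in> {(n::nat, t::nat \<Rightarrow> real).
        (\<forall>i\<le>n. t i \<in> I) \<and> (\<forall>i<n. t i < t (Suc i))}.
      ereal ((\<Sum>i\<in>{1..n}. \<bar>\<phi> (t i) - \<phi> (t (i - 1))\<bar> powr \<rho>) powr (1 / \<rho>)))"

end

theory Submission
  imports Defs
begin

text \<open>The kernel \<open>OU_kernel t x u\<close> is, for fixed \<open>x\<close> and \<open>u\<close>, the product of a monotone function
  with values in \<open>[1, 2]\<close> and a unimodal function of \<open>t\<close>, so its total variation in \<open>t\<close> is at most
  five times its supremum. If \<open>1 - exp (- 2 * t)\<close> is not small compared with \<open>1 / (1 + \<bar>x\<bar>)\<^sup>2\<close>, or
  \<open>u\<close> is at distance at least \<open>1 / (1 + \<bar>x\<bar>)\<close> from \<open>x\<close>, this supremum is bounded by a multiple of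
  \<open>(1 + \<bar>x\<bar>) * exp (R x)\<close>, a function in weak \<open>L\<^sup>1\<close> of the Gaussian measure.

  In the remaining local regime, integration by parts expresses \<open>OU t f x\<close> through the one-sided averages
  of \<open>f\<close> at \<open>x\<close>, so that (the density being essentially constant on the relevant scale) it suffices
  to bound the variation of one-sided averages on the line with Lebesgue measure. For these a Bishop-type
  upcrossing inequality holds: the integral over \<open>x\<close> of the number of upcrossings of \<open>[a, b]\<close> by the averages
  at \<open>x\<close> is at most the \<open>L\<^sup>1\<close> norm of \<open>f\<close> divided by \<open>b - a\<close>. Summing it over the
  intervals \<open>[k * l, (k + 1) * l]\<close> below height \<open>\<alpha>\<close> bounds the number of jumps of size
  \<open>l = \<alpha> / 2 ^ m\<close>; the sum over \<open>m\<close> of \<open>l powr \<rho>\<close> times these numbers converges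
  precisely because \<open>\<rho> > 2\<close>.\<close>

section \<open>A discrete upcrossing inequality\<close>

text \<open>For the excursions of \<open>G\<close> above the level \<open>G i\<close> we record the first point \<open>M\<close> at which
  \<open>G j - c * j\<close> is maximal. If every excursion were recorded by the maximum of \<open>G\<close> instead, that point
  might lie too far to the right of \<open>i\<close> for the counting argument in \<open>sum_card_charged_le\<close>.\<close>
definition charged :: "(nat \<Rightarrow> real) \<Rightarrow> real \<Rightarrow> nat \<Rightarrow> nat \<Rightarrow> nat \<Rightarrow> bool" where
  "charged G c N i M \<longleftrightarrow> i < M \<and> M \<le> N \<and> G i - c * i < G M - c * M \<and>
     (\<forall>j. i < j \<and> j \<le> N \<and> (\<forall>k\<in>{min j M..max j M}. G i < G k) \<longrightarrow>
        G j - c * j \<le> G M - c * M \<and> (j < M \<longrightarrow> G j - c * j < G M - c * M))"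

lemma finite_charged [simp]: "finite {M. charged G c N i M}" "finite {i. charged G c N i M}"
proof -
  have "{M. charged G c N i M} \<subseteq> {..N}" "{i. charged G c N i M} \<subseteq> {..M}"
    by (auto simp: charged_def)
  then show "finite {M. charged G c N i M}" "finite {i. charged G c N i M}"
    using finite_subset by blast+
qed

text \<open>Each \<open>y\<close> sits in an excursion \<open>S y\<close> of \<open>G\<close> above
  \<open>G i\<close>, and the first maximizer \<open>m y\<close> of \<open>G j - c * j\<close> on it
  satisfies \<open>charged\<close>. A return to the level \<open>G i\<close> between two visits
  separates their excursions, so \<open>m\<close> is injective.\<close>

lemma card_visits_le_card_charged:
  assumes c: "c > 0" and Y: "Y \<subseteq> {i<..N}"
    and high: "\<And>y. y \<in> Y \<Longrightarrow> G i - c * real i < G y - c * real y"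
    and sep: "\<And>y y'. y \<in> Y \<Longrightarrow> y' \<in> Y \<Longrightarrow> y < y' \<Longrightarrow> \<exists>z. y < z \<and> z < y' \<and> G z \<le> G i"
  shows "card Y \<le> card {M. charged G c N i M}"
proof -
  define S where "S y = {j. i < j \<and> j \<le> N \<and> (\<forall>k\<in>{min j y..max j y}. G i < G k)}" for y
  define H where "H j = G j - c * real j" for j
  define top where "top y = Max (H ` S y)" for y
  define m where "m y = (LEAST j. j \<in> S y \<and> H j = top y)" for y
  have finS: "finite (S y)" for y
    unfolding S_def by (rule finite_subset[of _ "{..N}"]) auto
  have yS: "y \<in> S y" if "y \<in> Y" for y
  proof -
    have "G i < G y" using high[OF that] Y that c
      by (smt (verit) greaterThanAtMost_iff mult_left_mono of_nat_le_iff less_imp_le_nat subsetD)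
    then show ?thesis using Y that by (auto simp: S_def)
  qed
  have mS: "m y \<in> S y \<and> H (m y) = top y" if "y \<in> Y" for y
  proof -
    have "top y \<in> H ` S y" unfolding top_def using finS yS[OF that] by (intro Max_in) auto
    then have "\<exists>j. j \<in> S y \<and> H j = top y" by auto
    then show ?thesis unfolding m_def by (rule LeastI_ex)
  qed
  have top: "H j \<le> top y" if "j \<in> S y" for j y
    unfolding top_def using finS that by auto
  \<comment> \<open>A run from \<open>j\<close> to \<open>m y\<close> joined with the run from
    \<open>m y\<close> to \<open>y\<close> stays above \<open>G i\<close>; hence every competitor of
    \<open>m y\<close> in the sense of \<open>charged\<close> belongs to \<open>S y\<close>.\<close>
  have Sm: "j \<in> S y" if y: "y \<in> Y" and j: "i < j" "j \<le> N"
     and jk: "\<forall>k\<in>{min j (m y)..max j (m y)}. G i < G k" for j y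
  proof -
    have "\<forall>k\<in>{min (m y) y..max (m y) y}. G i < G k" using mS[OF y] by (auto simp: S_def)
    with jk have "\<forall>k\<in>{min j y..max j y}. G i < G k"
      by (metis atLeastAtMost_iff linorder_le_cases max.coboundedI1 max.coboundedI2 max_def min.coboundedI1 min.coboundedI2 min_def)
    with j show ?thesis by (auto simp: S_def)
  qed
  have ch: "charged G c N i (m y)" if y: "y \<in> Y" for y
    unfolding charged_def
  proof (intro conjI allI impI)
    show "i < m y" "m y \<le> N" using mS[OF y] by (auto simp: S_def)
    show "G i - c * real i < G (m y) - c * real (m y)"
      using high[OF y] top[OF yS[OF y]] mS[OF y] by (simp add: H_def)
  next
    fix j assume j: "i < j \<and> j \<le> N \<and> (\<forall>k\<in>{min j (m y)..max j (m y)}. G i < G k)"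
    then have jS: "j \<in> S y" using Sm[OF y] by blast
    show "G j - c * real j \<le> G (m y) - c * real (m y)"
      using top[OF jS] mS[OF y] by (simp add: H_def)
    assume "j < m y"
    then have "\<not> (j \<in> S y \<and> H j = top y)" unfolding m_def by (rule not_less_Least)
    then show "G j - c * real j < G (m y) - c * real (m y)"
      using top[OF jS] mS[OF y] jS by (simp add: H_def)
  qed
  have "inj_on m Y"
  proof (rule linorder_inj_onI')
    fix y y' assume yy: "y \<in> Y" "y' \<in> Y" "y < y'"
    then obtain z where z: "y < z" "z < y'" "G z \<le> G i" using sep by blast
    have "z \<notin> {min (m y) y..max (m y) y}" "z \<notin> {min (m y') y'..max (m y') y'}"
      using z mS[OF yy(1)] mS[OF yy(2)] by (auto simp: S_def not_le[symmetric])
    then have "m y < z" "z < m y'" using z by auto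
    then show "m y \<noteq> m y'" by simp
  qed
  moreover have "m ` Y \<subseteq> {M. charged G c N i M}" using ch by auto
  ultimately show ?thesis by (intro card_inj_on_le) auto
qed

text \<open>Count by peaks: \<open>B M\<close> collects the starting points charged to
  \<open>M\<close>. The earliest of them is joined to the peak by a chord of slope greater than
  \<open>c\<close>, so \<open>c * card (B M)\<close> is at most \<open>G M - lo M\<close>. These
  heights are added by integrating over levels: at each level the intervals
  \<open>[lo M, G M)\<close> containing it are matched with different upward steps of
  \<open>G\<close>.\<close>

lemma sum_card_charged_le:
  assumes c: "c > 0"
  shows "c * (\<Sum>i\<le>N. real (card {M. charged G c N i M})) \<le> (\<Sum>j<N. max 0 (G (Suc j) - G j))"
proof -
  define B where "B M = {i. charged G c N i M}" for M
  \<comment> \<open>A peak without starting points gets \<open>lo M = G M\<close>, hence an empty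
    interval of levels.\<close>
  define lo where "lo M = (if B M = {} then G M else Min (G ` B M))" for M
  have finB: "finite (B M)" for M by (simp add: B_def)
  have lo: "\<exists>i\<in>B M. G i = lo M" if "B M \<noteq> {}" for M
  proof -
    have "Min (G ` B M) \<in> G ` B M" using that finB by (intro Min_in) auto
    then show ?thesis using that by (auto simp: lo_def)
  qed
  have lo_le: "lo M \<le> G i" if "i \<in> B M" for i M
    using that finB by (auto simp: lo_def)
  have cardB: "c * card (B M) \<le> G M - lo M" for M
  proof (cases "B M = {}")
    case False
    define i0 where "i0 = Min (B M)"
    have i0: "i0 \<in> B M" using False finB by (auto simp: i0_def)
    have "B M \<subseteq> {i0..<M}" using finB by (auto simp: i0_def) (auto simp: B_def charged_def)
    then have "card (B M) \<le> M - i0" using card_mono[of "{i0..<M}" "B M"] by simp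
    moreover have "i0 < M" using i0 by (simp add: B_def charged_def)
    ultimately have "c * card (B M) \<le> c * (real M - real i0)"
      using c by (intro mult_left_mono) linarith+
    also have "\<dots> \<le> G M - G i0" using i0 by (simp add: B_def charged_def algebra_simps)
    also have "\<dots> \<le> G M - lo M" using lo_le[OF i0] by simp
    finally show ?thesis .
  qed (simp add: lo_def)
  have lo_M: "lo M \<le> G M" for M using cardB[of M] c
    by (smt (verit) mult_nonneg_nonneg of_nat_0_le_iff)
  have swap: "(\<Sum>i\<le>N. real (card {M. charged G c N i M})) = (\<Sum>M\<le>N. real (card (B M)))"
  proof -
    have "(\<Sum>i\<le>N. real (card {M. charged G c N i M})) = (\<Sum>i\<le>N. \<Sum>M\<le>N. if charged G c N i M then 1 else 0)"
    proof (rule sum.cong[OF refl])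
      fix i
      have "{M. charged G c N i M} = {M\<in>{..N}. charged G c N i M}" by (auto simp: charged_def)
      then show "real (card {M. charged G c N i M}) = (\<Sum>M\<le>N. if charged G c N i M then 1 else 0)"
        by (simp add: sum.If_cases Int_def)
    qed
    also have "\<dots> = (\<Sum>M\<le>N. \<Sum>i\<le>N. if charged G c N i M then 1 else 0)" by (rule sum.swap)
    also have "\<dots> = (\<Sum>M\<le>N. real (card (B M)))"
    proof (rule sum.cong[OF refl])
      fix M
      have "B M = {i\<in>{..N}. charged G c N i M}" by (auto simp: charged_def B_def)
      then show "(\<Sum>i\<le>N. if charged G c N i M then 1 else 0) = real (card (B M))"
        by (simp add: sum.If_cases Int_def)
    qed
    finally show ?thesis .
  qed
  have levels: "(\<Sum>M\<le>N. indicator {lo M..<G M} l) \<le> (\<Sum>j<N. indicator {G j..<G (Suc j)} l :: ennreal)" for l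
  proof -
    define A where "A = {M\<in>{..N}. l \<in> {lo M..<G M}}"
    define U where "U = {j\<in>{..<N}. l \<in> {G j..<G (Suc j)}}"
    \<comment> \<open>\<open>e M\<close> is the last index before \<open>M\<close> at which
      \<open>G\<close> is at most \<open>l\<close>; the step that follows it crosses
      \<open>l\<close> upwards.\<close>
    define e where "e M = Max {j. j < M \<and> G j \<le> l}" for M
    have start: "\<exists>i. charged G c N i M \<and> G i \<le> l" if "M \<in> A" for M
    proof -
      have "B M \<noteq> {}" using that by (auto simp: A_def lo_def)
      then obtain i where "i \<in> B M" "G i = lo M" using lo by blast
      then show ?thesis using that by (auto simp: A_def B_def)
    qed
    have e: "e M < M \<and> G (e M) \<le> l \<and> (\<forall>k. e M < k \<and> k \<le> M \<longrightarrow> l < G k)" if M: "M \<in> A" for M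
    proof -
      obtain i where i: "charged G c N i M" "G i \<le> l" using start[OF M] by blast
      then have "i \<in> {j. j < M \<and> G j \<le> l}" by (auto simp: charged_def)
      then have "e M \<in> {j. j < M \<and> G j \<le> l}" unfolding e_def by (intro Max_in) auto
      moreover have "l < G k" if "e M < k" "k \<le> M" for k
      proof (rule ccontr)
        assume "\<not> l < G k"
        moreover have "k \<noteq> M" using calculation M by (auto simp: A_def)
        ultimately have "k \<in> {j. j < M \<and> G j \<le> l}" using that by auto
        then have "k \<le> e M" unfolding e_def by (intro Max_ge) auto
        with that show False by simp
      qed
      ultimately show ?thesis by auto
    qed
    have "inj_on e A"
    proof (rule linorder_inj_onI')
      fix M M' assume MM: "M \<in> A" "M' \<in> A" "M < M'"
      show "e M \<noteq> e M'"
      proof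
        assume eq: "e M = e M'"
        obtain i where i: "charged G c N i M" "G i \<le> l" using start[OF MM(1)] by blast
        obtain i' where i': "charged G c N i' M'" "G i' \<le> l" using start[OF MM(2)] by blast
        have up: "l < G k" if "M \<le> k" "k \<le> M'" for k
          using e[OF MM(1)] e[OF MM(2)] that eq by auto
        \<comment> \<open>Peaks \<open>M < M'\<close> with the same last crossing are joined by a
          stretch where \<open>G > l\<close>, so each competes with the other. The start
          \<open>i\<close> prefers \<open>M\<close>, possibly in a tie, while \<open>i'\<close>
          prefers \<open>M'\<close> strictly because \<open>M\<close> comes first. For the latter
          \<open>M\<close> must lie to the right of \<open>i'\<close>.\<close>
        have "i' < M"
        proof (rule ccontr)
          assume "\<not> i' < M"
          then show False using up[of i'] i' by (auto simp: charged_def)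
        qed
        moreover have "G i < G k" "G i' < G k" if "M \<le> k" "k \<le> M'" for k
          using up[OF that] i i' by auto
        ultimately have "G M - c * real M < G M' - c * real M'" "G M' - c * real M' \<le> G M - c * real M"
          using i i' MM by (auto simp: charged_def A_def dest!: spec[of _ M] spec[of _ M'])
        then show False by simp
      qed
    qed
    moreover have "e ` A \<subseteq> U"
    proof
      fix j assume "j \<in> e ` A"
      then obtain M where M: "M \<in> A" "j = e M" by auto
      have "l < G (Suc j)" using e[OF M(1)] M by auto
      then show "j \<in> U" using e[OF M(1)] M by (auto simp: U_def A_def)
    qed
    ultimately have "card A \<le> card U" by (intro card_inj_on_le[where f=e]) (auto simp: U_def)
    moreover have "(\<Sum>M\<le>N. indicator {lo M..<G M} l :: ennreal) = of_nat (card A)"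
      unfolding A_def indicator_def by (simp add: sum_of_bool_eq Int_def del: atLeastLessThan_iff)
    moreover have "(\<Sum>j<N. indicator {G j..<G (Suc j)} l :: ennreal) = of_nat (card U)"
      unfolding U_def indicator_def by (simp add: sum_of_bool_eq Int_def del: atLeastLessThan_iff)
    ultimately show ?thesis by simp
  qed
  have "ennreal (\<Sum>M\<le>N. G M - lo M) = (\<Sum>M\<le>N. ennreal (G M - lo M))"
    using lo_M by (subst sum_ennreal) (auto simp: algebra_simps)
  also have "\<dots> = (\<Sum>M\<le>N. \<integral>\<^sup>+l. indicator {lo M..<G M} l \<partial>lborel)"
    using lo_M by (intro sum.cong) auto
  also have "\<dots> = (\<integral>\<^sup>+l. (\<Sum>M\<le>N. indicator {lo M..<G M} l) \<partial>lborel)"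
    by (subst nn_integral_sum) auto
  also have "\<dots> \<le> (\<integral>\<^sup>+l. (\<Sum>j<N. indicator {G j..<G (Suc j)} l) \<partial>lborel)"
    using levels by (intro nn_integral_mono) auto
  also have "\<dots> = (\<Sum>j<N. \<integral>\<^sup>+l. indicator {G j..<G (Suc j)} l \<partial>lborel)"
    by (subst nn_integral_sum) auto
  also have "\<dots> = (\<Sum>j<N. ennreal (max 0 (G (Suc j) - G j)))"
    by (intro sum.cong) (auto simp: max_def)
  also have "\<dots> = ennreal (\<Sum>j<N. max 0 (G (Suc j) - G j))"
    by (subst sum_ennreal) auto
  finally have "(\<Sum>M\<le>N. G M - lo M) \<le> (\<Sum>j<N. max 0 (G (Suc j) - G j))"
    by (subst (asm) ennreal_le_iff) (auto intro: sum_nonneg)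
  moreover have "c * (\<Sum>M\<le>N. real (card (B M))) \<le> (\<Sum>M\<le>N. G M - lo M)"
    unfolding sum_distrib_left using cardB by (intro sum_mono) auto
  ultimately show ?thesis unfolding swap by simp
qed

section \<open>Upcrossings of one-sided averages\<close>

definition cumul :: "(real \<Rightarrow> real) \<Rightarrow> real \<Rightarrow> real" where
  "cumul f y = (\<integral>u. f u * indicator {..y} u \<partial>lborel)"

lemma integrable_mult_indicator_right:
  fixes f :: "real \<Rightarrow> real"
  assumes "integrable lborel f" "A \<in> sets borel"
  shows "integrable lborel (\<lambda>u. f u * indicator A u)"
  using integrable_mult_indicator[of A lborel f] assms by (simp add: mult.commute)

lemma cumul_diff:
  assumes f: "integrable lborel f" and xy: "x \<le> y"
  shows "cumul f y - cumul f x = (\<integral>u. f u * indicator {x<..y} u \<partial>lborel)"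
  unfolding cumul_def
  by (subst Bochner_Integration.integral_diff[symmetric])
     (use xy in \<open>auto intro!: Bochner_Integration.integral_cong integrable_mult_indicator_right[OF f] split: split_indicator\<close>)

lemma cumul_mono:
  assumes "integrable lborel f" "\<And>u. 0 \<le> f u" "x \<le> y"
  shows "cumul f x \<le> cumul f y"
proof -
  have "0 \<le> cumul f y - cumul f x"
    unfolding cumul_diff[OF assms(1,3)] using assms by (intro Bochner_Integration.integral_nonneg) auto
  then show ?thesis by simp
qed

lemma cumul_nonneg: "(\<And>u. 0 \<le> f u) \<Longrightarrow> 0 \<le> cumul f x"
  unfolding cumul_def by (intro Bochner_Integration.integral_nonneg) auto

lemma cumul_le:
  assumes "integrable lborel f" "\<And>u. 0 \<le> f u"
  shows "cumul f x \<le> (\<integral>u. f u \<partial>lborel)"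
  unfolding cumul_def using assms
  by (intro integral_mono integrable_mult_indicator_right) (auto simp: indicator_def)

lemma isCont_cumul:
  assumes f: "integrable lborel f"
  shows "isCont (cumul f) y"
  unfolding continuous_at_sequentially comp_def
proof (intro allI impI)
  fix X assume X: "X \<longlonglongrightarrow> y"
  show "(\<lambda>n. cumul f (X n)) \<longlonglongrightarrow> cumul f y"
    unfolding cumul_def
  proof (rule integral_dominated_convergence[where w="\<lambda>u. \<bar>f u\<bar>"])
    have "AE u in lborel. u \<noteq> y" by (rule AE_lborel_singleton)
    then show "AE u in lborel. (\<lambda>n. f u * indicator {..X n} u) \<longlonglongrightarrow> f u * indicator {..y} u"
    proof eventually_elim
      case (elim u)
      have "eventually (\<lambda>n. indicator {..X n} u = (indicator {..y} u :: real)) sequentially"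
      proof (cases "u < y")
        case True
        then show ?thesis using order_tendstoD(1)[OF X True] by (auto elim!: eventually_mono simp: indicator_def)
      next
        case False
        then have "y < u" using elim by simp
        then show ?thesis using order_tendstoD(2)[OF X, of u] by (auto elim!: eventually_mono simp: indicator_def)
      qed
      then show ?case by (intro tendsto_mult tendsto_const tendsto_eventually)
    qed
  qed (use f in \<open>auto simp: abs_mult indicator_def\<close>)
qed

text \<open>The continuous case follows from the discrete one by sampling the primitive of \<open>f\<close> on a grid of
  mesh \<open>2 ^ - K\<close> in \<open>[-K, K]\<close>; the lower limit over \<open>K\<close> is measurable by construction, and Fatou's
  lemma transports the bound.\<close>
definition grid :: "nat \<Rightarrow> nat \<Rightarrow> real" where
  "grid K i = - real K + real i / 2 ^ K"

definition grid_index :: "nat \<Rightarrow> real \<Rightarrow> nat" where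
  "grid_index K x = nat \<lfloor>(x + real K) * 2 ^ K\<rfloor>"

text \<open>With \<open>G = cumul f - a * id\<close> on the grid, subtracting
  \<open>(b - a) / 2 ^ K\<close> per index replaces slope \<open>a\<close> by slope \<open>b\<close>
  up to an additive constant, so \<open>charged\<close> sees both lines of the upcrossing
  condition.\<close>

definition grid_visits :: "(real \<Rightarrow> real) \<Rightarrow> real \<Rightarrow> real \<Rightarrow> nat \<Rightarrow> real \<Rightarrow> ennreal" where
  "grid_visits f a b K x =
     (\<Sum>i<2 * K * 2 ^ K. of_nat (card {M. charged (\<lambda>i. cumul f (grid K i) - a * grid K i) ((b - a) / 2 ^ K) (2 * K * 2 ^ K) i M})
        * indicator {grid K i..<grid K (Suc i)} x)"

definition visits :: "(real \<Rightarrow> real) \<Rightarrow> real \<Rightarrow> real \<Rightarrow> real \<Rightarrow> ennreal" where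
  "visits f a b x = liminf (\<lambda>K. grid_visits f a b K x)"

lemma borel_measurable_grid_visits [measurable]: "grid_visits f a b K \<in> borel_measurable borel"
  unfolding grid_visits_def by measurable

lemma borel_measurable_visits [measurable]: "visits f a b \<in> borel_measurable borel"
  unfolding visits_def by measurable

text \<open>A cell has length \<open>1 / 2 ^ K\<close>, so the integral of
  \<open>grid_visits\<close> is the discrete count with \<open>c\<close> rescaled to
  \<open>b - a\<close>. Since \<open>0 \<le> a\<close>, the positive part of an increment of
  \<open>G\<close> is at most the increment of \<open>cumul f\<close>, and the latter
  telescope.\<close>

lemma nn_integral_visits_le:
  assumes f: "integrable lborel f" "\<And>u. 0 \<le> f u" and ab: "0 \<le> a" "a < b"
  shows "(\<integral>\<^sup>+x. visits f a b x \<partial>lborel) \<le> ennreal ((\<integral>u. f u \<partial>lborel) / (b - a))"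
proof -
  have *: "(\<integral>\<^sup>+x. grid_visits f a b K x \<partial>lborel) \<le> ennreal ((\<integral>u. f u \<partial>lborel) / (b - a))" for K
  proof -
    define N where "N = 2 * K * 2 ^ K"
    define G where "G i = cumul f (grid K i) - a * grid K i" for i
    define c where "c = (b - a) / 2 ^ K"
    have c: "c > 0" using ab by (simp add: c_def)
    have gS: "grid K (Suc i) - grid K i = 1 / 2 ^ K" for i by (simp add: grid_def field_simps)
    then have gle: "grid K i \<le> grid K (Suc i)" for i
      by (smt (verit) divide_nonneg_nonneg zero_le_power)
    have "(\<integral>\<^sup>+x. grid_visits f a b K x \<partial>lborel)
      = (\<Sum>i<N. of_nat (card {M. charged G c N i M}) * emeasure lborel {grid K i..<grid K (Suc i)})"
      unfolding grid_visits_def N_def[symmetric] G_def[symmetric] c_def[symmetric]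
      by (subst nn_integral_sum) (auto simp: nn_integral_cmult_indicator)
    also have "\<dots> = (\<Sum>i<N. ennreal (real (card {M. charged G c N i M}) / 2 ^ K))"
      using gle gS by (intro sum.cong) (auto simp: ennreal_of_nat_eq_real_of_nat ennreal_mult[symmetric])
    also have "\<dots> = ennreal (\<Sum>i<N. real (card {M. charged G c N i M}) / 2 ^ K)"
      by (subst sum_ennreal) auto
    also have "(\<Sum>i<N. real (card {M. charged G c N i M}) / 2 ^ K) \<le> (\<integral>u. f u \<partial>lborel) / (b - a)"
    proof -
      have "(b - a) * (\<Sum>i<N. real (card {M. charged G c N i M}) / 2 ^ K)
        = c * (\<Sum>i<N. real (card {M. charged G c N i M}))"
        by (simp add: c_def sum_divide_distrib[symmetric])
      also have "\<dots> \<le> c * (\<Sum>i\<le>N. real (card {M. charged G c N i M}))"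
        using c by (intro mult_left_mono sum_mono2) auto
      also have "\<dots> \<le> (\<Sum>j<N. max 0 (G (Suc j) - G j))" by (rule sum_card_charged_le[OF c])
      also have "\<dots> \<le> (\<Sum>j<N. cumul f (grid K (Suc j)) - cumul f (grid K j))"
      proof (rule sum_mono)
        fix j
        have "a * grid K j \<le> a * grid K (Suc j)" using gle ab by (intro mult_left_mono) auto
        then show "max 0 (G (Suc j) - G j) \<le> cumul f (grid K (Suc j)) - cumul f (grid K j)"
          using cumul_mono[OF f gle[of j]] by (simp add: G_def)
      qed
      also have "\<dots> = cumul f (grid K N) - cumul f (grid K 0)"
        by (rule sum_lessThan_telescope)
      also have "\<dots> \<le> (\<integral>u. f u \<partial>lborel)"
        using cumul_le[OF f, of "grid K N"] cumul_nonneg[of f "grid K 0", OF f(2)] by simp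
      finally show ?thesis using ab by (simp add: pos_le_divide_eq mult.commute)
    qed
    finally show ?thesis by (simp add: ennreal_leI)
  qed
  have "(\<integral>\<^sup>+x. visits f a b x \<partial>lborel) \<le> liminf (\<lambda>K. \<integral>\<^sup>+x. grid_visits f a b K x \<partial>lborel)"
    unfolding visits_def by (rule nn_integral_liminf) simp
  also have "\<dots> \<le> limsup (\<lambda>K. \<integral>\<^sup>+x. grid_visits f a b K x \<partial>lborel)"
    by (intro Liminf_le_Limsup) simp
  also have "\<dots> \<le> ennreal ((\<integral>u. f u \<partial>lborel) / (b - a))"
    using * by (intro Limsup_bounded) auto
  finally show ?thesis .
qed

section \<open>Rounding points to the grid\<close>

lemma eventually_grid_bounds:
  "eventually (\<lambda>K. grid_index K x < 2 * K * 2 ^ K \<and> grid K (grid_index K x) \<le> x \<and>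
     x < grid K (Suc (grid_index K x))) sequentially"
proof -
  have "eventually (\<lambda>K. \<bar>x\<bar> < real K) sequentially"
    using filterlim_real_sequentially unfolding filterlim_at_top_dense by blast
  then show ?thesis
  proof eventually_elim
    case (elim K)
    define w where "w = (x + real K) * 2 ^ K"
    have w: "0 \<le> w" "w < real (2 * K * 2 ^ K)" using elim by (auto simp: w_def)
    have i: "real (grid_index K x) \<le> w" "w < real (grid_index K x) + 1"
      using w unfolding grid_index_def w_def[symmetric] by linarith+
    have "x = - real K + w / 2 ^ K" by (simp add: w_def)
    moreover have "real (grid_index K x) / 2 ^ K \<le> w / 2 ^ K" "w / 2 ^ K < (real (grid_index K x) + 1) / 2 ^ K"
      using i by (auto intro: divide_right_mono divide_strict_right_mono)
    moreover have "grid_index K x < 2 * K * 2 ^ K" using i w by linarith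
    ultimately show ?case unfolding grid_def by (auto simp: add.commute)
  qed
qed

lemma grid_index_tendsto: "(\<lambda>K. grid K (grid_index K x)) \<longlonglongrightarrow> x"
proof (rule tendsto_sandwich)
  show "eventually (\<lambda>K. x - 1 / 2 ^ K \<le> grid K (grid_index K x)) sequentially"
    using eventually_grid_bounds[of x] by eventually_elim (simp add: grid_def add_divide_distrib)
  show "eventually (\<lambda>K. grid K (grid_index K x) \<le> x) sequentially"
    using eventually_grid_bounds[of x] by eventually_elim simp
  have "(\<lambda>K. x - (1 / 2) ^ K) \<longlonglongrightarrow> x - 0"
    by (intro tendsto_intros LIMSEQ_realpow_zero) auto
  then show "(\<lambda>K. x - 1 / 2 ^ K) \<longlonglongrightarrow> x" by (simp add: power_one_over)
qed simp

lemma eventually_grid_index_less: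
  assumes "x < y"
  shows "eventually (\<lambda>K. grid_index K x < grid_index K y) sequentially"
proof -
  have "eventually (\<lambda>K. grid K (grid_index K x) < grid K (grid_index K y)) sequentially"
  proof -
    define m where "m = (x + y) / 2"
    have "x < m" "m < y" using assms by (auto simp: m_def)
    from order_tendstoD(2)[OF grid_index_tendsto this(1)] order_tendstoD(1)[OF grid_index_tendsto this(2)]
    show ?thesis by eventually_elim simp
  qed
  then show ?thesis by eventually_elim (simp add: grid_def divide_less_cancel)
qed

text \<open>Only finitely many strict inequalities between values of continuous functions are
  involved. They persist after rounding to every fine enough grid, where the discrete count applies
  with the cell of \<open>x\<close> as starting index.\<close>

lemma card_le_visits:
  assumes f: "integrable lborel f" and ab: "a < b"
    and Y: "finite Y" "Y \<subseteq> {x<..}"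
    and high: "\<And>y. y \<in> Y \<Longrightarrow> cumul f x - b * x < cumul f y - b * y"
    and sep: "\<And>y y'. y \<in> Y \<Longrightarrow> y' \<in> Y \<Longrightarrow> y < y' \<Longrightarrow> \<exists>z. y < z \<and> z < y' \<and> cumul f z - a * z < cumul f x - a * x"
  shows "of_nat (card Y) \<le> visits f a b x"
  unfolding visits_def
proof (rule Liminf_bounded)
  obtain zz where zz: "y < zz y y' \<and> zz y y' < y' \<and> cumul f (zz y y') - a * zz y y' < cumul f x - a * x"
    if "y \<in> Y" "y' \<in> Y" "y < y'" for y y' using sep by metis
  define rnd where "rnd K w = grid K (grid_index K w)" for K w
  have lim: "(\<lambda>K. cumul f (rnd K w) - d * rnd K w) \<longlonglongrightarrow> cumul f w - d * w" for d w
    unfolding rnd_def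
    by (intro tendsto_intros grid_index_tendsto isCont_tendsto_compose[OF isCont_cumul[OF f]])
  have ev_less: "eventually (\<lambda>K. cumul f (rnd K v) - d * rnd K v < cumul f (rnd K w) - d * rnd K w) sequentially"
    if "cumul f v - d * v < cumul f w - d * w" for d v w
  proof -
    have "eventually (\<lambda>K. 0 < (cumul f (rnd K w) - d * rnd K w) - (cumul f (rnd K v) - d * rnd K v)) sequentially"
      using that by (intro order_tendstoD(1)[OF tendsto_diff[OF lim lim]]) auto
    then show ?thesis by eventually_elim simp
  qed
  have e1: "eventually (\<lambda>K. \<forall>y\<in>Y. cumul f (rnd K x) - b * rnd K x < cumul f (rnd K y) - b * rnd K y) sequentially"
    using high by (intro eventually_ball_finite Y ballI ev_less)
  have e2: "eventually (\<lambda>K. \<forall>y\<in>Y. grid_index K x < grid_index K y) sequentially"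
    using Y by (intro eventually_ball_finite Y ballI eventually_grid_index_less) auto
  have e3: "eventually (\<lambda>K. \<forall>y\<in>Y. grid_index K y < 2 * K * 2 ^ K) sequentially"
    by (intro eventually_ball_finite Y ballI) (rule eventually_mono[OF eventually_grid_bounds], auto)
  have e4: "eventually (\<lambda>K. \<forall>y\<in>Y. \<forall>y'\<in>Y. y < y' \<longrightarrow> grid_index K y < grid_index K (zz y y') \<and>
      grid_index K (zz y y') < grid_index K y' \<and>
      cumul f (rnd K (zz y y')) - a * rnd K (zz y y') < cumul f (rnd K x) - a * rnd K x) sequentially"
  proof (intro eventually_ball_finite Y ballI)
    fix y y' assume "y \<in> Y" "y' \<in> Y"
    then show "eventually (\<lambda>K. y < y' \<longrightarrow> grid_index K y < grid_index K (zz y y') \<and>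
      grid_index K (zz y y') < grid_index K y' \<and>
      cumul f (rnd K (zz y y')) - a * rnd K (zz y y') < cumul f (rnd K x) - a * rnd K x) sequentially"
      using zz by (cases "y < y'") (auto intro!: eventually_conj eventually_grid_index_less ev_less)
  qed
  show "eventually (\<lambda>K. of_nat (card Y) \<le> grid_visits f a b K x) sequentially"
    using e1 e2 e3 e4 eventually_grid_bounds[of x]
  proof eventually_elim
    case (elim K)
    define N where "N = 2 * K * 2 ^ K"
    define G where "G i = cumul f (grid K i) - a * grid K i" for i
    define c where "c = (b - a) / 2 ^ K"
    let ?I = "grid_index K"
    have c: "c > 0" using ab by (simp add: c_def)
    \<comment> \<open>The constant \<open>(b - a) * K\<close> arises because the grid starts at
      \<open>- K\<close>; it cancels in comparisons.\<close>
    have Hc: "G i - c * real i = cumul f (grid K i) - b * grid K i - (b - a) * K" for i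
      by (simp add: G_def c_def grid_def algebra_simps diff_divide_distrib)
    have I_less: "?I y < ?I y'" if "y \<in> Y" "y' \<in> Y" "y < y'" for y y'
      using elim(4) that by (metis less_trans)
    have "inj_on ?I Y" by (rule linorder_inj_onI') (use I_less in fastforce)
    then have "card Y = card (?I ` Y)" by (simp add: card_image)
    also have "\<dots> \<le> card {M. charged G c N (?I x) M}"
    proof (rule card_visits_le_card_charged[OF c])
      show "?I ` Y \<subseteq> {?I x<..N}" using elim(2,3) by (auto simp: N_def less_imp_le)
    next
      fix i assume "i \<in> ?I ` Y"
      then show "G (?I x) - c * real (?I x) < G i - c * real i"
        using elim(1) unfolding Hc by (auto simp: rnd_def)
    next
      fix i i' assume i: "i \<in> ?I ` Y" "i' \<in> ?I ` Y" "i < i'"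
      then obtain y y' where y: "y \<in> Y" "y' \<in> Y" "i = ?I y" "i' = ?I y'" by auto
      then have "y < y'" using I_less[of y' y] i by (metis less_asym linorder_neqE)
      then show "\<exists>z. i < z \<and> z < i' \<and> G z \<le> G (?I x)"
        using elim(4) y by (intro exI[of _ "?I (zz y y')"]) (auto simp: rnd_def G_def less_imp_le)
    qed
    finally have "of_nat (card Y) \<le> (of_nat (card {M. charged G c N (?I x) M}) :: ennreal)" by simp
    also have "\<dots> = (\<Sum>i\<in>{?I x}. of_nat (card {M. charged G c N i M}) * indicator {grid K i..<grid K (Suc i)} x)"
      using elim(5) by simp
    also have "\<dots> \<le> (\<Sum>i<N. of_nat (card {M. charged G c N i M}) * indicator {grid K i..<grid K (Suc i)} x)"
      by (rule sum_mono2) (use elim(5) in \<open>auto simp: N_def\<close>)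
    finally show ?case
      unfolding grid_visits_def N_def[symmetric] G_def[symmetric] c_def[symmetric] .
  qed
qed

section \<open>Variation of one-sided averages\<close>

definition avg :: "(real \<Rightarrow> real) \<Rightarrow> real \<Rightarrow> real \<Rightarrow> real" where
  "avg f x r = (cumul f (x + r) - cumul f x) / r"

text \<open>Radii may repeat, because later the times are truncated by \<open>min\<close> and
  several of them may collapse into one. The bound on the averages themselves is included for the
  terms in which the weight changes and an average is a factor.\<close>

definition avg_controlled :: "real \<Rightarrow> real \<Rightarrow> (real \<Rightarrow> real) \<Rightarrow> real \<Rightarrow> bool" where
  "avg_controlled \<rho> \<alpha> f x \<longleftrightarrow> (\<forall>r>0. avg f x r \<le> \<alpha>) \<and>
     (\<forall>n r. (\<forall>i\<le>n. 0 < r i) \<longrightarrow> (\<forall>i<n. r i \<le> r (Suc i)) \<longrightarrow>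
        (\<Sum>i<n. \<bar>avg f x (r (Suc i)) - avg f x (r i)\<bar> powr \<rho>) \<le> \<alpha> powr \<rho>)"

lemma avg_nonneg:
  assumes "integrable lborel f" "\<And>u. 0 \<le> f u" "0 < r"
  shows "0 \<le> avg f x r"
  using cumul_mono[OF assms(1,2), of x "x + r"] assms(3) by (simp add: avg_def)

lemma steps_mono:
  fixes r :: "nat \<Rightarrow> 'a::order"
  assumes "\<And>i. i < n \<Longrightarrow> r i \<le> r (Suc i)" "i \<le> j" "j \<le> n"
  shows "r i \<le> r j"
  using assms(2,3)
proof (induction j rule: dec_induct)
  case (step j)
  then show ?case using assms(1)[of j] by (metis Suc_leD Suc_le_lessD order_trans)
qed simp

text \<open>Multiplied by the radius, the conditions on averages become comparisons of
  \<open>cumul f\<close> with lines through its value at \<open>x\<close>. An average above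
  \<open>b\<close> and one below \<open>a\<close> cannot have the same radius, which restores strict
  order where radii repeat.\<close>

lemma card_high_le_visits:
  assumes f: "integrable lborel f" and ab: "a < b"
    and r: "\<And>i. i \<le> n \<Longrightarrow> 0 < r i" "\<And>i. i < n \<Longrightarrow> r i \<le> r (Suc i)"
    and I: "I \<subseteq> {..n}" "\<And>i. i \<in> I \<Longrightarrow> b < avg f x (r i)"
    and sep: "\<And>i i'. i \<in> I \<Longrightarrow> i' \<in> I \<Longrightarrow> i < i' \<Longrightarrow> \<exists>k. i \<le> k \<and> k \<le> i' \<and> avg f x (r k) < a"
  shows "of_nat (card I) \<le> visits f a b x"
proof -
  let ?p = "\<lambda>i. x + r i"
  have btw: "\<exists>k. k \<le> n \<and> r i < r k \<and> r k < r i' \<and> avg f x (r k) < a" if ii: "i \<in> I" "i' \<in> I" "i < i'" for i i'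
  proof -
    obtain k where k: "i \<le> k" "k \<le> i'" "avg f x (r k) < a" using sep[OF ii] by blast
    have "i' \<le> n" using I ii by auto
    then have "r i \<le> r k" "r k \<le> r i'" using steps_mono[of n r] r(2) k by auto
    moreover have "r i \<noteq> r k" "r k \<noteq> r i'" using I(2)[of i] I(2)[of i'] ii k(3) ab by auto
    ultimately show ?thesis using k \<open>i' \<le> n\<close> by (intro exI[of _ k]) auto
  qed
  have finI: "finite I" using I(1) finite_subset by blast
  have less: "?p i < ?p i'" if "i \<in> I" "i' \<in> I" "i < i'" for i i'
    using btw[OF that] by auto
  have "inj_on ?p I" by (rule linorder_inj_onI') (use less in fastforce)
  then have "card I = card (?p ` I)" by (simp add: card_image)
  also have "of_nat \<dots> \<le> visits f a b x"
  proof (rule card_le_visits[OF f ab])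
    show "finite (?p ` I)" using finI by simp
    show "?p ` I \<subseteq> {x<..}" using I r(1) by auto
  next
    fix y assume "y \<in> ?p ` I"
    then obtain i where i: "i \<in> I" "y = ?p i" by blast
    then have "0 < r i" "b < avg f x (r i)" using I r by auto
    then show "cumul f x - b * x < cumul f y - b * y"
      using i by (simp add: avg_def field_simps)
  next
    fix y y' assume "y \<in> ?p ` I" "y' \<in> ?p ` I" "y < y'"
    then obtain i i' where i: "i \<in> I" "i' \<in> I" "y = ?p i" "y' = ?p i'" by blast
    have "i < i'" using less[of i' i] i \<open>y < y'\<close> by (metis less_asym linorder_neqE)
    then obtain k where k: "k \<le> n" "r i < r k" "r k < r i'" "avg f x (r k) < a" using btw i by blast
    have "0 < r k" using r(1) k by simp
    then have "cumul f (?p k) - a * ?p k < cumul f x - a * x"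
      using k(4) by (simp add: avg_def field_simps)
    then show "\<exists>z. y < z \<and> z < y' \<and> cumul f z - a * z < cumul f x - a * x"
      using k i by (intro exI[of _ "?p k"]) auto
  qed
  finally show ?thesis .
qed

text \<open>Here \<open>m\<close> runs over the dyadic jump sizes and \<open>k\<close> over the
  level cells of that size below height about \<alpha>. The factor \<open>powr \<rho>\<close> is, up
  to a constant, what one jump of that size contributes to a variation sum.\<close>

definition jump_sum :: "(real \<Rightarrow> real) \<Rightarrow> real \<Rightarrow> real \<Rightarrow> real \<Rightarrow> ennreal" where
  "jump_sum f \<alpha> \<rho> x = (\<Sum>m. ennreal ((\<alpha> / 2 ^ m) powr \<rho>) *
     (\<Sum>k\<in>{1..2 ^ m}. visits f (real k * (\<alpha> / 2 ^ m)) (real (Suc k) * (\<alpha> / 2 ^ m)) x))"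

lemma borel_measurable_jump_sum [measurable]: "jump_sum f \<alpha> \<rho> \<in> borel_measurable borel"
  unfolding jump_sum_def by measurable

text \<open>With \<open>l = \<alpha> / 2 ^ m\<close> there are \<open>2 ^ m\<close> cells, each
  costing the norm of \<open>f\<close> divided by \<open>l\<close>. Multiplied by
  \<open>l powr \<rho>\<close> this is \<open>\<alpha> powr (\<rho> - 1)\<close> times the norm
  times \<open>2 powr (m * (2 - \<rho>))\<close>, a geometric sequence.\<close>

lemma nn_integral_jump_sum_le:
  assumes f: "integrable lborel f" "\<And>u. 0 \<le> f u" and \<alpha>: "0 < \<alpha>" and \<rho>: "2 < \<rho>"
  shows "(\<integral>\<^sup>+x. jump_sum f \<alpha> \<rho> x \<partial>lborel)
    \<le> ennreal (\<alpha> powr (\<rho> - 1) * (\<integral>u. f u \<partial>lborel) / (1 - 2 powr (2 - \<rho>)))"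
proof -
  let ?n = "\<integral>u. f u \<partial>lborel"
  define q where "q = (2::real) powr (2 - \<rho>)"
  have q: "0 \<le> q" "q < 1" using \<rho> powr_less_mono[of "2-\<rho>" 0 "2::real"] by (auto simp: q_def)
  have n: "0 \<le> ?n" using f by (intro Bochner_Integration.integral_nonneg) auto
  have "(\<integral>\<^sup>+x. jump_sum f \<alpha> \<rho> x \<partial>lborel) = (\<Sum>m. ennreal ((\<alpha> / 2 ^ m) powr \<rho>) *
     (\<Sum>k\<in>{1..2 ^ m}. \<integral>\<^sup>+x. visits f (real k * (\<alpha> / 2 ^ m)) (real (Suc k) * (\<alpha> / 2 ^ m)) x \<partial>lborel))"
    unfolding jump_sum_def
    by (simp add: nn_integral_suminf nn_integral_cmult nn_integral_sum del: of_nat_Suc)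
  also have "\<dots> \<le> (\<Sum>m. ennreal ((\<alpha> powr (\<rho> - 1) * ?n) * q ^ m))"
  proof (rule suminf_le)
    fix m :: nat
    define l where "l = \<alpha> / 2 ^ m"
    have l: "0 < l" using \<alpha> by (simp add: l_def)
    have "(\<Sum>k\<in>{1..2 ^ m}. \<integral>\<^sup>+x. visits f (real k * l) (real (Suc k) * l) x \<partial>lborel)
        \<le> (\<Sum>k\<in>{1..2 ^ m::nat}. ennreal (?n / l))"
    proof (rule sum_mono)
      fix k :: nat
      have "(\<integral>\<^sup>+x. visits f (real k * l) (real (Suc k) * l) x \<partial>lborel) \<le> ennreal (?n / (real (Suc k) * l - real k * l))"
        using l by (intro nn_integral_visits_le f) auto
      then show "(\<integral>\<^sup>+x. visits f (real k * l) (real (Suc k) * l) x \<partial>lborel) \<le> ennreal (?n / l)"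
        by (simp add: algebra_simps)
    qed
    also have "\<dots> = ennreal (2 ^ m * (?n / l))" using n l
      by (simp add: ennreal_of_nat_eq_real_of_nat, subst ennreal_mult[symmetric]) auto
    finally have "ennreal (l powr \<rho>) * (\<Sum>k\<in>{1..2 ^ m}. \<integral>\<^sup>+x. visits f (real k * l) (real (Suc k) * l) x \<partial>lborel)
       \<le> ennreal (l powr \<rho>) * ennreal (2 ^ m * (?n / l))" by (rule mult_left_mono) simp
    also have "\<dots> = ennreal (l powr \<rho> * (2 ^ m * (?n / l)))"
      using n l by (subst ennreal_mult) auto
    also have "l powr \<rho> * (2 ^ m * (?n / l)) = (\<alpha> powr (\<rho> - 1) * ?n) * q ^ m"
    proof -
      have 2: "q ^ m = 2 powr (real m * (2 - \<rho>))" by (simp add: q_def powr_realpow[symmetric] powr_powr mult.commute)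
      have "l = \<alpha> * 2 powr (- real m)" by (simp add: l_def powr_minus powr_realpow divide_inverse)
      then have "l powr \<rho> / l = (\<alpha> * 2 powr (- real m)) powr (\<rho> - 1)"
        using l by (simp add: powr_diff)
      also have "\<dots> = \<alpha> powr (\<rho> - 1) * 2 powr (- real m * (\<rho> - 1))"
        using \<alpha> by (simp add: powr_mult powr_powr)
      finally have *: "l powr \<rho> / l = \<alpha> powr (\<rho> - 1) * 2 powr (- real m * (\<rho> - 1))" .
      have "l powr \<rho> * (2 ^ m * (?n / l)) = (l powr \<rho> / l) * (2 ^ m * ?n)" by simp
      also have "\<dots> = \<alpha> powr (\<rho> - 1) * ?n * (2 powr real m * 2 powr (- real m * (\<rho> - 1)))"
        unfolding * by (simp add: powr_realpow)
      also have "2 powr real m * 2 powr (- real m * (\<rho> - 1)) = (2::real) powr (real m * (2 - \<rho>))"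
        by (simp add: powr_add[symmetric] algebra_simps)
      finally show ?thesis using 2 by simp
    qed
    finally show "ennreal ((\<alpha> / 2 ^ m) powr \<rho>) * (\<Sum>k\<in>{1..2 ^ m}. \<integral>\<^sup>+x. visits f (real k * (\<alpha> / 2 ^ m)) (real (Suc k) * (\<alpha> / 2 ^ m)) x \<partial>lborel)
       \<le> ennreal ((\<alpha> powr (\<rho> - 1) * ?n) * q ^ m)" by (simp add: l_def)
  qed auto
  also have "\<dots> = ennreal ((\<alpha> powr (\<rho> - 1) * ?n) * (1 / (1 - q)))"
    using q n by (intro suminf_ennreal_eq sums_mult geometric_sums) auto
  finally show ?thesis by (simp add: q_def)
qed

section \<open>From jump counts to the variation sum\<close>

lemma dyadic_scale_exists:
  assumes "0 < d" "d \<le> (\<alpha>::real)"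
  shows "\<exists>m. 2 * (\<alpha> / 2 ^ m) < d \<and> d \<le> 4 * (\<alpha> / 2 ^ m)"
proof -
  have "\<exists>m. (1/2) ^ m < d / (2 * \<alpha>)" using assms by (intro real_arch_pow_inv) auto
  then have ex: "\<exists>m. 2 * (\<alpha> / 2 ^ m) < d" using assms by (auto simp: field_simps power_one_over)
  define m where "m = (LEAST m. 2 * (\<alpha> / 2 ^ m) < d)"
  have m: "2 * (\<alpha> / 2 ^ m) < d" unfolding m_def using ex by (rule LeastI_ex)
  \<comment> \<open>\<open>m = 0\<close> is excluded by \<open>d \<le> \<alpha>\<close>, so there is
    a previous scale, and it fails the inequality; being twice as large, it yields the factor
    4.\<close>
  then obtain m' where m': "m = Suc m'" using assms by (cases m) auto
  have "\<not> 2 * (\<alpha> / 2 ^ m') < d" using not_less_Least[of m' "\<lambda>m. 2 * (\<alpha> / 2 ^ m) < d"] m' by (simp add: m_def)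
  then show ?thesis using m m' by (intro exI[of _ m]) auto
qed

lemma grid_level_between:
  assumes l: "0 < (l::real)" and u: "0 \<le> u" "u + 2 * l < w"
  shows "\<exists>k. 1 \<le> k \<and> u < real k * l \<and> real (Suc k) * l < w"
proof -
  define k where "k = nat (\<lfloor>u / l\<rfloor> + 1)"
  have "0 \<le> u / l" using l u by simp
  then have k: "u / l < real k" "real k \<le> u / l + 1" "1 \<le> k" unfolding k_def by linarith+
  then have "u < real k * l" "real k * l \<le> u + l" using l by (auto simp: field_simps)
  then show ?thesis using k u by (intro exI[of _ k]) (auto simp: algebra_simps)
qed

text \<open>One step is paid for by a single cell: at the scale with
  \<open>2 * l < d \<le> 4 * l\<close> the gap between \<open>v\<close> and \<open>w\<close>
  contains a full level cell, and \<open>d powr \<rho>\<close> is at most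
  \<open>4 powr \<rho> * l powr \<rho>\<close>.\<close>

lemma step_powr_le:
  assumes \<alpha>: "0 < \<alpha>" and v: "0 \<le> v" "v \<le> \<alpha>" "0 \<le> w" "w \<le> \<alpha>" and \<rho>: "0 < \<rho>"
  shows "ennreal (\<bar>w - v\<bar> powr \<rho>) \<le> ennreal (4 powr \<rho>) * (\<Sum>m. ennreal ((\<alpha> / 2 ^ m) powr \<rho>) *
     (\<Sum>k\<in>{1..2 ^ m}. of_bool (v < real k * (\<alpha> / 2 ^ m) \<and> real (Suc k) * (\<alpha> / 2 ^ m) < w)
        + of_bool (real (Suc k) * (\<alpha> / 2 ^ m) < v \<and> w < real k * (\<alpha> / 2 ^ m))))"
    (is "_ \<le> _ * (\<Sum>m. ?T m)")
proof (cases "v = w")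
  case False
  define d where "d = \<bar>w - v\<bar>"
  have d: "0 < d" "d \<le> \<alpha>" using False v by (auto simp: d_def)
  obtain m where m: "2 * (\<alpha> / 2 ^ m) < d" "d \<le> 4 * (\<alpha> / 2 ^ m)" using dyadic_scale_exists[OF d] by blast
  define l where "l = \<alpha> / 2 ^ m"
  have l: "0 < l" using \<alpha> by (simp add: l_def)
  obtain k where k: "1 \<le> k" "min v w < real k * l" "real (Suc k) * l < max v w"
  proof -
    have "min v w + 2 * l < max v w" "0 \<le> min v w"
      using m v by (auto simp: l_def[symmetric] d_def min_def max_def abs_if split: if_splits)
    then show ?thesis using grid_level_between[OF l] that by blast
  qed
  have "real k * l < real (Suc k) * l" using l by simp
  also have "\<dots> < max v w" by (rule k)
  also have "\<dots> \<le> 2 ^ m * l" using v by (simp add: l_def)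
  finally have "real k * l < 2 ^ m * l" .
  then have "real k < 2 ^ m" using l by simp
  then have "k \<le> 2 ^ m" by (metis less_imp_le of_nat_le_iff of_nat_numeral of_nat_power)
  let ?B = "\<lambda>k. of_bool (v < real k * l \<and> real (Suc k) * l < w) + of_bool (real (Suc k) * l < v \<and> w < real k * l) :: ennreal"
  have "1 \<le> ?B k" using k by (auto simp: min_def max_def split: if_splits)
  also have "?B k = (\<Sum>k\<in>{k}. ?B k)" by simp
  also have "\<dots> \<le> (\<Sum>k\<in>{1..2 ^ m}. ?B k)" using k \<open>k \<le> 2 ^ m\<close> by (intro sum_mono2) auto
  finally have B: "1 \<le> (\<Sum>k\<in>{1..2 ^ m}. ?B k)" .
  have "ennreal (d powr \<rho>) \<le> ennreal ((4 * l) powr \<rho>)"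
    using d m \<rho> by (intro ennreal_leI powr_mono2) (auto simp: l_def)
  also have "\<dots> = ennreal (4 powr \<rho>) * (ennreal (l powr \<rho>) * 1)"
    using l by (simp add: powr_mult ennreal_mult)
  also have "\<dots> \<le> ennreal (4 powr \<rho>) * ?T m"
    unfolding l_def[symmetric] using B by (intro mult_left_mono) auto
  also have "?T m \<le> (\<Sum>m. ?T m)"
    using sum_le_suminf[of ?T "{m}"] by simp
  finally show ?thesis by (simp add: d_def mult_left_mono)
qed simp

text \<open>The one-step estimate is summed over \<open>i\<close> and the sums are exchanged. For a
  fixed cell the upward and the downward crossings are each counted by \<open>visits\<close>, whence
  the factor 2.\<close>

lemma variation_avg_le_jump_sum:
  assumes f: "integrable lborel f" "\<And>u. 0 \<le> f u" and \<alpha>: "0 < \<alpha>" and \<rho>: "2 < \<rho>"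
    and r: "\<And>i. i \<le> n \<Longrightarrow> 0 < r i" "\<And>i. i < n \<Longrightarrow> r i \<le> r (Suc i)"
    and bd: "\<And>r. 0 < r \<Longrightarrow> avg f x r \<le> \<alpha>"
  shows "ennreal (\<Sum>i<n. \<bar>avg f x (r (Suc i)) - avg f x (r i)\<bar> powr \<rho>)
    \<le> ennreal (2 * 4 powr \<rho>) * jump_sum f \<alpha> \<rho> x"
proof -
  define v where "v i = avg f x (r i)" for i
  define L where "L m = \<alpha> / 2 ^ m" for m :: nat
  have L: "0 < L m" for m using \<alpha> by (simp add: L_def)
  let ?up = "\<lambda>m k i. v i < real k * L m \<and> real (Suc k) * L m < v (Suc i)"
  let ?dn = "\<lambda>m k i. real (Suc k) * L m < v i \<and> v (Suc i) < real k * L m"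
  have v: "0 \<le> v i" "v i \<le> \<alpha>" if "i \<le> n" for i
    using that r avg_nonneg[OF f] bd by (auto simp: v_def)
  have lev: "real k * L m < real (Suc k) * L m" for k m using L by (simp add: algebra_simps)
  have crossings: "(\<Sum>i<n. of_bool (?up m k i) + of_bool (?dn m k i) :: ennreal)
      \<le> 2 * visits f (real k * L m) (real (Suc k) * L m) x" for m k
  proof -
    \<comment> \<open>The high radius of an upward step is its endpoint, hence the image under
      \<open>Suc\<close>; a later upward step starts low, which separates the two.\<close>
    have "of_nat (card (Suc ` {i\<in>{..<n}. ?up m k i})) \<le> visits f (real k * L m) (real (Suc k) * L m) x"
      using r lev
      by (intro card_high_le_visits[OF f(1), where n=n and r=r]) (auto simp: v_def intro: Suc_leI)
    moreover have "card (Suc ` {i\<in>{..<n}. ?up m k i}) = card {i\<in>{..<n}. ?up m k i}"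
      by (intro card_image) simp
    moreover have "of_nat (card {i\<in>{..<n}. ?dn m k i}) \<le> visits f (real k * L m) (real (Suc k) * L m) x"
    proof (rule card_high_le_visits[OF f(1), where n=n and r=r])
      fix i i' assume "i \<in> {i\<in>{..<n}. ?dn m k i}" "i < i'"
      then show "\<exists>j. i \<le> j \<and> j \<le> i' \<and> avg f x (r j) < real k * L m"
        by (intro exI[of _ "Suc i"]) (auto simp: v_def)
    qed (use r lev in \<open>auto simp: v_def\<close>)
    moreover have "(\<Sum>i<n. of_bool (?up m k i) + of_bool (?dn m k i) :: ennreal)
       = of_nat (card {i\<in>{..<n}. ?up m k i}) + of_nat (card {i\<in>{..<n}. ?dn m k i})"
      by (simp add: sum.distrib sum_of_bool_eq Int_def del: of_nat_Suc)
    ultimately show ?thesis unfolding mult_2 by (simp add: add_mono)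
  qed
  have "ennreal (\<Sum>i<n. \<bar>v (Suc i) - v i\<bar> powr \<rho>) = (\<Sum>i<n. ennreal (\<bar>v (Suc i) - v i\<bar> powr \<rho>))"
    by (subst sum_ennreal) auto
  also have "\<dots> \<le> (\<Sum>i<n. ennreal (4 powr \<rho>) * (\<Sum>m. ennreal (L m powr \<rho>) *
     (\<Sum>k\<in>{1..2 ^ m}. of_bool (?up m k i) + of_bool (?dn m k i))))"
    unfolding L_def using v \<rho> \<alpha> by (intro sum_mono step_powr_le) auto
  also have "\<dots> = ennreal (4 powr \<rho>) * (\<Sum>m. \<Sum>i<n. ennreal (L m powr \<rho>) *
     (\<Sum>k\<in>{1..2 ^ m}. of_bool (?up m k i) + of_bool (?dn m k i)))"
    by (subst suminf_sum) (auto simp: sum_distrib_left)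
  also have "\<dots> = ennreal (4 powr \<rho>) * (\<Sum>m. ennreal (L m powr \<rho>) *
     (\<Sum>k\<in>{1..2 ^ m}. \<Sum>i<n. of_bool (?up m k i) + of_bool (?dn m k i)))"
    by (subst sum_distrib_left[symmetric], subst sum.swap) simp
  also have "\<dots> \<le> ennreal (4 powr \<rho>) * (\<Sum>m. ennreal (L m powr \<rho>) *
     (\<Sum>k\<in>{1..2 ^ m}. 2 * visits f (real k * L m) (real (Suc k) * L m) x))"
    using crossings by (intro mult_left_mono suminf_le sum_mono) auto
  also have "\<dots> = ennreal (4 powr \<rho>) * (\<Sum>m. 2 * (ennreal (L m powr \<rho>) *
     (\<Sum>k\<in>{1..2 ^ m}. visits f (real k * L m) (real (Suc k) * L m) x)))"
    by (simp only: sum_distrib_left[symmetric] mult.left_commute)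
  also have "\<dots> = ennreal (4 powr \<rho>) * (2 * jump_sum f \<alpha> \<rho> x)"
    unfolding jump_sum_def L_def by (subst ennreal_suminf_cmult) simp
  also have "\<dots> = ennreal (2 * 4 powr \<rho>) * jump_sum f \<alpha> \<rho> x"
    by (simp add: ennreal_mult mult_ac)
  finally show ?thesis by (simp add: v_def)
qed

lemma averages_weak_type:
  assumes \<rho>: "2 < \<rho>"
  shows "\<exists>C>0. \<forall>f \<alpha>. integrable lborel f \<longrightarrow> (\<forall>u. 0 \<le> f u) \<longrightarrow> 0 < \<alpha> \<longrightarrow>
    (\<exists>E\<in>sets borel. emeasure lborel E \<le> ennreal (C * (\<integral>u. f u \<partial>lborel) / \<alpha>) \<and>
      (\<forall>x. x \<notin> E \<longrightarrow> avg_controlled \<rho> \<alpha> f x))"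
proof -
  define q where "q = (2::real) powr (2 - \<rho>)"
  have q: "0 \<le> q" "q < 1" using \<rho> powr_less_mono[of "2-\<rho>" 0 "2::real"] by (auto simp: q_def)
  define B where "B = 2 * 4 powr \<rho>"
  \<comment> \<open>The 2 pays for the bound on the averages, \<open>B / (1 - q)\<close> for the
    geometric sum.\<close>
  define C where "C = 2 + B / (1 - q)"
  have B: "0 < B" by (simp add: B_def)
  have "C > 0" using q B by (auto simp: C_def intro!: add_pos_nonneg)
  moreover have "\<exists>E\<in>sets borel. emeasure lborel E \<le> ennreal (C * (\<integral>u. f u \<partial>lborel) / \<alpha>) \<and>
      (\<forall>x. x \<notin> E \<longrightarrow> avg_controlled \<rho> \<alpha> f x)"
    if f: "integrable lborel f" "\<And>u. 0 \<le> f u" and \<alpha>: "0 < \<alpha>" for f \<alpha>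
  proof -
    let ?n = "\<integral>u. f u \<partial>lborel"
    have n: "0 \<le> ?n" using f by (intro Bochner_Integration.integral_nonneg) auto
    define c where "c = B / \<alpha> powr \<rho>"
    have c: "0 < c" using B \<alpha> by (simp add: c_def)
    \<comment> \<open>A single average above \<alpha> is one visit over
      \<open>[\<alpha> / 2, \<alpha>]\<close>, so the maximal inequality comes from the same
      count.\<close>
    define E1 where "E1 = {x. 1 \<le> 1 * visits f (\<alpha> / 2) \<alpha> x}"
    define E2 where "E2 = {x. 1 \<le> ennreal c * jump_sum f \<alpha> \<rho> x}"
    have [measurable]: "E1 \<in> sets borel" "E2 \<in> sets borel"
      unfolding E1_def E2_def by measurable
    have "emeasure lborel E1 \<le> 1 * (\<integral>\<^sup>+x\<in>UNIV. visits f (\<alpha> / 2) \<alpha> x \<partial>lborel)"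
      unfolding E1_def using nn_integral_Markov_inequality[of "visits f (\<alpha> / 2) \<alpha>" UNIV lborel 1] by simp
    also have "\<dots> \<le> ennreal (?n / (\<alpha> - \<alpha> / 2))"
      using nn_integral_visits_le[OF f, of "\<alpha> / 2" \<alpha>] \<alpha> by simp
    also have "?n / (\<alpha> - \<alpha> / 2) = 2 * ?n / \<alpha>" by (simp add: field_simps)
    finally have e1: "emeasure lborel E1 \<le> ennreal (2 * ?n / \<alpha>)" .
    have "emeasure lborel E2 \<le> ennreal c * (\<integral>\<^sup>+x\<in>UNIV. jump_sum f \<alpha> \<rho> x \<partial>lborel)"
      unfolding E2_def using nn_integral_Markov_inequality[of "jump_sum f \<alpha> \<rho>" UNIV lborel "ennreal c"] by simp
    also have "\<dots> \<le> ennreal c * ennreal (\<alpha> powr (\<rho> - 1) * ?n / (1 - q))"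
      using nn_integral_jump_sum_le[OF f \<alpha> \<rho>] by (intro mult_left_mono) (auto simp: q_def)
    also have "\<dots> = ennreal (c * (\<alpha> powr (\<rho> - 1) * ?n / (1 - q)))"
      using c q n by (subst ennreal_mult) auto
    also have "c * (\<alpha> powr (\<rho> - 1) * ?n / (1 - q)) = B / (1 - q) * ?n / \<alpha>"
      using \<alpha> by (simp add: c_def powr_diff)
    finally have e2: "emeasure lborel E2 \<le> ennreal (B / (1 - q) * ?n / \<alpha>)" .
    have "emeasure lborel (E1 \<union> E2) \<le> emeasure lborel E1 + emeasure lborel E2"
      by (rule emeasure_subadditive) auto
    also have "\<dots> \<le> ennreal (2 * ?n / \<alpha>) + ennreal (B / (1 - q) * ?n / \<alpha>)"
      using e1 e2 by (rule add_mono)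
    also have "\<dots> = ennreal (C * ?n / \<alpha>)"
      using n \<alpha> B q by (subst ennreal_plus[symmetric]) (auto simp: C_def add_divide_distrib distrib_right)
    finally have "emeasure lborel (E1 \<union> E2) \<le> ennreal (C * ?n / \<alpha>)" .
    moreover have "E1 \<union> E2 \<in> sets borel" by simp
    moreover have "avg_controlled \<rho> \<alpha> f x"
      if x: "x \<notin> E1 \<union> E2" for x
    proof -
      have bd: "avg f x r \<le> \<alpha>" if "0 < r" for r
      proof (rule ccontr)
        assume "\<not> avg f x r \<le> \<alpha>"
        then have "of_nat (card {0::nat}) \<le> visits f (\<alpha> / 2) \<alpha> x"
          using that \<alpha> by (intro card_high_le_visits[OF f(1), where n=0 and r="\<lambda>_. r"]) auto
        with x show False by (auto simp: E1_def)
      qed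
      have "(\<Sum>i<n. \<bar>avg f x (r (Suc i)) - avg f x (r i)\<bar> powr \<rho>) \<le> \<alpha> powr \<rho>"
        if "\<forall>i\<le>n. 0 < r i" "\<forall>i<n. r i \<le> r (Suc i)" for n r
      proof -
        have "ennreal (\<Sum>i<n. \<bar>avg f x (r (Suc i)) - avg f x (r i)\<bar> powr \<rho>) \<le> ennreal B * jump_sum f \<alpha> \<rho> x"
          unfolding B_def using that bd by (intro variation_avg_le_jump_sum[OF f \<alpha> \<rho>]) auto
        also have "ennreal B = ennreal (\<alpha> powr \<rho>) * ennreal c"
          using \<alpha> c by (subst ennreal_mult[symmetric]) (auto simp: c_def)
        also have "ennreal (\<alpha> powr \<rho>) * ennreal c * jump_sum f \<alpha> \<rho> x \<le> ennreal (\<alpha> powr \<rho>) * 1"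
          unfolding mult.assoc using x by (intro mult_left_mono) (auto simp: E2_def)
        finally show ?thesis by (simp add: ennreal_le_iff)
      qed
      with bd show ?thesis unfolding avg_controlled_def by blast
    qed
    ultimately show ?thesis by blast
  qed
  ultimately show ?thesis by blast
qed

section \<open>The Ornstein--Uhlenbeck kernel and the Gaussian measure\<close>

text \<open>Quasi-concavity makes \<open>y\<close> rise up to its maximum and fall afterwards, so
  the sum telescopes on both sides.\<close>

lemma sum_abs_diff_unimodal_le:
  fixes y :: "nat \<Rightarrow> real"
  assumes bd: "\<And>i. i \<le> n \<Longrightarrow> 0 \<le> y i \<and> y i \<le> B"
    and qc: "\<And>i j k. i \<le> j \<Longrightarrow> j \<le> k \<Longrightarrow> k \<le> n \<Longrightarrow> min (y i) (y k) \<le> y j"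
  shows "(\<Sum>i<n. \<bar>y (Suc i) - y i\<bar>) \<le> 2 * B"
proof -
  have "Max (y ` {..n}) \<in> y ` {..n}" by (intro Max_in) auto
  then obtain m where m: "m \<le> n" "y m = Max (y ` {..n})" by (metis atMost_iff imageE)
  have max: "y i \<le> y m" if "i \<le> n" for i using that m by simp
  have up: "y i \<le> y (Suc i)" if "i < m" for i
    using qc[of i "Suc i" m] that m max[of i] by simp
  have down: "y (Suc i) \<le> y i" if "m \<le> i" "i < n" for i
    using qc[of m i "Suc i"] that m max[of "Suc i"] by simp
  have "{..<n} = {..<m} \<union> {m..<n}" using m by auto
  then have "(\<Sum>i<n. \<bar>y (Suc i) - y i\<bar>) = (\<Sum>i<m. \<bar>y (Suc i) - y i\<bar>) + (\<Sum>i=m..<n. \<bar>y (Suc i) - y i\<bar>)"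
    by (simp add: sum.union_disjoint ivl_disj_int)
  also have "(\<Sum>i<m. \<bar>y (Suc i) - y i\<bar>) = (\<Sum>i<m. y (Suc i) - y i)"
    using up by (intro sum.cong) auto
  also have "\<dots> = y m - y 0" by (rule sum_lessThan_telescope)
  also have "(\<Sum>i=m..<n. \<bar>y (Suc i) - y i\<bar>) = - (\<Sum>i=m..<n. y (Suc i) - y i)"
    unfolding sum_negf[symmetric] using down by (intro sum.cong) auto
  also have "(\<Sum>i=m..<n. y (Suc i) - y i) = y n - y m" using m by (intro sum_Suc_diff') auto
  finally have "(\<Sum>i<n. \<bar>y (Suc i) - y i\<bar>) = 2 * y m - y 0 - y n" by simp
  then show ?thesis using bd[of 0] bd[of n] bd[OF m(1)] by linarith
qed

text \<open>This is \<open>tanh (t / 2)\<close>. Writing \<open>s\<close> for it,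
  \<open>exp (- t)\<close> is \<open>(1 - s) / (1 + s)\<close>, and the exponent of the kernel
  becomes a combination of \<open>s\<close> and \<open>1 / s\<close>.\<close>

definition half_tanh :: "real \<Rightarrow> real" where
  "half_tanh t = (1 - exp (- t)) / (1 + exp (- t))"

lemma one_plus_exp_pos: "0 < 1 + exp (t::real)"
  by (smt (verit) exp_gt_zero)

lemma half_tanh_bounds: "0 < t \<Longrightarrow> 0 < half_tanh t" "half_tanh t < 1"
  using one_plus_exp_pos[of "-t"] by (auto simp: half_tanh_def field_simps)

lemma half_tanh_mono:
  assumes "t \<le> t'" shows "half_tanh t \<le> half_tanh t'"
proof -
  have "exp (- t') \<le> exp (- t)" using assms by simp
  then show ?thesis unfolding half_tanh_def
    using one_plus_exp_pos[of "-t"] one_plus_exp_pos[of "-t'"] by (simp add: divide_simps algebra_simps)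
qed

lemma exp_half_tanh: "exp (- t) = (1 - half_tanh t) / (1 + half_tanh t)"
  using one_plus_exp_pos[of "-t"] by (simp add: half_tanh_def field_simps)

lemma one_minus_exp_half_tanh:
  assumes "0 < t"
  shows "1 - exp (- 2 * t) = 4 * half_tanh t / (1 + half_tanh t)\<^sup>2"
proof -
  define e where "e = exp (- t)"
  have e: "0 < 1 + e" using one_plus_exp_pos by (simp add: e_def)
  have "exp (- 2 * t) = e\<^sup>2" by (simp add: e_def power2_eq_square exp_add[symmetric])
  moreover have "1 + half_tanh t = 2 / (1 + e)" using e by (simp add: half_tanh_def e_def field_simps)
  moreover have "4 * ((1 - e) / (1 + e)) / (2 / (1 + e))\<^sup>2 = 1 - e\<^sup>2"
    using e by (simp add: power_divide) (simp add: divide_simps power2_eq_square algebra_simps)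
  ultimately show ?thesis by (simp add: half_tanh_def e_def)
qed

text \<open>In the variable \<open>v = ln (half_tanh t)\<close> the kernel is a factor in \<open>[1, 2]\<close> times the exponential of a
  concave function, so as a function of time it essentially rises once and falls once.\<close>
lemma OU_kernel_half_tanh:
  assumes "0 < t"
  shows "OU_kernel t x u = (1 + half_tanh t) * exp ((x\<^sup>2 + u\<^sup>2) / 4 - ln 2 - ln (half_tanh t) / 2
     - (u - x)\<^sup>2 / 8 * exp (- ln (half_tanh t)) - (u + x)\<^sup>2 / 8 * exp (ln (half_tanh t)))"
proof -
  define s where "s = half_tanh t"
  have s: "0 < s" using half_tanh_bounds(1)[OF assms] by (simp add: s_def)
  have *: "sqrt (1 - exp (- 2 * t)) = 2 * sqrt s / (1 + s)"
    unfolding one_minus_exp_half_tanh[OF assms] s_def[symmetric]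
    using s by (simp add: real_sqrt_divide real_sqrt_mult)
  have **: "- (1/2) * (exp (- t) * u - x)\<^sup>2 / (1 - exp (-2 * t)) = - (((1 - s) * u - (1 + s) * x)\<^sup>2) / (8 * s)"
  proof -
    have "exp (- t) * u - x = ((1 - s) * u - (1 + s) * x) / (1 + s)"
      using s unfolding exp_half_tanh s_def[symmetric] by (simp add: field_simps)
    then show ?thesis unfolding one_minus_exp_half_tanh[OF assms] s_def[symmetric]
      using s by (simp add: power_divide)
  qed
  \<comment> \<open>Since \<open>(1 - s) * u - (1 + s) * x = (u - x) - s * (u + x)\<close>, the
    cross term of the square is free of \<open>s\<close> after the division; together with
    \<open>R x\<close> it gives the symmetric \<open>(x^2 + u^2) / 4\<close>.\<close>
  have ex: "R x + - (((1 - s) * u - (1 + s) * x)\<^sup>2) / (8 * s) = (x\<^sup>2 + u\<^sup>2) / 4 - (u - x)\<^sup>2 / 8 / s - (u + x)\<^sup>2 / 8 * s"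
    using s by (simp add: R_def field_simps power2_eq_square)
  have "exp (- ln 2 - ln s / 2) = 1 / (2 * sqrt s)"
  proof -
    have "sqrt s = exp (ln s / 2)" using s by (simp add: powr_half_sqrt[symmetric] powr_def)
    moreover have "exp (- ln 2 - ln s / 2) = exp (- ln 2) * exp (- (ln s / 2))"
      by (simp flip: exp_add)
    moreover have "exp (- ln 2) = 1 / (2::real)" by (simp add: exp_minus)
    moreover have "exp (- (ln s / 2)) = 1 / exp (ln s / 2)" by (simp add: exp_minus inverse_eq_divide)
    ultimately show ?thesis by simp
  qed
  moreover have "exp ((x\<^sup>2 + u\<^sup>2) / 4 - ln 2 - ln s / 2 - (u - x)\<^sup>2 / 8 * exp (- ln s) - (u + x)\<^sup>2 / 8 * exp (ln s))
     = exp (- ln 2 - ln s / 2) * exp ((x\<^sup>2 + u\<^sup>2) / 4 - (u - x)\<^sup>2 / 8 / s - (u + x)\<^sup>2 / 8 * s)"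
  proof -
    have "exp (- ln s) = 1 / s" using s by (simp add: exp_minus inverse_eq_divide)
    then show ?thesis unfolding exp_add[symmetric] using s by simp
  qed
  ultimately have "(1 + s) * exp ((x\<^sup>2 + u\<^sup>2) / 4 - ln 2 - ln s / 2 - (u - x)\<^sup>2 / 8 * exp (- ln s) - (u + x)\<^sup>2 / 8 * exp (ln s))
     = (1 + s) / (2 * sqrt s) * exp ((x\<^sup>2 + u\<^sup>2) / 4 - (u - x)\<^sup>2 / 8 / s - (u + x)\<^sup>2 / 8 * s)"
    by simp
  also have "\<dots> = OU_kernel t x u"
    unfolding OU_kernel_def * ** ex[symmetric] exp_add by simp
  finally show ?thesis by (simp add: s_def)
qed

lemma exp_concave_between:
  fixes a b c d :: real
  assumes "0 \<le> b" "0 \<le> d" "u \<le> v" "v \<le> w"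
  defines "F \<equiv> (\<lambda>v. a - v / 2 - b * exp (- v) - d * exp v)"
  shows "min (F u) (F w) \<le> F v"
proof -
  \<comment> \<open>The negative of \<open>F\<close> is convex because \<open>b\<close> and
    \<open>d\<close> are nonnegative, and a convex function on a segment is at most its larger
    endpoint value.\<close>
  have "convex_on {u..w} (\<lambda>v. v / 2 + b * exp (- v) + d * exp v - a)"
  proof (rule convex_on_realI)
    show "((\<lambda>v. v / 2 + b * exp (- v) + d * exp v - a) has_real_derivative 1 / 2 - b * exp (- v) + d * exp v) (at v)" for v
      by (auto intro!: derivative_eq_intros)
    show "1 / 2 - b * exp (- v) + d * exp v \<le> 1 / 2 - b * exp (- v') + d * exp v'" if "v \<le> v'" for v v'
      using assms(1,2) that by (intro add_mono diff_mono mult_left_mono) auto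
  qed simp
  from convex_on_le_max[OF this, of v] show ?thesis
    using assms(3,4) unfolding F_def by (auto simp: min_def max_def split: if_splits)
qed

text \<open>Product rule with 5 = 2 * 2 + 1: the factor \<open>1 + s\<close> is at most 2 and
  multiplies the variation \<open>2 * B\<close> of the unimodal factor; the latter is at most
  \<open>B\<close> and multiplies the total increase of \<open>s\<close>, which is at most
  1.\<close>

lemma variation_OU_kernel_le:
  assumes t: "\<And>i. i \<le> n \<Longrightarrow> 0 < t i" "\<And>i. i < n \<Longrightarrow> t i \<le> t (Suc i)"
    and B: "\<And>i. i \<le> n \<Longrightarrow> OU_kernel (t i) x u \<le> B"
  shows "(\<Sum>i<n. \<bar>OU_kernel (t (Suc i)) x u - OU_kernel (t i) x u\<bar>) \<le> 5 * B"
proof -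
  define s where "s i = half_tanh (t i)" for i
  define m where "m i = exp ((x\<^sup>2 + u\<^sup>2) / 4 - ln 2 - ln (s i) / 2
     - (u - x)\<^sup>2 / 8 * exp (- ln (s i)) - (u + x)\<^sup>2 / 8 * exp (ln (s i)))" for i
  have s: "0 < s i" "s i < 1" if "i \<le> n" for i using half_tanh_bounds t that by (auto simp: s_def)
  have tm: "t i \<le> t j" if "i \<le> j" "j \<le> n" for i j
    using that
  proof (induction j rule: dec_induct)
    case (step j)
    then show ?case using t(2)[of j] by simp
  qed simp
  have K: "OU_kernel (t i) x u = (1 + s i) * m i" if "i \<le> n" for i
    using OU_kernel_half_tanh[OF t(1)[OF that]] by (simp add: s_def m_def)
  have m: "0 \<le> m i" "m i \<le> B" if "i \<le> n" for i
  proof -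
    show "0 \<le> m i" by (simp add: m_def)
    then have "1 * m i \<le> (1 + s i) * m i" using s[OF that] by (intro mult_right_mono) auto
    then show "m i \<le> B" using K[OF that] B[OF that] by simp
  qed
  have "(\<Sum>i<n. \<bar>m (Suc i) - m i\<bar>) \<le> 2 * B"
  proof (rule sum_abs_diff_unimodal_le)
    fix i j k assume ijk: "i \<le> j" "j \<le> k" "k \<le> n"
    have "ln (s i) \<le> ln (s j)" "ln (s j) \<le> ln (s k)"
      using ijk s half_tanh_mono tm by (auto simp: s_def)
    from exp_concave_between[OF _ _ this, of "(u - x)\<^sup>2 / 8" "(u + x)\<^sup>2 / 8" "(x\<^sup>2 + u\<^sup>2) / 4 - ln 2"]
    show "min (m i) (m k) \<le> m j" by (auto simp: m_def min_def split: if_splits)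
  qed (use m in auto)
  moreover have "(\<Sum>i<n. s (Suc i) - s i) = s n - s 0" by (rule sum_lessThan_telescope)
  then have "(\<Sum>i<n. s (Suc i) - s i) \<le> 1" using s[of 0] s[of n] by simp
  ultimately have "2 * (\<Sum>i<n. \<bar>m (Suc i) - m i\<bar>) + B * (\<Sum>i<n. s (Suc i) - s i) \<le> 5 * B"
    using m[of 0] mult_left_mono[of "\<Sum>i<n. s (Suc i) - s i" 1 B] by simp
  moreover have "(\<Sum>i<n. \<bar>OU_kernel (t (Suc i)) x u - OU_kernel (t i) x u\<bar>)
     \<le> (\<Sum>i<n. 2 * \<bar>m (Suc i) - m i\<bar> + B * (s (Suc i) - s i))"
  proof (rule sum_mono)
    fix i assume "i \<in> {..<n}"
    then have i: "i < n" by simp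
    have ss: "s i \<le> s (Suc i)" using half_tanh_mono t(2)[OF i] by (simp add: s_def)
    have "OU_kernel (t (Suc i)) x u - OU_kernel (t i) x u
      = (1 + s (Suc i)) * (m (Suc i) - m i) + m i * (s (Suc i) - s i)"
      using K[of i] K[of "Suc i"] i by (simp add: algebra_simps)
    then have "\<bar>OU_kernel (t (Suc i)) x u - OU_kernel (t i) x u\<bar>
      \<le> \<bar>(1 + s (Suc i)) * (m (Suc i) - m i)\<bar> + \<bar>m i * (s (Suc i) - s i)\<bar>"
      using abs_triangle_ineq by simp
    also have "\<dots> = (1 + s (Suc i)) * \<bar>m (Suc i) - m i\<bar> + m i * (s (Suc i) - s i)"
      using s[of "Suc i"] m[of i] ss i by (simp add: abs_mult)
    also have "\<dots> \<le> 2 * \<bar>m (Suc i) - m i\<bar> + B * (s (Suc i) - s i)"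
      using s[of "Suc i"] m[of i] ss i by (intro add_mono mult_right_mono) auto
    finally show "\<bar>OU_kernel (t (Suc i)) x u - OU_kernel (t i) x u\<bar>
      \<le> 2 * \<bar>m (Suc i) - m i\<bar> + B * (s (Suc i) - s i)" .
  qed
  ultimately show ?thesis by (simp add: sum.distrib sum_distrib_left)
qed

section \<open>Pointwise size of the kernel\<close>

lemma one_minus_exp_pos: "0 < t \<Longrightarrow> 0 < 1 - exp (- 2 * t :: real)"
  by simp

text \<open>Let \<open>s = sqrt (1 - exp (- 2 * t))\<close>. If \<open>s\<close> is not small, the
  exponential is bounded by 1. Otherwise \<open>1 - exp (- t) \<le> s^2\<close> makes the drift
  \<open>(1 - exp (- t)) * x\<close> at most half the lower bound for
  \<open>exp (- t) * |u - x|\<close>, and the Gaussian factor exchanges \<open>1 / s\<close> for a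
  reciprocal distance.\<close>

lemma OU_kernel_le:
  assumes t: "0 < t"
    and reg: "1 / (2 * (1 + \<bar>x\<bar>)) \<le> sqrt (1 - exp (- 2 * t)) \<or> 1 / (1 + \<bar>x\<bar>) \<le> \<bar>u - x\<bar>"
  shows "OU_kernel t x u \<le> 4 * (1 + \<bar>x\<bar>) * exp (R x)"
proof -
  define s where "s = sqrt (1 - exp (- 2 * t))"
  define r where "r = exp (- t)"
  have s: "0 < s" using one_minus_exp_pos[OF t] by (simp add: s_def)
  have r: "0 < r" "r < 1" using t by (auto simp: r_def)
  have "exp (- 2 * t) = r\<^sup>2" by (simp add: r_def power2_eq_square exp_add[symmetric])
  then have s2: "s\<^sup>2 = 1 - r\<^sup>2" using one_minus_exp_pos[OF t] by (simp add: s_def)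
  have K: "OU_kernel t x u = exp (R x) * (exp (- (((r * u - x) / s)\<^sup>2) / 2) / s)"
    using one_minus_exp_pos[OF t] by (simp add: OU_kernel_def r_def s_def power_divide)
  have "exp (- (((r * u - x) / s)\<^sup>2) / 2) / s \<le> 4 * (1 + \<bar>x\<bar>)"
  proof (cases "1 / (2 * (1 + \<bar>x\<bar>)) \<le> s")
    case True
    have "exp (- (((r * u - x) / s)\<^sup>2) / 2) / s \<le> 1 / s"
      using s by (intro divide_right_mono) auto
    also have "\<dots> \<le> 2 * (1 + \<bar>x\<bar>)" using True s by (simp add: field_simps)
    finally show ?thesis by simp
  next
    case False
    then have ux: "1 / (1 + \<bar>x\<bar>) \<le> \<bar>u - x\<bar>" and sl: "s < 1 / (2 * (1 + \<bar>x\<bar>))"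
      using reg by (auto simp: s_def)
    have p: "0 < 1 + \<bar>x\<bar>" by simp
    have "1 / (2 * (1 + \<bar>x\<bar>)) \<le> 1 / 2" by (simp add: field_simps)
    then have "s \<le> 1 / 2" by (rule order_trans[OF less_imp_le[OF sl]])
    then have "s\<^sup>2 \<le> (1/2)\<^sup>2" using s by (intro power_mono) auto
    then have "(1/2)\<^sup>2 \<le> r\<^sup>2" using s2 by (simp add: power2_eq_square)
    then have r2: "1/2 \<le> r" using r by (simp add: abs_le_square_iff[symmetric])
    have "s\<^sup>2 \<le> (1 / (2 * (1 + \<bar>x\<bar>)))\<^sup>2" using s sl by (intro power_mono) auto
    moreover have "1 - r \<le> s\<^sup>2" using r s2 by (simp add: power2_eq_square)
    ultimately have "(1 - r) * \<bar>x\<bar> \<le> (1 / (2 * (1 + \<bar>x\<bar>)))\<^sup>2 * (1 + \<bar>x\<bar>)"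
      using r by (intro mult_mono) auto
    also have "(1 / (2 * p))\<^sup>2 * p = 1 / (4 * p)" if "0 < p" for p :: real
      using that by (simp add: power2_eq_square)
    from this[OF p] have "(1 / (2 * (1 + \<bar>x\<bar>)))\<^sup>2 * (1 + \<bar>x\<bar>) = 1 / (4 * (1 + \<bar>x\<bar>))" .
    finally have rx: "\<bar>(1 - r) * x\<bar> \<le> 1 / (4 * (1 + \<bar>x\<bar>))" using r by (simp add: abs_mult)
    have "1/2 * (1 / (1 + \<bar>x\<bar>)) \<le> r * \<bar>u - x\<bar>" using r2 ux by (intro mult_mono) auto
    then have "1 / (2 * (1 + \<bar>x\<bar>)) \<le> \<bar>r * (u - x)\<bar>" using r by (simp add: abs_mult)
    moreover have "\<bar>r * (u - x)\<bar> - \<bar>(1 - r) * x\<bar> \<le> \<bar>r * (u - x) - (1 - r) * x\<bar>"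
      by (rule abs_triangle_ineq2)
    moreover have "r * (u - x) - (1 - r) * x = r * u - x" by (simp add: algebra_simps)
    ultimately have "1 / (2 * (1 + \<bar>x\<bar>)) - 1 / (4 * (1 + \<bar>x\<bar>)) \<le> \<bar>r * u - x\<bar>" using rx by simp
    moreover have "1 / (2 * (1 + \<bar>x\<bar>)) - 1 / (4 * (1 + \<bar>x\<bar>)) = 1 / (4 * (1 + \<bar>x\<bar>))"
      using p by (simp add: field_simps)
    ultimately have d: "1 / (4 * (1 + \<bar>x\<bar>)) \<le> \<bar>r * u - x\<bar>" by simp
    define z where "z = (r * u - x) / s"
    have d0: "0 < \<bar>r * u - x\<bar>" using d p by (smt (verit) divide_pos_pos)
    have z: "0 < \<bar>z\<bar>" using d0 s by (simp add: z_def)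
    \<comment> \<open>This leads to \<open>exp (- z^2 / 2) \<le> 1 / |z|\<close>, which cancels the
      singular factor \<open>1 / s\<close>.\<close>
    have "0 \<le> (\<bar>z\<bar> - 1)\<^sup>2" by simp
    then have "\<bar>z\<bar> \<le> 1 + z\<^sup>2 / 2" by (simp add: power2_diff)
    also have "\<dots> \<le> exp (z\<^sup>2 / 2)" by (rule exp_ge_add_one_self)
    finally have "exp (- (z\<^sup>2) / 2) \<le> 1 / \<bar>z\<bar>" using z by (simp add: exp_minus field_simps)
    then have "exp (- (z\<^sup>2) / 2) / s \<le> 1 / \<bar>z\<bar> / s" using s by (intro divide_right_mono) auto
    also have "\<dots> = 1 / \<bar>r * u - x\<bar>" using s by (simp add: z_def)
    also have "\<dots> \<le> 4 * (1 + \<bar>x\<bar>)" using d d0 p by (simp add: field_simps)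
    finally show ?thesis by (simp add: z_def)
  qed
  then have "exp (R x) * (exp (- (((r * u - x) / s)\<^sup>2) / 2) / s) \<le> exp (R x) * (4 * (1 + \<bar>x\<bar>))"
    by (rule mult_left_mono) simp
  then show ?thesis unfolding K by (simp add: mult_ac)
qed

section \<open>Tails of the Gaussian measure\<close>

lemma gauss_eq: "gauss = density lborel std_normal_density"
  unfolding gauss_def by (intro density_cong) (auto simp: normal_density_def R_def)

lemma prob_space_gauss: "prob_space gauss"
  unfolding gauss_eq by (rule prob_space_normal_density) simp

lemma sets_gauss [simp, measurable_cong]: "sets gauss = sets borel"
  by (simp add: gauss_def)

lemma space_gauss [simp]: "space gauss = UNIV"
  by (simp add: gauss_def)

text \<open>With \<open>w = u - y\<close>, the square \<open>(w - 1)^2\<close> being nonnegative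
  gives \<open>u^2 / 2 \<ge> y^2 / 2 + (1 + y) * w - 1 / 2\<close>. The density is thus dominated by
  an exponential of rate \<open>1 + y\<close>, which stays positive at \<open>y = 0\<close>.\<close>

lemma emeasure_gauss_half_line_le:
  assumes y: "0 \<le> y"
  shows "emeasure gauss {y<..} \<le> ennreal (exp (1/2) * exp (- R y) / (1 + y))"
proof -
  define c where "c = exp (1/2 :: real) * exp (- R y)"
  define k where "k = 1 + y"
  have k: "0 < k" using y by (simp add: k_def)
  have "emeasure gauss {y<..} = (\<integral>\<^sup>+u. ennreal (std_normal_density u) * indicator {y<..} u \<partial>lborel)"
    unfolding gauss_eq by (subst emeasure_density) auto
  also have "\<dots> \<le> (\<integral>\<^sup>+u. ennreal (c * exp (- k * (u - y))) * indicator {y..} u \<partial>lborel)"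
  proof (intro nn_integral_mono)
    fix u :: real
    have "std_normal_density u \<le> c * exp (- k * (u - y))" if "y < u"
    proof -
      have "0 \<le> (u - y - 1)\<^sup>2" by simp
      then have "- u\<^sup>2 / 2 \<le> 1/2 + - R y + - k * (u - y)"
        by (simp add: R_def k_def power2_eq_square field_simps)
      then have "exp (- u\<^sup>2 / 2) \<le> c * exp (- k * (u - y))"
        unfolding c_def exp_add[symmetric] by simp
      moreover have "std_normal_density u \<le> 1 * exp (- u\<^sup>2 / 2)"
        unfolding std_normal_density_def using pi_ge_two by (intro mult_right_mono) auto
      ultimately show ?thesis by simp
    qed
    then show "ennreal (std_normal_density u) * indicator {y<..} u \<le> ennreal (c * exp (- k * (u - y))) * indicator {y..} u"
      by (auto simp: indicator_def intro: ennreal_leI)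
  qed
  also have "\<dots> = ennreal (0 - (- (c / k) * exp (- k * (y - y))))"
  proof (rule nn_integral_FTC_atLeast[where F="\<lambda>u. - (c / k) * exp (- k * (u - y))"])
    fix u
    show "((\<lambda>u. - (c / k) * exp (- k * (u - y))) has_real_derivative c * exp (- k * (u - y))) (at u)"
      by (rule derivative_eq_intros refl)+ (use k in simp)
    show "0 \<le> c * exp (- k * (u - y))" by (simp add: c_def)
  next
    have "filterlim (\<lambda>u. k * (u - y)) at_top at_top"
      using k by real_asymp
    then have "((\<lambda>u. exp (- (k * (u - y)))) \<longlongrightarrow> 0) at_top"
      by (intro filterlim_compose[OF exp_at_bot]) (simp add: filterlim_uminus_at_bot)
    then have "((\<lambda>u. - (c / k) * exp (- (k * (u - y)))) \<longlongrightarrow> - (c / k) * 0) at_top"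
      by (intro tendsto_intros)
    then show "((\<lambda>u. - (c / k) * exp (- k * (u - y))) \<longlongrightarrow> 0) at_top" by simp
  qed auto
  also have "\<dots> = ennreal (exp (1/2) * exp (- R y) / (1 + y))" by (simp add: c_def k_def)
  finally show ?thesis .
qed

lemma emeasure_gauss_uminus:
  assumes "A \<in> sets borel"
  shows "emeasure gauss (uminus ` A) = emeasure gauss A"
proof -
  have A: "uminus ` A = uminus -` A" by (force simp: image_iff)
  have [measurable]: "uminus -` A \<in> sets borel" using measurable_sets[of uminus borel borel A] assms by simp
  have "emeasure gauss (uminus -` A) = (\<integral>\<^sup>+u. ennreal (std_normal_density u) * indicator A (- u) \<partial>lborel)"
    unfolding gauss_eq by (subst emeasure_density) (auto intro!: nn_integral_cong simp: indicator_def)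
  also have "\<dots> = (\<integral>\<^sup>+u. ennreal (std_normal_density (- u)) * indicator A u \<partial>lborel)"
    using assms by (subst nn_integral_real_affine[where c="-1" and t=0]) auto
  also have "\<dots> = emeasure gauss A"
    unfolding gauss_eq using assms by (subst emeasure_density) (auto simp: normal_density_def)
  finally show ?thesis using A by simp
qed

text \<open>The superlevel set lies in \<open>|x| > y\<close> for a \<open>y \<ge> 0\<close> at
  which the weight equals \<open>B\<close>; there the tail bound reads
  \<open>exp (1 / 2) / B\<close> on each side, and \<open>exp (1 / 2) \<le> 2\<close>. For
  \<open>B \<le> 1\<close> total mass 1 suffices.\<close>

lemma emeasure_gauss_weight_le:
  assumes B: "0 < B"
  shows "emeasure gauss {x. B < (1 + \<bar>x\<bar>) * exp (R x)} \<le> ennreal (4 / B)"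
proof (cases "B \<le> 1")
  case True
  have "emeasure gauss {x. B < (1 + \<bar>x\<bar>) * exp (R x)} \<le> 1"
    by (rule prob_space.measure_le_1[OF prob_space_gauss])
  also have "\<dots> \<le> ennreal (4 / B)" using B True by (simp add: ennreal_leI flip: ennreal_1)
  finally show ?thesis .
next
  case False
  define w where "w x = (1 + x) * exp (R x)" for x
  have "\<exists>y. 0 \<le> y \<and> y \<le> B \<and> w y = B"
  proof (rule IVT')
    show "w 0 \<le> B" using False by (simp add: w_def R_def)
    have "B * 1 \<le> (1 + B) * exp (R B)" using B by (intro mult_mono) (auto simp: R_def)
    then show "B \<le> w B" by (simp add: w_def)
    show "continuous_on {0..B} w" unfolding w_def R_def by (intro continuous_intros) auto
  qed (use B in auto)
  then obtain y where y: "0 \<le> y" "w y = B" by blast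
  have "{x. B < (1 + \<bar>x\<bar>) * exp (R x)} \<subseteq> {y<..} \<union> uminus ` {y<..}"
  proof
    fix x assume "x \<in> {x. B < (1 + \<bar>x\<bar>) * exp (R x)}"
    then have "w y < w \<bar>x\<bar>" using y by (simp add: w_def R_def)
    moreover have "w \<bar>x\<bar> \<le> w y" if "\<bar>x\<bar> \<le> y"
      unfolding w_def R_def using that power_mono[OF that, of 2] by (intro mult_mono) auto
    ultimately have "y < \<bar>x\<bar>" by linarith
    then show "x \<in> {y<..} \<union> uminus ` {y<..}" by (auto simp: image_iff intro!: bexI[of _ "-x"])
  qed
  then have "emeasure gauss {x. B < (1 + \<bar>x\<bar>) * exp (R x)} \<le> emeasure gauss ({y<..} \<union> uminus ` {y<..})"
    by (intro emeasure_mono) (auto simp: image_uminus_greaterThan)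
  also have "\<dots> \<le> emeasure gauss {y<..} + emeasure gauss (uminus ` {y<..})"
    by (intro emeasure_subadditive) (auto simp: image_uminus_greaterThan)
  also have "\<dots> = emeasure gauss {y<..} + emeasure gauss {y<..}"
    by (subst emeasure_gauss_uminus) auto
  also have "\<dots> \<le> ennreal (exp (1/2) / B) + ennreal (exp (1/2) / B)"
  proof -
    have "B = (1 + y) * exp (R y)" using y by (simp add: w_def)
    moreover have "exp (- R y) = 1 / exp (R y)" by (simp add: exp_minus inverse_eq_divide)
    ultimately have "exp (1/2) * exp (- R y) / (1 + y) = exp (1/2) / B" by simp
    then show ?thesis using emeasure_gauss_half_line_le[OF y(1)] by (intro add_mono) auto
  qed
  also have "\<dots> = ennreal (2 * exp (1/2) / B)"
    using B by (subst ennreal_plus[symmetric]) auto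
  also have "\<dots> \<le> ennreal (4 / B)"
    using B exp_half_le2 by (intro ennreal_leI divide_right_mono) auto
  finally show ?thesis .
qed

section \<open>The local regime\<close>

text \<open>Integrating by parts in \<open>u\<close> writes the kernel as a superposition of one-sided averages over
  intervals of length proportional to \<open>s = sqrt (1 - exp (- 2 * t))\<close>. The drift of the centre
  \<open>exp (- t) * x\<close> only enters through \<open>d\<close>, which is monotone in time and bounded in the local regime.\<close>
definition weight :: "real \<Rightarrow> real \<Rightarrow> real" where
  "weight l d = l * (l + d) * std_normal_density (l + d)"

definition weighted_avg :: "(real \<Rightarrow> real) \<Rightarrow> real \<Rightarrow> real \<Rightarrow> real" where
  "weighted_avg a s d = (\<integral>l. indicator {0<..} l * (weight l d * a (s * l)) \<partial>lborel)"

section \<open>Decay of the weight\<close>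

lemma DERIV_std_normal_density:
  "(std_normal_density has_real_derivative - z * std_normal_density z) (at z)"
proof -
  have "((\<lambda>z. c * exp (- z\<^sup>2 / 2)) has_real_derivative - z * (c * exp (- z\<^sup>2 / 2))) (at z)" for c
    by (auto intro!: derivative_eq_intros)
  from this[of "1 / sqrt (2 * pi)"] show ?thesis by (simp add: std_normal_density_def[abs_def])
qed

lemma std_normal_density_le: "std_normal_density z \<le> exp (- z\<^sup>2 / 2)"
proof -
  have "std_normal_density z \<le> 1 * exp (- z\<^sup>2 / 2)"
    unfolding std_normal_density_def using pi_ge_two by (intro mult_right_mono) auto
  then show ?thesis by simp
qed

lemma std_normal_density_minus: "std_normal_density (- z) = std_normal_density z"
  by (simp add: std_normal_density_def)

text \<open>The factor \<open>q\<close> is free so that the bound serves both the weight, with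
  \<open>q = l + d\<close>, and its derivative in \<open>d\<close>, with
  \<open>q = 1 - (l + d)^2\<close>. Polynomial factors are bounded by \<open>exp y\<close> and
  absorbed through \<open>(y - 3)^2 \<ge> 0\<close>, the origin of \<open>11 / 2\<close>. The
  majorant \<open>exp (- l)\<close> is the exponential density over which averages are taken
  later.\<close>

lemma gaussian_poly_le:
  assumes l: "0 \<le> l" and d: "\<bar>d\<bar> \<le> 1" and q: "\<bar>q\<bar> \<le> 1 + (l + d)\<^sup>2"
  shows "\<bar>l * q * std_normal_density (l + d)\<bar> \<le> 2 * exp (11 / 2) * exp (- l)"
proof -
  define z where "z = l + d"
  define y where "y = \<bar>z\<bar>"
  have y: "0 \<le> y" "y\<^sup>2 = z\<^sup>2" by (auto simp: y_def)
  have l': "l \<le> 1 + y" using d by (auto simp: y_def z_def)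
  have "1 + y \<le> exp y" by (rule exp_ge_add_one_self)
  with l' have e1: "l \<le> exp y" by (rule order_trans)
  have "1 + y + y\<^sup>2 / 2 \<le> exp y" using y by (intro exp_lower_Taylor_quadratic)
  then have "1 + y\<^sup>2 \<le> 2 * exp y" using y by simp
  then have e2: "\<bar>q\<bar> \<le> 2 * exp y" using q y by (simp add: z_def)
  have "0 \<le> (y - 3)\<^sup>2" by simp
  then have "y + y + - y\<^sup>2 / 2 \<le> 11 / 2 + - (1 + y)" by (simp add: power2_eq_square algebra_simps)
  also have "\<dots> \<le> 11 / 2 + - l" using l' by simp
  finally have e3: "y + y + - y\<^sup>2 / 2 \<le> 11 / 2 + - l" .
  have "\<bar>l * q * std_normal_density (l + d)\<bar> = l * \<bar>q\<bar> * std_normal_density z"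
    using l by (simp add: abs_mult z_def)
  also have "\<dots> \<le> exp y * (2 * exp y) * exp (- z\<^sup>2 / 2)"
    using e1 e2 l by (intro mult_mono std_normal_density_le) auto
  also have "\<dots> = 2 * exp (y + y + - y\<^sup>2 / 2)" unfolding y(2) exp_add by simp
  also have "\<dots> \<le> 2 * exp (11 / 2 + - l)" using e3 by simp
  finally show ?thesis by (simp only: exp_add mult.assoc)
qed

lemma abs_weight_le:
  assumes "0 \<le> l" "\<bar>d\<bar> \<le> 1"
  shows "\<bar>weight l d\<bar> \<le> 2 * exp (11 / 2) * exp (- l)"
  unfolding weight_def
proof (rule gaussian_poly_le[OF assms])
  have "0 \<le> (\<bar>l + d\<bar> - 1)\<^sup>2" by simp
  then have "2 * \<bar>l + d\<bar> \<le> 1 + (l + d)\<^sup>2" by (simp add: power2_diff)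
  then show "\<bar>l + d\<bar> \<le> 1 + (l + d)\<^sup>2" by (rule order_trans[rotated]) simp
qed

lemma abs_weight_diff_le:
  assumes "0 \<le> l" "\<bar>d\<bar> \<le> 1" "\<bar>d'\<bar> \<le> 1"
  shows "\<bar>weight l d - weight l d'\<bar> \<le> 2 * exp (11 / 2) * exp (- l) * \<bar>d - d'\<bar>"
proof -
  have "norm (weight l d - weight l d') \<le> (2 * exp (11 / 2) * exp (- l)) * norm (d - d')"
  proof (rule field_differentiable_bound[where S="{-1..1}" and f'="\<lambda>d. l * (1 - (l + d)\<^sup>2) * std_normal_density (l + d)"])
    fix z :: real assume z: "z \<in> {-1..1}"
    have "((\<lambda>d. std_normal_density (l + d)) has_real_derivative - (l + z) * std_normal_density (l + z) * (0 + 1)) (at z)"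
      by (intro DERIV_chain2[OF DERIV_std_normal_density] derivative_intros)
    then have "(weight l has_real_derivative l * (l + z) * (- (l + z) * std_normal_density (l + z) * (0 + 1)) + l * (0 + 1) * std_normal_density (l + z)) (at z)"
      unfolding weight_def[abs_def] by (auto intro!: derivative_eq_intros)
    then have "(weight l has_real_derivative l * (1 - (l + z)\<^sup>2) * std_normal_density (l + z)) (at z)"
      by (rule back_subst[where P="\<lambda>D. (weight l has_real_derivative D) (at z)"]) (simp add: power2_eq_square algebra_simps)
    then show "(weight l has_real_derivative l * (1 - (l + z)\<^sup>2) * std_normal_density (l + z)) (at z within {-1..1})"
      by (rule has_field_derivative_at_within)
    show "norm (l * (1 - (l + z)\<^sup>2) * std_normal_density (l + z)) \<le> 2 * exp (11 / 2) * exp (- l)"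
      unfolding real_norm_def by (rule gaussian_poly_le) (use assms z in \<open>auto simp: abs_le_iff\<close>)
  qed (use assms in auto)
  then show ?thesis by simp
qed

lemma borel_measurable_weight [measurable]: "weight l \<in> borel_measurable borel" "(\<lambda>l. weight l d) \<in> borel_measurable borel"
  unfolding weight_def by measurable

text \<open>The integrand is the derivative of \<open>- std_normal_density (l + d)\<close>. Read
  backwards, a Gaussian value is a superposition of indicators of half lines: integration by parts
  in the form needed for Fubini.\<close>

lemma tail_first_moment:
  shows "integrable lborel (\<lambda>l. (l + d) * std_normal_density (l + d))"
    and "(\<integral>l. (if a \<le> l then (l + d) * std_normal_density (l + d) else 0) \<partial>lborel) = std_normal_density (a + d)"
proof -
  let ?f = "\<lambda>l. (l + d) * std_normal_density (l + d)"
  have "integrable lborel (\<lambda>z. std_normal_density z * z)"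
    using integrable_normal_moment[of 1 0 1] by simp
  then have "integrable lborel (\<lambda>z. z * std_normal_density z)" by (simp add: mult.commute)
  from lborel_integrable_real_affine[OF this, of 1 d]
  show int: "integrable lborel ?f" by (simp add: add.commute)
  have "(LBINT l=ereal a..\<infinity>. ?f l) = 0 - (- std_normal_density (a + d))"
  proof (rule interval_integral_FTC_integrable[where F="\<lambda>l. - std_normal_density (l + d)"])
    fix l
    have "((\<lambda>l. std_normal_density (l + d)) has_real_derivative - (l + d) * std_normal_density (l + d) * (1 + 0)) (at l)"
      by (intro DERIV_chain2[OF DERIV_std_normal_density] derivative_intros)
    from DERIV_minus[OF this]
    have "((\<lambda>l. - std_normal_density (l + d)) has_real_derivative ?f l) (at l)"
      by (simp add: algebra_simps)
    then show "((\<lambda>l. - std_normal_density (l + d)) has_vector_derivative ?f l) (at l)"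
      by (simp add: has_real_derivative_iff_has_vector_derivative)
    show "isCont ?f l" unfolding std_normal_density_def by (intro continuous_intros) auto
  next
    show "set_integrable lborel (einterval (ereal a) \<infinity>) ?f"
      unfolding set_integrable_def using int by (intro integrable_mult_indicator) auto
    have "isCont (\<lambda>l. - std_normal_density (l + d)) a"
      unfolding std_normal_density_def by (intro continuous_intros) auto
    then have "((\<lambda>l. - std_normal_density (l + d)) \<longlongrightarrow> - std_normal_density (a + d)) (at_right a)"
      by (simp add: isCont_def filterlim_at_split)
    then show "(((\<lambda>l. - std_normal_density (l + d)) \<circ> real_of_ereal) \<longlongrightarrow> - std_normal_density (a + d)) (at_right (ereal a))"
      by (simp add: ereal_tendsto_simps)
    have "((\<lambda>l. - (1 / sqrt (2 * pi) * exp (- (l + d)\<^sup>2 / 2))) \<longlongrightarrow> 0) at_top"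
      by real_asymp
    then show "(((\<lambda>l. - std_normal_density (l + d)) \<circ> real_of_ereal) \<longlongrightarrow> 0) (at_left \<infinity>)"
      by (simp add: ereal_tendsto_simps std_normal_density_def)
  qed simp
  then have "(LBINT l:{a<..}. ?f l) = std_normal_density (a + d)"
    by (simp add: interval_integral_to_infinity_eq)
  moreover have "(\<integral>l. (if a \<le> l then ?f l else 0) \<partial>lborel) = (LBINT l:{a<..}. ?f l)"
    unfolding set_lebesgue_integral_def
  proof (rule integral_cong_AE)
    have "AE l in lborel. l \<noteq> a" by (rule AE_lborel_singleton)
    then show "AE l in lborel. (if a \<le> l then ?f l else 0) = indicator {a<..} l *\<^sub>R ?f l"
      by eventually_elim (auto simp: indicator_def)
  qed measurable
  ultimately show "(\<integral>l. (if a \<le> l then ?f l else 0) \<partial>lborel) = std_normal_density (a + d)" by simp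
qed

text \<open>Insert the tail formula at \<open>(u - x) / s\<close> and exchange the integrals: for
  fixed \<open>l\<close> the condition on \<open>u\<close> is membership in
  \<open>(x, x + s * l]\<close>. The inner integral is then \<open>s * l\<close> times an average,
  which produces the factor \<open>l\<close> in \<open>weight\<close>.\<close>

lemma half_line_gaussian_eq_weighted_avg:
  assumes g: "integrable lborel g" and s: "0 < s"
  shows "(\<integral>u. g u * indicator {x<..} u * (std_normal_density ((u - x) / s + d) / s) \<partial>lborel)
    = weighted_avg (avg g x) s d"
proof -
  let ?f = "\<lambda>l. (l + d) * std_normal_density (l + d)"
  define k where "k l u = ?f l * (g u / s) * (if x < u \<and> u \<le> x + s * l then 1 else 0)" for l u
  have [measurable]: "g \<in> borel_measurable borel" using g by auto
  have "integrable (lborel \<Otimes>\<^sub>M lborel) (\<lambda>p. ?f (fst p) * (g (snd p) / s))"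
  proof (rule lborel_pair.Fubini_integrable)
    show "AE l in lborel. integrable lborel (\<lambda>u. ?f (fst (l, u)) * (g (snd (l, u)) / s))"
      using g by auto
    have "integrable lborel (\<lambda>l. \<bar>?f l\<bar> * (\<integral>u. \<bar>g u / s\<bar> \<partial>lborel))"
      using tail_first_moment(1)[of d] by (intro integrable_mult_left integrable_abs)
    then show "integrable lborel (\<lambda>l. \<integral>u. norm (?f (fst (l, u)) * (g (snd (l, u)) / s)) \<partial>lborel)"
      by (simp add: abs_mult)
  qed measurable
  moreover have "case_prod k \<in> borel_measurable (lborel \<Otimes>\<^sub>M lborel)"
    unfolding k_def split_beta' by measurable
  ultimately have int: "integrable (lborel \<Otimes>\<^sub>M lborel) (case_prod k)"
    by (rule Bochner_Integration.integrable_bound) (auto simp: k_def abs_mult)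
  have "(\<integral>u. (\<integral>l. k l u \<partial>lborel) \<partial>lborel) = (\<integral>l. (\<integral>u. k l u \<partial>lborel) \<partial>lborel)"
    by (rule lborel_pair.Fubini_integral[OF int])
  moreover have "(\<integral>l. k l u \<partial>lborel) = g u * indicator {x<..} u * (std_normal_density ((u - x) / s + d) / s)" for u
  proof -
    have "k l u = (g u / s * indicator {x<..} u) * (if (u - x) / s \<le> l then ?f l else 0)" for l
      using s by (auto simp: k_def field_simps)
    then have "(\<integral>l. k l u \<partial>lborel) = (g u / s * indicator {x<..} u) * (\<integral>l. (if (u - x) / s \<le> l then ?f l else 0) \<partial>lborel)"
      by simp
    then show ?thesis unfolding tail_first_moment(2) by simp
  qed
  moreover have "(\<integral>u. k l u \<partial>lborel) = indicator {0<..} l * (weight l d * avg g x (s * l))" for l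
  proof (cases "0 < l")
    case True
    have "k l u = (?f l / s) * (g u * indicator {x<..x + s * l} u)" for u
      by (auto simp: k_def indicator_def)
    then have "(\<integral>u. k l u \<partial>lborel) = (?f l / s) * (cumul g (x + s * l) - cumul g x)"
      using cumul_diff[OF g, of x "x + s * l"] True s by simp
    then show ?thesis using True s by (simp add: weight_def avg_def)
  next
    case False
    then have "s * l \<le> 0" using s by (simp add: mult_nonneg_nonpos)
    then have "k l u = 0" for u by (auto simp: k_def)
    then show ?thesis using False by simp
  qed
  ultimately show ?thesis by (simp add: weighted_avg_def)
qed

text \<open>With \<open>r = exp (- t)\<close>, the kernel times the Gaussian density is a Gaussian
  in \<open>u\<close> with centre \<open>r * x\<close> and deviation \<open>s\<close>. Recentring at
  \<open>x\<close> gives the shift \<open>d = x * (1 - r) / s\<close>, where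
  \<open>((1 - r) / s)^2 = (1 - r) / (1 + r)\<close> is \<open>half_tanh t\<close>. The half line
  left of \<open>x\<close> is reflected, which changes the sign of \<open>d\<close>.\<close>

lemma OU_eq_weighted_avg:
  fixes t x :: real
  defines "s \<equiv> sqrt (1 - exp (- 2 * t))" and "d \<equiv> x * sqrt (half_tanh t)"
  assumes t: "0 < t" and g: "integrable lborel g"
  shows "OU t g x = weighted_avg (avg g x) s d + weighted_avg (avg (\<lambda>u. g (- u)) (- x)) s (- d)"
proof -
  define r where "r = exp (- t)"
  have [measurable]: "g \<in> borel_measurable borel" using g by auto
  have s: "0 < s" using one_minus_exp_pos[OF t] by (simp add: s_def)
  have r: "0 < r" "r < 1" using t by (auto simp: r_def)
  have "exp (- 2 * t) = r\<^sup>2" by (simp add: r_def power2_eq_square exp_add[symmetric])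
  then have s2: "s\<^sup>2 = 1 - r\<^sup>2" "s\<^sup>2 = 1 - exp (- 2 * t)" using one_minus_exp_pos[OF t] by (auto simp: s_def)
  have d: "d = x * (1 - r) / s"
  proof -
    have "s\<^sup>2 = (1 - r) * (1 + r)" using s2 by (simp add: power2_eq_square algebra_simps)
    then have "((1 - r) / s)\<^sup>2 = half_tanh t" using r
      by (simp add: power_divide half_tanh_def r_def[symmetric]) (simp add: power2_eq_square)
    then have "sqrt (half_tanh t) = (1 - r) / s" using r s by (metis diff_ge_0_iff_ge divide_nonneg_pos less_imp_le real_sqrt_unique)
    then show ?thesis by (simp add: d_def)
  qed
  have kern: "std_normal_density u * OU_kernel t x u = std_normal_density ((u - x) / s + d) / s" for u
  proof -
    have "(u - x) / s + d = (u - r * x) / s" by (simp add: d add_divide_distrib[symmetric] algebra_simps)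
    moreover have "- u\<^sup>2 / 2 + (R x + - (1/2) * (r * u - x)\<^sup>2 / s\<^sup>2) = - ((u - r * x) / s)\<^sup>2 / 2"
    proof -
      have "- (s\<^sup>2 * u\<^sup>2) + s\<^sup>2 * x\<^sup>2 - (r * u - x)\<^sup>2 = - (u - r * x)\<^sup>2"
        unfolding s2(1) by (simp add: power2_eq_square algebra_simps)
      then have "(- (s\<^sup>2 * u\<^sup>2) + s\<^sup>2 * x\<^sup>2 - (r * u - x)\<^sup>2) / (2 * s\<^sup>2) = - (u - r * x)\<^sup>2 / (2 * s\<^sup>2)" by simp
      moreover have "- ((u - r * x) / s)\<^sup>2 / 2 = - (u - r * x)\<^sup>2 / (2 * s\<^sup>2)" by (simp add: power_divide)
      moreover have "- u\<^sup>2 / 2 + (R x + - (1/2) * (r * u - x)\<^sup>2 / s\<^sup>2)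
        = (- (s\<^sup>2 * u\<^sup>2) + s\<^sup>2 * x\<^sup>2 - (r * u - x)\<^sup>2) / (2 * s\<^sup>2)"
        using s by (simp add: R_def diff_divide_distrib add_divide_distrib)
      ultimately show ?thesis by simp
    qed
    ultimately show ?thesis
      unfolding std_normal_density_def OU_kernel_def s2(2)[symmetric] s_def[symmetric] r_def[symmetric]
      using s by (simp flip: exp_add)
  qed
  let ?h = "\<lambda>u. g u * (std_normal_density ((u - x) / s + d) / s)"
  have int: "integrable lborel ?h"
  proof (rule Bochner_Integration.integrable_bound[where f="\<lambda>u. g u / s"])
    show "AE u in lborel. norm (?h u) \<le> norm (g u / s)"
    proof (intro AE_I2)
      fix u
      have "std_normal_density ((u - x) / s + d) \<le> 1"
        using std_normal_density_le[of "(u - x) / s + d"] by (rule order_trans) simp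
      then have "\<bar>g u\<bar> * std_normal_density ((u - x) / s + d) \<le> \<bar>g u\<bar> * 1" by (intro mult_left_mono) auto
      then show "norm (?h u) \<le> norm (g u / s)" using s by (simp add: abs_mult divide_right_mono)
    qed
  qed (use g in auto)
  have "OU t g x = (\<integral>u. std_normal_density u * (g u * OU_kernel t x u) \<partial>lborel)"
    unfolding OU_def gauss_eq by (subst integral_density) (auto simp: OU_kernel_def)
  also have "\<dots> = (\<integral>u. ?h u \<partial>lborel)"
    unfolding kern[symmetric] by (simp add: mult_ac)
  also have "\<dots> = (\<integral>u. ?h u * indicator {x<..} u + ?h u * indicator {..<x} u \<partial>lborel)"
  proof (rule integral_cong_AE)
    have "AE u in lborel. u \<noteq> x" by (rule AE_lborel_singleton)
    then show "AE u in lborel. ?h u = ?h u * indicator {x<..} u + ?h u * indicator {..<x} u"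
      by eventually_elim (auto simp: indicator_def)
  qed measurable
  also have "\<dots> = (\<integral>u. ?h u * indicator {x<..} u \<partial>lborel) + (\<integral>u. ?h u * indicator {..<x} u \<partial>lborel)"
    using int by (intro Bochner_Integration.integral_add integrable_mult_indicator_right) auto
  also have "(\<integral>u. ?h u * indicator {x<..} u \<partial>lborel) = weighted_avg (avg g x) s d"
    unfolding half_line_gaussian_eq_weighted_avg[OF g s, symmetric] by (simp add: mult_ac)
  also have "(\<integral>u. ?h u * indicator {..<x} u \<partial>lborel) = (\<integral>u. ?h (- u) * indicator {..<x} (- u) \<partial>lborel)"
    by (subst lborel_integral_real_affine[where c="-1" and t=0]) auto
  also have "\<dots> = (\<integral>u. g (- u) * indicator {- x<..} u * (std_normal_density ((u - (- x)) / s + (- d)) / s) \<partial>lborel)"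
  proof (intro Bochner_Integration.integral_cong refl)
    fix u
    have "std_normal_density ((- u - x) / s + d) = std_normal_density ((u - (- x)) / s + (- d))"
      by (subst std_normal_density_minus[symmetric]) (simp add: diff_divide_distrib add_divide_distrib add.commute)
    then show "?h (- u) * indicator {..<x} (- u) = g (- u) * indicator {- x<..} u * (std_normal_density ((u - (- x)) / s + (- d)) / s)"
      by (auto simp: indicator_def)
  qed
  also have "\<dots> = weighted_avg (avg (\<lambda>u. g (- u)) (- x)) s (- d)"
    using lborel_integrable_real_affine[OF g, of "-1" 0] by (intro half_line_gaussian_eq_weighted_avg s) simp
  finally show ?thesis .
qed


section \<open>Variation of superpositions\<close>

lemma sum_powr_le:
  fixes c :: "'a \<Rightarrow> real"
  assumes "finite I" "\<And>i. i \<in> I \<Longrightarrow> 0 \<le> c i" "1 \<le> \<rho>"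
  shows "(\<Sum>i\<in>I. c i powr \<rho>) \<le> (\<Sum>i\<in>I. c i) powr \<rho>"
proof -
  define S where "S = (\<Sum>i\<in>I. c i)"
  have S: "0 \<le> S" using assms by (auto simp: S_def intro: sum_nonneg)
  have split: "z powr \<rho> = z * z powr (\<rho> - 1)" if "0 \<le> z" for z :: real
    using that powr_add[of z 1 "\<rho> - 1"] by (cases "z = 0") auto
  have "(\<Sum>i\<in>I. c i powr \<rho>) \<le> (\<Sum>i\<in>I. c i * S powr (\<rho> - 1))"
  proof (rule sum_mono)
    fix i assume i: "i \<in> I"
    have "c i \<le> S" unfolding S_def using assms i by (intro member_le_sum) auto
    then have "c i powr (\<rho> - 1) \<le> S powr (\<rho> - 1)" using assms i by (intro powr_mono2) auto
    then show "c i powr \<rho> \<le> c i * S powr (\<rho> - 1)"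
      using assms i by (subst split) (auto intro: mult_left_mono)
  qed
  also have "\<dots> = S powr \<rho>" unfolding sum_distrib_right[symmetric] S_def[symmetric] using split[OF S] by simp
  finally show ?thesis by (simp add: S_def)
qed

lemma powr_add3_le:
  fixes a b c \<rho> :: real
  assumes "0 \<le> a" "0 \<le> b" "0 \<le> c" "0 \<le> \<rho>"
  shows "(a + b + c) powr \<rho> \<le> 3 powr \<rho> * (a powr \<rho> + b powr \<rho> + c powr \<rho>)"
proof -
  define m where "m = max a (max b c)"
  have "(a + b + c) powr \<rho> \<le> (3 * m) powr \<rho>"
    using assms by (intro powr_mono2) (auto simp: m_def)
  also have "\<dots> = 3 powr \<rho> * m powr \<rho>" using assms by (simp add: powr_mult m_def)
  also have "m powr \<rho> \<le> a powr \<rho> + b powr \<rho> + c powr \<rho>"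
    by (auto simp: m_def max_def)
  finally show ?thesis by (simp add: mult_left_mono)
qed

text \<open>Jensen's inequality for the exponential distribution brings the power inside the
  integral over \<open>l\<close>. For fixed \<open>l > 0\<close> the radii \<open>s i * l\<close>
  increase again, so the hypothesis on \<open>a\<close> applies; changes of the weight are
  controlled by the total variation of \<open>d\<close> and the bound on \<open>a\<close>.\<close>

lemma variation_weighted_avg_le:
  assumes a[measurable]: "a \<in> borel_measurable borel"
    and a0: "\<And>r. 0 \<le> a r" "\<And>r. a r \<le> \<alpha>" "\<And>r. r \<le> 0 \<Longrightarrow> a r = 0"
    and \<alpha>: "0 < \<alpha>" and \<rho>: "1 \<le> \<rho>"
    and var: "\<And>r. (\<And>i. i \<le> n \<Longrightarrow> 0 < r i) \<Longrightarrow> (\<And>i. i < n \<Longrightarrow> r i \<le> r (Suc i)) \<Longrightarrow>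
        (\<Sum>i<n. \<bar>a (r (Suc i)) - a (r i)\<bar> powr \<rho>) \<le> \<alpha> powr \<rho>"
    and s: "\<And>i. i \<le> n \<Longrightarrow> 0 < s i" "\<And>i. i < n \<Longrightarrow> s i \<le> s (Suc i)"
    and d: "\<And>i. i \<le> n \<Longrightarrow> \<bar>d i\<bar> \<le> 1" "(\<Sum>i<n. \<bar>d (Suc i) - d i\<bar>) \<le> 1"
  shows "(\<Sum>i<n. \<bar>weighted_avg a (s (Suc i)) (d (Suc i)) - weighted_avg a (s i) (d i)\<bar> powr \<rho>)
     \<le> 3 * (6 * exp (11 / 2)) powr \<rho> * \<alpha> powr \<rho>"
proof (cases "n = 0")
  case False
  define C where "C = 2 * exp (11 / 2 :: real)"
  have C: "0 < C" by (simp add: C_def)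
  define M where "M = density lborel (exponential_density 1)"
  interpret M: prob_space M unfolding M_def by (rule prob_space_exponential_density) simp
  have [measurable_cong, simp]: "sets M = sets borel" by (simp add: M_def)
  have edens: "exponential_density 1 l = (if l < 0 then 0 else exp (- l))" for l :: real
    by (simp add: exponential_density_def)
  have int_M: "integrable M f \<longleftrightarrow> integrable lborel (\<lambda>l. exponential_density 1 l * f l)"
    "integral\<^sup>L M f = (\<integral>l. exponential_density 1 l * f l \<partial>lborel)"
    if "f \<in> borel_measurable borel" for f :: "real \<Rightarrow> real"
    unfolding M_def using that
    by (simp_all add: integrable_density integral_density exponential_density_nonneg)
  define F where "F i l = indicator {0<..} l * (weight l (d i) * a (s i * l))" for i l
  have F_meas [measurable]: "F i \<in> borel_measurable borel" for i unfolding F_def by measurable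
  have wa: "weighted_avg a (s i) (d i) = (\<integral>l. F i l \<partial>lborel)" for i
    by (simp add: weighted_avg_def F_def)
  have intF: "integrable lborel (F i)" if i: "i \<le> n" for i
  proof (rule Bochner_Integration.integrable_bound)
    have "integrable M (\<lambda>_. C * \<alpha>)" by simp
    then show "integrable lborel (\<lambda>l. exponential_density 1 l * (C * \<alpha>))" using int_M(1)[of "\<lambda>_. C * \<alpha>"] by simp
    show "AE l in lborel. norm (F i l) \<le> norm (exponential_density 1 l * (C * \<alpha>))"
    proof (intro AE_I2)
      fix l
      show "norm (F i l) \<le> norm (exponential_density 1 l * (C * \<alpha>))"
      proof (cases "0 < l")
        case True
        have "\<bar>weight l (d i)\<bar> * a (s i * l) \<le> (C * exp (- l)) * \<alpha>"
          using abs_weight_le[of l "d i"] d(1)[OF i] True a0 C \<alpha>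
          by (intro mult_mono) (auto simp: C_def)
        then show ?thesis using True a0 C \<alpha> by (simp add: F_def edens abs_mult mult_ac)
      qed (simp add: F_def)
    qed
  qed simp
  \<comment> \<open>The term \<open>\<alpha> / n\<close> keeps \<open>Y\<close> strictly positive,
    as Jensen is applied to the power on \<open>{0<..}\<close>; spread over \<open>n\<close> steps,
    it adds at most \<open>\<alpha> powr \<rho>\<close> to the sum of powers.\<close>
  define Y where "Y i l = C * (\<bar>a (s (Suc i) * l) - a (s i * l)\<bar> + \<alpha> * \<bar>d (Suc i) - d i\<bar> + \<alpha> / n)" for i l
  have Y_meas [measurable]: "Y i \<in> borel_measurable borel" for i unfolding Y_def by measurable
  have Y_pos: "0 < Y i l" for i l
    using False \<alpha> C by (auto simp: Y_def intro!: mult_pos_pos add_nonneg_pos)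
  have Y_bd: "Y i l \<le> C * (\<alpha> + 3 * \<alpha> + \<alpha>)" if i: "i < n" for i l
  proof -
    have "\<bar>a (s (Suc i) * l) - a (s i * l)\<bar> \<le> \<alpha>" using a0 by (smt (verit))
    moreover have "\<bar>d (Suc i) - d i\<bar> \<le> 3" using d(1)[of i] d(1)[of "Suc i"] i by linarith
    then have "\<alpha> * \<bar>d (Suc i) - d i\<bar> \<le> \<alpha> * 3" using \<alpha> by (intro mult_left_mono) auto
    moreover have "\<alpha> / n \<le> \<alpha>" using \<alpha> False by (simp add: divide_le_eq)
    ultimately show ?thesis unfolding Y_def using C by (intro mult_left_mono) linarith+
  qed
  have intY: "integrable M (Y i)" if "i < n" for i
    using Y_pos[of i] Y_bd[OF that] by (intro M.integrable_const_bound[where B="C * (\<alpha> + 3 * \<alpha> + \<alpha>)"]) (auto simp: less_imp_le)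
  have intYp: "integrable M (\<lambda>l. Y i l powr \<rho>)" if "i < n" for i
    using Y_pos[of i] Y_bd[OF that] \<rho>
    by (intro M.integrable_const_bound[where B="(C * (\<alpha> + 3 * \<alpha> + \<alpha>)) powr \<rho>"])
       (auto simp: less_imp_le intro!: powr_mono2)
  have step: "\<bar>weighted_avg a (s (Suc i)) (d (Suc i)) - weighted_avg a (s i) (d i)\<bar> powr \<rho> \<le> M.expectation (\<lambda>l. Y i l powr \<rho>)"
    if i: "i < n" for i
  proof -
    have "weighted_avg a (s (Suc i)) (d (Suc i)) - weighted_avg a (s i) (d i) = (\<integral>l. F (Suc i) l - F i l \<partial>lborel)"
      unfolding wa using i by (intro Bochner_Integration.integral_diff[symmetric] intF) auto
    also have "\<bar>\<dots>\<bar> \<le> (\<integral>l. \<bar>F (Suc i) l - F i l\<bar> \<partial>lborel)" by (rule integral_abs_bound)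
    also have "\<dots> \<le> (\<integral>l. exponential_density 1 l * Y i l \<partial>lborel)"
    proof (rule integral_mono)
      show "integrable lborel (\<lambda>l. \<bar>F (Suc i) l - F i l\<bar>)"
        using i by (intro integrable_abs Bochner_Integration.integrable_diff intF) auto
      show "integrable lborel (\<lambda>l. exponential_density 1 l * Y i l)" using intY[OF i] by (simp add: int_M)
      fix l :: real
      show "\<bar>F (Suc i) l - F i l\<bar> \<le> exponential_density 1 l * Y i l"
      proof (cases "0 < l")
        case True
        have "F (Suc i) l - F i l = weight l (d (Suc i)) * (a (s (Suc i) * l) - a (s i * l))
            + (weight l (d (Suc i)) - weight l (d i)) * a (s i * l)"
          using True by (simp add: F_def algebra_simps)
        also have "\<bar>\<dots>\<bar> \<le> \<bar>weight l (d (Suc i)) * (a (s (Suc i) * l) - a (s i * l))\<bar> + \<bar>(weight l (d (Suc i)) - weight l (d i)) * a (s i * l)\<bar>"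
          by (rule abs_triangle_ineq)
        also have "\<bar>weight l (d (Suc i)) * (a (s (Suc i) * l) - a (s i * l))\<bar> \<le> (C * exp (- l)) * \<bar>a (s (Suc i) * l) - a (s i * l)\<bar>"
          unfolding abs_mult using abs_weight_le[of l "d (Suc i)"] d(1)[of "Suc i"] True i
          by (intro mult_right_mono) (auto simp: C_def)
        also have "\<bar>(weight l (d (Suc i)) - weight l (d i)) * a (s i * l)\<bar> \<le> (C * exp (- l) * \<bar>d (Suc i) - d i\<bar>) * \<alpha>"
          unfolding abs_mult using abs_weight_diff_le[of l "d (Suc i)" "d i"] d(1)[of "Suc i"] d(1)[of i] True i a0 C
          by (intro mult_mono) (auto simp: C_def)
        finally have "\<bar>F (Suc i) l - F i l\<bar> \<le> exp (- l) * (C * (\<bar>a (s (Suc i) * l) - a (s i * l)\<bar> + \<alpha> * \<bar>d (Suc i) - d i\<bar>))"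
          by (simp add: algebra_simps)
        also have "\<dots> \<le> exp (- l) * Y i l"
          unfolding Y_def using C \<alpha> by (intro mult_left_mono) auto
        finally show ?thesis using True by (simp add: edens)
      next
        case False
        then show ?thesis using Y_pos[of i l] by (simp add: F_def edens)
      qed
    qed
    also have "\<dots> = M.expectation (Y i)" by (simp add: int_M)
    finally have "\<bar>weighted_avg a (s (Suc i)) (d (Suc i)) - weighted_avg a (s i) (d i)\<bar> powr \<rho> \<le> M.expectation (Y i) powr \<rho>"
      using \<rho> by (intro powr_mono2) auto
    also have "\<dots> \<le> M.expectation (\<lambda>l. Y i l powr \<rho>)"
      using intY[OF i] intYp[OF i] Y_pos \<rho>
      by (intro M.jensens_inequality[where I="{0<..}" and a=0] powr_convex) auto
    finally show ?thesis .
  qed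
  have pt: "(\<Sum>i<n. Y i l powr \<rho>) \<le> 3 * (3 * C) powr \<rho> * \<alpha> powr \<rho>" for l
  proof -
    have "(\<Sum>i<n. \<bar>a (s (Suc i) * l) - a (s i * l)\<bar> powr \<rho>) \<le> \<alpha> powr \<rho>"
    proof (cases "0 < l")
      case True
      then show ?thesis using s by (intro var[of "\<lambda>i. s i * l"]) auto
    next
      case False
      then have "a (s i * l) = 0" if "i \<le> n" for i
        using s(1)[OF that] by (intro a0) (simp add: mult_nonneg_nonpos)
      then show ?thesis by simp
    qed
    moreover have "(\<Sum>i<n. (\<alpha> * \<bar>d (Suc i) - d i\<bar>) powr \<rho>) \<le> \<alpha> powr \<rho>"
    proof -
      have "(\<Sum>i<n. (\<alpha> * \<bar>d (Suc i) - d i\<bar>) powr \<rho>) \<le> (\<Sum>i<n. \<alpha> * \<bar>d (Suc i) - d i\<bar>) powr \<rho>"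
        using \<alpha> \<rho> by (intro sum_powr_le) auto
      also have "\<dots> \<le> (\<alpha> * 1) powr \<rho>"
        unfolding sum_distrib_left[symmetric] using \<alpha> \<rho> d(2)
        by (intro powr_mono2 mult_left_mono mult_nonneg_nonneg sum_nonneg) auto
      finally show ?thesis by simp
    qed
    moreover have "(\<Sum>i<n. (\<alpha> / n) powr \<rho>) \<le> (\<Sum>i<n. \<alpha> / n) powr \<rho>"
      using \<alpha> \<rho> by (intro sum_powr_le) auto
    then have "(\<Sum>i<n. (\<alpha> / n) powr \<rho>) \<le> \<alpha> powr \<rho>" using False by simp
    ultimately have sum3: "(\<Sum>i<n. \<bar>a (s (Suc i) * l) - a (s i * l)\<bar> powr \<rho>) + (\<Sum>i<n. (\<alpha> * \<bar>d (Suc i) - d i\<bar>) powr \<rho>) + (\<Sum>i<n. (\<alpha> / n) powr \<rho>) \<le> 3 * \<alpha> powr \<rho>"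
      by linarith
    have "(\<Sum>i<n. Y i l powr \<rho>) \<le> (\<Sum>i<n. (3 * C) powr \<rho> * (\<bar>a (s (Suc i) * l) - a (s i * l)\<bar> powr \<rho> + (\<alpha> * \<bar>d (Suc i) - d i\<bar>) powr \<rho> + (\<alpha> / n) powr \<rho>))"
    proof (rule sum_mono)
      fix i
      have "Y i l powr \<rho> = C powr \<rho> * (\<bar>a (s (Suc i) * l) - a (s i * l)\<bar> + \<alpha> * \<bar>d (Suc i) - d i\<bar> + \<alpha> / n) powr \<rho>"
        unfolding Y_def using C \<alpha> by (subst powr_mult) auto
      also have "\<dots> \<le> C powr \<rho> * (3 powr \<rho> * (\<bar>a (s (Suc i) * l) - a (s i * l)\<bar> powr \<rho> + (\<alpha> * \<bar>d (Suc i) - d i\<bar>) powr \<rho> + (\<alpha> / n) powr \<rho>))"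
        using \<alpha> \<rho> by (intro mult_left_mono powr_add3_le) auto
      finally show "Y i l powr \<rho> \<le> (3 * C) powr \<rho> * (\<bar>a (s (Suc i) * l) - a (s i * l)\<bar> powr \<rho> + (\<alpha> * \<bar>d (Suc i) - d i\<bar>) powr \<rho> + (\<alpha> / n) powr \<rho>)"
        using C by (simp add: powr_mult mult_ac)
    qed
    also have "\<dots> = (3 * C) powr \<rho> * ((\<Sum>i<n. \<bar>a (s (Suc i) * l) - a (s i * l)\<bar> powr \<rho>) + (\<Sum>i<n. (\<alpha> * \<bar>d (Suc i) - d i\<bar>) powr \<rho>) + (\<Sum>i<n. (\<alpha> / n) powr \<rho>))"
      by (simp only: sum_distrib_left[symmetric] sum.distrib)
    also have "\<dots> \<le> (3 * C) powr \<rho> * (3 * \<alpha> powr \<rho>)" using sum3 by (rule mult_left_mono) simp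
    finally show ?thesis by (simp add: mult_ac)
  qed
  have "(\<Sum>i<n. \<bar>weighted_avg a (s (Suc i)) (d (Suc i)) - weighted_avg a (s i) (d i)\<bar> powr \<rho>) \<le> (\<Sum>i<n. M.expectation (\<lambda>l. Y i l powr \<rho>))"
    using step by (intro sum_mono) auto
  also have "\<dots> = M.expectation (\<lambda>l. \<Sum>i<n. Y i l powr \<rho>)"
    using intYp by (subst Bochner_Integration.integral_sum) auto
  also have "\<dots> \<le> 3 * (3 * C) powr \<rho> * \<alpha> powr \<rho>"
    using pt intYp by (intro M.integral_le_const Bochner_Integration.integrable_sum) auto
  finally show ?thesis by (simp add: C_def)
qed (use \<alpha> in simp)

text \<open>\<open>half_tanh (t i)\<close> is at most \<open>1 - exp (- 2 * t i)\<close>, so the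
  smallness hypothesis makes \<open>|d i|\<close> at most 1. As \<open>d\<close> is the constant
  \<open>x\<close> times an increasing nonnegative function, \<open>|d|\<close> increases and the
  total variation telescopes.\<close>

lemma local_variation_OU_le:
  assumes g: "integrable lborel g" "\<And>u. 0 \<le> g u" and \<alpha>: "0 < \<alpha>" and \<rho>: "1 \<le> \<rho>"
    and fwd: "avg_controlled \<rho> \<alpha> g x" and bwd: "avg_controlled \<rho> \<alpha> (\<lambda>u. g (- u)) (- x)"
    and t: "\<And>i. i \<le> n \<Longrightarrow> 0 < t i" "\<And>i. i < n \<Longrightarrow> t i \<le> t (Suc i)"
    and small: "\<And>i. i \<le> n \<Longrightarrow> sqrt (1 - exp (- 2 * t i)) \<le> 1 / (2 * (1 + \<bar>x\<bar>))"
  shows "(\<Sum>i<n. \<bar>OU (t (Suc i)) g x - OU (t i) g x\<bar> powr \<rho>) \<le> 9 * (18 * exp (11 / 2)) powr \<rho> * \<alpha> powr \<rho>"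
proof -
  define s where "s i = sqrt (1 - exp (- 2 * t i))" for i
  define d where "d i = x * sqrt (half_tanh (t i))" for i
  define K where "K = 3 * (6 * exp (11 / 2)) powr \<rho> * \<alpha> powr \<rho>"
  have s: "0 < s i" if "i \<le> n" for i using one_minus_exp_pos[OF t(1)[OF that]] by (simp add: s_def)
  have s_mono: "s i \<le> s (Suc i)" if "i < n" for i using t(2)[OF that] by (simp add: s_def)
  have hm: "half_tanh (t i) \<le> half_tanh (t (Suc i))" if "i < n" for i using half_tanh_mono t(2)[OF that] .
  have d1: "\<bar>d i\<bar> \<le> 1" if i: "i \<le> n" for i
  proof -
    have h: "0 < half_tanh (t i)" "half_tanh (t i) < 1" using half_tanh_bounds t(1)[OF i] by auto
    have "(1 + half_tanh (t i))\<^sup>2 \<le> 2\<^sup>2" using h by (intro power_mono) auto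
    then have "half_tanh (t i) * (1 + half_tanh (t i))\<^sup>2 \<le> half_tanh (t i) * 4" using h by (intro mult_left_mono) auto
    then have "half_tanh (t i) \<le> 1 - exp (- 2 * t i)"
      unfolding one_minus_exp_half_tanh[OF t(1)[OF i]] using h by (simp add: pos_le_divide_eq mult.commute)
    then have "sqrt (half_tanh (t i)) \<le> 1 / (2 * (1 + \<bar>x\<bar>))" using small[OF i] by (meson order_trans real_sqrt_le_mono)
    then have "\<bar>x\<bar> * sqrt (half_tanh (t i)) \<le> (1 + \<bar>x\<bar>) * (1 / (2 * (1 + \<bar>x\<bar>)))"
      using h by (intro mult_mono) auto
    also have "\<dots> \<le> 1" by (simp add: field_simps)
    finally show ?thesis using h by (simp add: d_def abs_mult)
  qed
  have dsum: "(\<Sum>i<n. \<bar>d (Suc i) - d i\<bar>) \<le> 1"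
  proof -
    have "(\<Sum>i<n. \<bar>d (Suc i) - d i\<bar>) = (\<Sum>i<n. \<bar>d (Suc i)\<bar> - \<bar>d i\<bar>)"
    proof (rule sum.cong[OF refl])
      fix i assume "i \<in> {..<n}"
      then have i: "i < n" by simp
      have "0 \<le> sqrt (half_tanh (t i))" "sqrt (half_tanh (t i)) \<le> sqrt (half_tanh (t (Suc i)))"
        using half_tanh_bounds(1)[of "t i"] t(1)[of i] hm[OF i] i by auto
      then have "\<bar>x * (sqrt (half_tanh (t (Suc i))) - sqrt (half_tanh (t i)))\<bar> = \<bar>d (Suc i)\<bar> - \<bar>d i\<bar>"
        unfolding d_def abs_mult by (simp add: right_diff_distrib)
      moreover have "d (Suc i) - d i = x * (sqrt (half_tanh (t (Suc i))) - sqrt (half_tanh (t i)))"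
        by (simp add: d_def algebra_simps)
      ultimately show "\<bar>d (Suc i) - d i\<bar> = \<bar>d (Suc i)\<bar> - \<bar>d i\<bar>" by simp
    qed
    also have "\<dots> = \<bar>d n\<bar> - \<bar>d 0\<bar>" by (rule sum_lessThan_telescope)
    also have "\<dots> \<le> 1" using d1[of n] by simp
    finally show ?thesis .
  qed
  have half: "(\<Sum>i<n. \<bar>weighted_avg (avg h y) (s (Suc i)) (c * d (Suc i)) - weighted_avg (avg h y) (s i) (c * d i)\<bar> powr \<rho>) \<le> K"
    if h: "integrable lborel h" "\<And>u. 0 \<le> h u" and ctl: "avg_controlled \<rho> \<alpha> h y" and c: "\<bar>c\<bar> = 1" for h y c
  proof -
    \<comment> \<open>Averages are set to 0 at nonpositive radii, where nothing bounds them; the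
      integral over \<open>l > 0\<close> does not see the change.\<close>
    define a where "a r = (if 0 < r then avg h y r else 0)" for r
    have "continuous_on UNIV (cumul h)" using isCont_cumul[OF h(1)] by (simp add: continuous_on_eq_continuous_at)
    then have [measurable]: "cumul h \<in> borel_measurable borel" by (rule borel_measurable_continuous_onI)
    have "weighted_avg (avg h y) (s i) (c * d i) = weighted_avg a (s i) (c * d i)" if "i \<le> n" for i
      unfolding weighted_avg_def a_def using s[OF that]
      by (intro Bochner_Integration.integral_cong) (auto simp: indicator_def)
    then have "(\<Sum>i<n. \<bar>weighted_avg (avg h y) (s (Suc i)) (c * d (Suc i)) - weighted_avg (avg h y) (s i) (c * d i)\<bar> powr \<rho>)
      = (\<Sum>i<n. \<bar>weighted_avg a (s (Suc i)) (c * d (Suc i)) - weighted_avg a (s i) (c * d i)\<bar> powr \<rho>)"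
      by (intro sum.cong) auto
    also have "\<dots> \<le> K" unfolding K_def
    proof (rule variation_weighted_avg_le)
      show "a \<in> borel_measurable borel" unfolding a_def avg_def by measurable
      show "0 \<le> a r" for r using avg_nonneg[OF h] by (simp add: a_def)
      show "a r \<le> \<alpha>" for r using ctl \<alpha> by (simp add: a_def avg_controlled_def)
      show "a r = 0" if "r \<le> 0" for r using that by (simp add: a_def)
      show "(\<Sum>i<n. \<bar>a (r (Suc i)) - a (r i)\<bar> powr \<rho>) \<le> \<alpha> powr \<rho>"
        if r: "\<And>i. i \<le> n \<Longrightarrow> 0 < r i" "\<And>i. i < n \<Longrightarrow> r i \<le> r (Suc i)" for r
      proof -
        have "(\<Sum>i<n. \<bar>a (r (Suc i)) - a (r i)\<bar> powr \<rho>) = (\<Sum>i<n. \<bar>avg h y (r (Suc i)) - avg h y (r i)\<bar> powr \<rho>)"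
          using r by (intro sum.cong) (auto simp: a_def)
        then show ?thesis using ctl r unfolding avg_controlled_def by auto
      qed
      have "\<bar>c * d (Suc i) - c * d i\<bar> = \<bar>d (Suc i) - d i\<bar>" for i
        using c by (simp add: right_diff_distrib[symmetric] abs_mult)
      then show "(\<Sum>i<n. \<bar>c * d (Suc i) - c * d i\<bar>) \<le> 1" using dsum by simp
      show "\<bar>c * d i\<bar> \<le> 1" if "i \<le> n" for i using d1[OF that] c by (simp add: abs_mult)
    qed (use s s_mono \<alpha> \<rho> in auto)
    finally show ?thesis .
  qed
  let ?A = "\<lambda>i. weighted_avg (avg g x) (s i) (1 * d i)"
  let ?B = "\<lambda>i. weighted_avg (avg (\<lambda>u. g (- u)) (- x)) (s i) (- 1 * d i)"
  have A: "(\<Sum>i<n. \<bar>?A (Suc i) - ?A i\<bar> powr \<rho>) \<le> K" using half[OF g fwd, of 1] by simp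
  have B: "(\<Sum>i<n. \<bar>?B (Suc i) - ?B i\<bar> powr \<rho>) \<le> K"
    using lborel_integrable_real_affine[OF g(1), of "-1" 0] g by (intro half[OF _ _ bwd]) auto
  have "(\<Sum>i<n. \<bar>OU (t (Suc i)) g x - OU (t i) g x\<bar> powr \<rho>)
    \<le> (\<Sum>i<n. 3 powr \<rho> * (\<bar>?A (Suc i) - ?A i\<bar> powr \<rho> + \<bar>?B (Suc i) - ?B i\<bar> powr \<rho>))"
  proof (rule sum_mono)
    fix i assume "i \<in> {..<n}"
    then have "OU (t (Suc i)) g x - OU (t i) g x = (?A (Suc i) - ?A i) + (?B (Suc i) - ?B i)"
      using OU_eq_weighted_avg[OF t(1) g(1)] by (simp add: s_def d_def)
    then have "\<bar>OU (t (Suc i)) g x - OU (t i) g x\<bar> \<le> \<bar>?A (Suc i) - ?A i\<bar> + \<bar>?B (Suc i) - ?B i\<bar> + 0"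
      by linarith
    then have "\<bar>OU (t (Suc i)) g x - OU (t i) g x\<bar> powr \<rho> \<le> (\<bar>?A (Suc i) - ?A i\<bar> + \<bar>?B (Suc i) - ?B i\<bar> + 0) powr \<rho>"
      using \<rho> by (intro powr_mono2) auto
    also have "\<dots> \<le> 3 powr \<rho> * (\<bar>?A (Suc i) - ?A i\<bar> powr \<rho> + \<bar>?B (Suc i) - ?B i\<bar> powr \<rho> + 0 powr \<rho>)"
      using \<rho> by (intro powr_add3_le) auto
    finally show "\<bar>OU (t (Suc i)) g x - OU (t i) g x\<bar> powr \<rho> \<le> 3 powr \<rho> * (\<bar>?A (Suc i) - ?A i\<bar> powr \<rho> + \<bar>?B (Suc i) - ?B i\<bar> powr \<rho>)"
      by simp
  qed
  also have "\<dots> = 3 powr \<rho> * ((\<Sum>i<n. \<bar>?A (Suc i) - ?A i\<bar> powr \<rho>) + (\<Sum>i<n. \<bar>?B (Suc i) - ?B i\<bar> powr \<rho>))"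
    by (simp only: sum_distrib_left[symmetric] sum.distrib)
  also have "\<dots> \<le> 3 powr \<rho> * (K + K)" using A B by (intro mult_left_mono add_mono) auto
  also have "\<dots> \<le> 3 powr \<rho> * (3 * K)" by (intro mult_left_mono) (auto simp: K_def)
  also have "\<dots> = 9 * (18 * exp (11 / 2)) powr \<rho> * \<alpha> powr \<rho>"
    using powr_mult[of 3 "6 * exp (11 / 2)" \<rho>] by (simp add: K_def)
  finally show ?thesis .
qed

section \<open>Regularity of the semigroup\<close>

lemma borel_measurable_OU_kernel [measurable]:
  "(\<lambda>u. OU_kernel t x u) \<in> borel_measurable borel"
  "(\<lambda>(x, u). OU_kernel t x u) \<in> borel_measurable (borel \<Otimes>\<^sub>M borel)"
  unfolding OU_kernel_def R_def split_beta' by measurable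

lemma abs_OU_kernel_le:
  assumes "0 < t"
  shows "\<bar>OU_kernel t x u\<bar> \<le> exp (R x) / sqrt (1 - exp (- 2 * t))"
proof -
  have "exp (- (1/2) * (exp (- t) * u - x)\<^sup>2 / (1 - exp (-2 * t))) \<le> 1"
    using one_minus_exp_pos[OF assms] by (simp add: divide_nonneg_pos)
  then have "exp (R x) / sqrt (1 - exp (- 2 * t)) * exp (- (1/2) * (exp (- t) * u - x)\<^sup>2 / (1 - exp (-2 * t)))
     \<le> exp (R x) / sqrt (1 - exp (- 2 * t)) * 1"
    using one_minus_exp_pos[OF assms] by (intro mult_left_mono) auto
  then show ?thesis using one_minus_exp_pos[OF assms] by (simp add: OU_kernel_def abs_mult)
qed

lemma integrable_OU_kernel:
  assumes f: "integrable gauss f" and t: "0 < t"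
  shows "integrable gauss (\<lambda>u. f u * OU_kernel t x u)"
proof (rule Bochner_Integration.integrable_bound)
  let ?B = "exp (R x) / sqrt (1 - exp (- 2 * t))"
  have [measurable]: "f \<in> borel_measurable borel" using borel_measurable_integrable[OF f] by simp
  show "integrable gauss (\<lambda>u. f u * ?B)" using f by simp
  show "(\<lambda>u. f u * OU_kernel t x u) \<in> borel_measurable gauss" by simp
  show "AE u in gauss. norm (f u * OU_kernel t x u) \<le> norm (f u * ?B)"
    using abs_OU_kernel_le[OF t] one_minus_exp_pos[OF t]
    by (intro AE_I2) (auto simp: abs_mult simp del: times_divide_eq_right intro!: mult_left_mono)
qed

lemma isCont_OU:
  assumes f: "integrable gauss f" and t: "0 < t"
  shows "isCont (\<lambda>t. OU t f x) t"
  unfolding continuous_at_sequentially comp_def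
proof (intro allI impI)
  fix X assume X: "X \<longlonglongrightarrow> t"
  \<comment> \<open>\<open>B\<close> bounds the kernel at all times after \<open>t / 2\<close>,
    since \<open>exp (- 2 * (t / 2)) = exp (- t)\<close>; it supplies the dominating
    function.\<close>
  define B where "B = exp (R x) / sqrt (1 - exp (- t))"
  have [measurable]: "f \<in> borel_measurable borel" using borel_measurable_integrable[OF f] by simp
  have "eventually (\<lambda>n. t / 2 < X n) sequentially" using X t by (intro order_tendstoD(1)[OF X]) auto
  then obtain N where N: "\<And>n. N \<le> n \<Longrightarrow> t / 2 < X n" by (auto simp: eventually_sequentially)
  have "(\<lambda>n. OU (X (n + N)) f x) \<longlonglongrightarrow> OU t f x"
    unfolding OU_def
  proof (rule integral_dominated_convergence[where w="\<lambda>u. \<bar>f u * B\<bar>"])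
    show "integrable gauss (\<lambda>u. \<bar>f u * B\<bar>)" using f by auto
    show "AE u in gauss. (\<lambda>n. f u * OU_kernel (X (n + N)) x u) \<longlonglongrightarrow> f u * OU_kernel t x u"
      unfolding OU_kernel_def using one_minus_exp_pos[OF t]
      by (intro AE_I2 tendsto_intros LIMSEQ_ignore_initial_segment X) auto
    show "AE u in gauss. norm (f u * OU_kernel (X (n + N)) x u) \<le> \<bar>f u * B\<bar>" for n
    proof (intro AE_I2)
      fix u
      have X': "t / 2 < X (n + N)" using N by simp
      then have "0 < X (n + N)" using t by simp
      then have "\<bar>OU_kernel (X (n + N)) x u\<bar> \<le> exp (R x) / sqrt (1 - exp (- 2 * X (n + N)))"
        by (rule abs_OU_kernel_le)
      also have "\<dots> \<le> B" unfolding B_def using X' t one_minus_exp_pos[of "t/2"]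
        by (intro divide_left_mono real_sqrt_le_mono mult_pos_pos) auto
      finally have "\<bar>f u\<bar> * \<bar>OU_kernel (X (n + N)) x u\<bar> \<le> \<bar>f u\<bar> * B" by (intro mult_left_mono) auto
      then show "norm (f u * OU_kernel (X (n + N)) x u) \<le> \<bar>f u * B\<bar>"
        using one_minus_exp_pos[of "t/2"] t by (simp add: abs_mult B_def)
    qed
  qed simp_all
  then show "(\<lambda>n. OU (X n) f x) \<longlonglongrightarrow> OU t f x" by (rule LIMSEQ_offset)
qed

lemma borel_measurable_OU [measurable]:
  assumes "f \<in> borel_measurable borel"
  shows "(\<lambda>x. OU t f x) \<in> borel_measurable borel"
proof -
  interpret G: prob_space gauss by (rule prob_space_gauss)
  have "(\<lambda>(x, u). f u * OU_kernel t x u) \<in> borel_measurable (borel \<Otimes>\<^sub>M borel)"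
    using assms borel_measurable_OU_kernel(2)[of t] by measurable
  then have "(\<lambda>(x, u). f u * OU_kernel t x u) \<in> borel_measurable (borel \<Otimes>\<^sub>M gauss)"
    by (subst measurable_cong_sets[OF sets_pair_measure_cong[OF refl sets_gauss] refl])
  then show ?thesis unfolding OU_def by (rule G.borel_measurable_lebesgue_integral)
qed

lemma rational_approximation:
  obtains q :: "nat \<Rightarrow> rat" where "(\<lambda>k. real_of_rat (q k)) \<longlonglongrightarrow> (t::real)"
proof -
  have "\<exists>q. \<bar>real_of_rat q - t\<bar> < inverse (real (Suc k))" for k
  proof -
    obtain q where "t < real_of_rat q" "real_of_rat q < t + inverse (real (Suc k))"
      using of_rat_dense[of t "t + inverse (real (Suc k))"] by auto
    then show ?thesis by (intro exI[of _ q]) auto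
  qed
  then obtain q where q: "\<And>k. \<bar>real_of_rat (q k) - t\<bar> < inverse (real (Suc k))" by metis
  have "(\<lambda>k. real_of_rat (q k) - t) \<longlonglongrightarrow> 0"
    by (rule Lim_null_comparison[OF _ LIMSEQ_inverse_real_of_nat])
      (use q in \<open>auto intro!: always_eventually less_imp_le\<close>)
  then have "(\<lambda>k. real_of_rat (q k)) \<longlonglongrightarrow> t" by (simp add: LIM_zero_iff)
  then show ?thesis by (rule that)
qed

text \<open>The exceptional set is a countable union because rational time sequences suffice, by
  continuity in time.\<close>
lemma sets_variation_OU:
  assumes f: "integrable gauss f" and \<rho>: "0 < \<rho>"
  shows "{x. variation \<rho> {0<..} (\<lambda>t. OU t f x) > ereal \<alpha>} \<in> sets gauss"
proof -
  have [measurable]: "f \<in> borel_measurable borel" using borel_measurable_integrable[OF f] by simp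
  define V where "V n t x = (\<Sum>i\<in>{1..n}. \<bar>OU (t i) f x - OU (t (i - 1)) f x\<bar> powr \<rho>) powr (1 / \<rho>)" for n and t :: "nat \<Rightarrow> real" and x
  define adm where "adm n t \<longleftrightarrow> (\<forall>i\<le>n. 0 < t i) \<and> (\<forall>i<n. t i < t (Suc i))" for n :: nat and t :: "nat \<Rightarrow> real"
  \<comment> \<open>Finite time sequences become nonempty lists of rationals, a countable type; the
    number of steps is the length minus one.\<close>
  define P where "P = {qs :: rat list. qs \<noteq> [] \<and> adm (length qs - 1) (\<lambda>i. real_of_rat (qs ! i))}"
  have [measurable]: "V n t \<in> borel_measurable borel" for n t
    unfolding V_def by measurable
  have var: "variation \<rho> {0<..} (\<lambda>t. OU t f x) > ereal \<alpha> \<longleftrightarrow> (\<exists>n t. adm n t \<and> \<alpha> < V n t x)" for x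
    unfolding variation_def V_def adm_def by (subst less_SUP_iff) auto
  have "(\<exists>n t. adm n t \<and> \<alpha> < V n t x) \<longleftrightarrow> (\<exists>qs\<in>P. \<alpha> < V (length qs - 1) (\<lambda>i. real_of_rat (qs ! i)) x)" for x
  proof
    assume "\<exists>n t. adm n t \<and> \<alpha> < V n t x"
    then obtain n t where t: "adm n t" "\<alpha> < V n t x" by blast
    have "\<exists>q :: nat \<Rightarrow> rat. (\<lambda>k. real_of_rat (q k)) \<longlonglongrightarrow> t i" for i
      using rational_approximation[of "t i"] by blast
    then obtain q :: "nat \<Rightarrow> nat \<Rightarrow> rat" where q: "\<And>i. (\<lambda>k. real_of_rat (q i k)) \<longlonglongrightarrow> t i" by metis
    have OUlim: "(\<lambda>k. OU (real_of_rat (q i k)) f x) \<longlonglongrightarrow> OU (t i) f x" if "i \<le> n" for i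
      using t(1) that by (intro isCont_tendsto_compose[OF isCont_OU[OF f] q]) (auto simp: adm_def)
    have "(\<lambda>k. V n (\<lambda>i. real_of_rat (q i k)) x) \<longlonglongrightarrow> V n t x"
      unfolding V_def using \<rho>
      by (intro tendsto_powr' tendsto_const tendsto_sum tendsto_rabs tendsto_diff OUlim) (auto intro!: always_eventually sum_nonneg)
    then have e1: "eventually (\<lambda>k. \<alpha> < V n (\<lambda>i. real_of_rat (q i k)) x) sequentially"
      by (rule order_tendstoD) (rule t)
    have e2: "eventually (\<lambda>k. \<forall>i\<in>{..n}. 0 < real_of_rat (q i k)) sequentially"
      using t(1) by (intro eventually_ball_finite ballI order_tendstoD(1)[OF q]) (auto simp: adm_def)
    have e3: "eventually (\<lambda>k. \<forall>i\<in>{..<n}. 0 < real_of_rat (q (Suc i) k) - real_of_rat (q i k)) sequentially"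
      using t(1) by (intro eventually_ball_finite ballI order_tendstoD(1)[OF tendsto_diff[OF q q]]) (auto simp: adm_def)
    obtain k where k: "\<alpha> < V n (\<lambda>i. real_of_rat (q i k)) x" "\<forall>i\<in>{..n}. 0 < real_of_rat (q i k)"
       "\<forall>i\<in>{..<n}. 0 < real_of_rat (q (Suc i) k) - real_of_rat (q i k)"
      using eventually_happens[OF eventually_conj[OF e1 eventually_conj[OF e2 e3]]] by auto
    define qs where "qs = map (\<lambda>i. q i k) [0..<Suc n]"
    have len: "length qs = Suc n" by (simp add: qs_def)
    have nth: "qs ! i = q i k" if "i \<le> n" for i using that by (simp add: qs_def del: upt_Suc)
    have "V n (\<lambda>i. real_of_rat (qs ! i)) x = V n (\<lambda>i. real_of_rat (q i k)) x"
      unfolding V_def by (intro arg_cong[where f="\<lambda>z. z powr (1 / \<rho>)"] sum.cong) (auto simp: nth)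
    moreover have "qs \<in> P" using k(2,3) len by (auto simp: P_def adm_def nth)
    ultimately show "\<exists>qs\<in>P. \<alpha> < V (length qs - 1) (\<lambda>i. real_of_rat (qs ! i)) x"
      using k(1) len by (intro bexI[of _ qs]) auto
  qed (auto simp: P_def)
  then have "{x. variation \<rho> {0<..} (\<lambda>t. OU t f x) > ereal \<alpha>}
    = (\<Union>qs\<in>P. {x. \<alpha> < V (length qs - 1) (\<lambda>i. real_of_rat (qs ! i)) x})"
    unfolding var by auto
  also have "\<dots> \<in> sets borel" by (intro sets.countable_UN'' countableI_type) measurable
  finally show ?thesis by simp
qed

section \<open>The weak type estimate\<close>

text \<open>For \<open>f \<ge> 0\<close> the variation passes under the integral, where the kernel
  estimate applies for each \<open>u\<close>; the sum of first powers then dominates the sum of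
  powers. Asking for \<open>B\<close> only where \<open>f u\<close> is nonzero lets the lemma serve
  functions supported far from \<open>x\<close>.\<close>

lemma global_variation_OU_le:
  assumes f: "integrable gauss f" "\<And>u. 0 \<le> f u" and \<rho>: "1 \<le> \<rho>"
    and t: "\<And>i. i \<le> n \<Longrightarrow> 0 < t i" "\<And>i. i < n \<Longrightarrow> t i \<le> t (Suc i)"
    and B: "\<And>i u. i \<le> n \<Longrightarrow> f u \<noteq> 0 \<Longrightarrow> OU_kernel (t i) x u \<le> B"
  shows "(\<Sum>i<n. \<bar>OU (t (Suc i)) f x - OU (t i) f x\<bar> powr \<rho>) \<le> (5 * B * (\<integral>u. f u \<partial>gauss)) powr \<rho>"
proof -
  let ?K = "\<lambda>i u. OU_kernel (t i) x u"
  have int: "integrable gauss (\<lambda>u. f u * ?K i u)" if "i \<le> n" for i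
    using integrable_OU_kernel[OF f(1) t(1)[OF that]] .
  have int': "integrable gauss (\<lambda>u. f u * \<bar>?K (Suc i) u - ?K i u\<bar>)" if "i < n" for i
  proof -
    have "integrable gauss (\<lambda>u. \<bar>f u * ?K (Suc i) u - f u * ?K i u\<bar>)"
      using that by (intro integrable_abs Bochner_Integration.integrable_diff int) auto
    then show ?thesis using f(2) by (simp add: right_diff_distrib[symmetric] abs_mult)
  qed
  have "(\<Sum>i<n. \<bar>OU (t (Suc i)) f x - OU (t i) f x\<bar>) \<le> (\<Sum>i<n. \<integral>u. f u * \<bar>?K (Suc i) u - ?K i u\<bar> \<partial>gauss)"
  proof (rule sum_mono)
    fix i assume "i \<in> {..<n}"
    then have "OU (t (Suc i)) f x - OU (t i) f x = (\<integral>u. f u * ?K (Suc i) u - f u * ?K i u \<partial>gauss)"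
      unfolding OU_def by (intro Bochner_Integration.integral_diff[symmetric] int) auto
    also have "\<bar>\<dots>\<bar> \<le> (\<integral>u. \<bar>f u * ?K (Suc i) u - f u * ?K i u\<bar> \<partial>gauss)" by (rule integral_abs_bound)
    also have "\<dots> = (\<integral>u. f u * \<bar>?K (Suc i) u - ?K i u\<bar> \<partial>gauss)"
      using f(2) by (simp add: right_diff_distrib[symmetric] abs_mult)
    finally show "\<bar>OU (t (Suc i)) f x - OU (t i) f x\<bar> \<le> (\<integral>u. f u * \<bar>?K (Suc i) u - ?K i u\<bar> \<partial>gauss)" .
  qed
  also have "\<dots> = (\<integral>u. (\<Sum>i<n. f u * \<bar>?K (Suc i) u - ?K i u\<bar>) \<partial>gauss)"
    using int' by (subst Bochner_Integration.integral_sum) auto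
  also have "\<dots> \<le> (\<integral>u. f u * (5 * B) \<partial>gauss)"
  proof (rule integral_mono)
    show "integrable gauss (\<lambda>u. \<Sum>i<n. f u * \<bar>?K (Suc i) u - ?K i u\<bar>)"
      using int' by (intro Bochner_Integration.integrable_sum) auto
    show "integrable gauss (\<lambda>u. f u * (5 * B))" using f by simp
    fix u
    show "(\<Sum>i<n. f u * \<bar>?K (Suc i) u - ?K i u\<bar>) \<le> f u * (5 * B)"
    proof (cases "f u = 0")
      case False
      then show ?thesis unfolding sum_distrib_left[symmetric]
        using f(2) t B by (intro mult_left_mono variation_OU_kernel_le) auto
    qed simp
  qed
  also have "\<dots> = 5 * B * (\<integral>u. f u \<partial>gauss)" by simp
  finally have *: "(\<Sum>i<n. \<bar>OU (t (Suc i)) f x - OU (t i) f x\<bar>) \<le> 5 * B * (\<integral>u. f u \<partial>gauss)" .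
  have "(\<Sum>i<n. \<bar>OU (t (Suc i)) f x - OU (t i) f x\<bar> powr \<rho>) \<le> (\<Sum>i<n. \<bar>OU (t (Suc i)) f x - OU (t i) f x\<bar>) powr \<rho>"
    using \<rho> by (intro sum_powr_le) auto
  also have "\<dots> \<le> (5 * B * (\<integral>u. f u \<partial>gauss)) powr \<rho>"
    using * \<rho> by (intro powr_mono2 sum_nonneg) auto
  finally show ?thesis .
qed

text \<open>On \<open>fat_shell j\<close> the Gaussian density is comparable to \<open>exp (- j / 2)\<close>, which transfers Lebesgue
  bounds to \<open>gauss\<close>.\<close>
definition shell :: "nat \<Rightarrow> real set" where
  "shell j = {x. real j \<le> x\<^sup>2 \<and> x\<^sup>2 < real j + 1}"

definition fat_shell :: "nat \<Rightarrow> real set" where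
  "fat_shell j = {u. real j - 3 \<le> u\<^sup>2 \<and> u\<^sup>2 < real j + 4}"

lemma sets_shell [measurable]: "shell j \<in> sets borel" "fat_shell j \<in> sets borel"
  unfolding shell_def fat_shell_def by measurable

text \<open>A smaller distance would force \<open>|u + x| \<le> 2 * (1 + |x|)\<close>, hence
  \<open>|u^2 - x^2| < 2\<close>, which is within the margin 3 of the fat shell.\<close>

lemma far_from_shell:
  assumes x: "x \<in> shell j" and u: "u \<notin> fat_shell j"
  shows "1 / (1 + \<bar>x\<bar>) \<le> \<bar>u - x\<bar>"
proof (rule ccontr)
  assume "\<not> 1 / (1 + \<bar>x\<bar>) \<le> \<bar>u - x\<bar>"
  then have *: "\<bar>u - x\<bar> * (1 + \<bar>x\<bar>) < 1" by (simp add: field_simps)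
  have "\<bar>u - x\<bar> * 1 \<le> \<bar>u - x\<bar> * (1 + \<bar>x\<bar>)" by (intro mult_left_mono) auto
  then have "\<bar>u - x\<bar> < 1" using * by simp
  moreover have "\<bar>(u - x) + 2 * x\<bar> \<le> \<bar>u - x\<bar> + \<bar>2 * x\<bar>" by (rule abs_triangle_ineq)
  ultimately have "\<bar>u + x\<bar> \<le> 2 * (1 + \<bar>x\<bar>)" by (simp add: abs_mult)
  then have "\<bar>u - x\<bar> * \<bar>u + x\<bar> \<le> \<bar>u - x\<bar> * (2 * (1 + \<bar>x\<bar>))" by (intro mult_left_mono) auto
  also have "\<dots> = 2 * (\<bar>u - x\<bar> * (1 + \<bar>x\<bar>))" by simp
  also have "\<dots> < 2 * 1" using * by (intro mult_strict_left_mono) auto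
  finally have "\<bar>u\<^sup>2 - x\<^sup>2\<bar> < 2" by (simp add: abs_mult[symmetric] power2_eq_square algebra_simps)
  then show False using x u unfolding shell_def fat_shell_def mem_Collect_eq by linarith
qed

text \<open>A point \<open>u\<close> lies only in fat shells whose index differs from the floor of
  \<open>u^2\<close> by at most 3.\<close>

lemma suminf_indicator_fat_shell_le: "(\<Sum>j. indicator (fat_shell j) u :: ennreal) \<le> 7"
proof -
  define m where "m = nat \<lfloor>u\<^sup>2\<rfloor>"
  have m: "real m \<le> u\<^sup>2" "u\<^sup>2 < real m + 1" unfolding m_def by (simp_all add: of_nat_floor)
  have near: "j \<in> {m-3..m+3}" if "u \<in> fat_shell j" for j
  proof -
    have "real j < real m + 4" "real m < real j + 4" using that m unfolding fat_shell_def mem_Collect_eq by linarith+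
    then show ?thesis by auto
  qed
  have "(\<Sum>j. indicator (fat_shell j) u :: ennreal) = (\<Sum>j\<in>{m-3..m+3}. indicator (fat_shell j) u)"
    by (rule suminf_finite) (use near in \<open>auto simp: indicator_def\<close>)
  also have "\<dots> \<le> (\<Sum>j\<in>{m-3..m+3}. 1)" by (intro sum_mono) (auto simp: indicator_def)
  also have "\<dots> \<le> of_nat 7" unfolding sum_constant mult_1_right of_nat_le_iff by simp
  finally show ?thesis by simp
qed

lemma emeasure_gauss_shell_le:
  assumes A[measurable]: "A \<in> sets borel"
  shows "emeasure gauss (shell j \<inter> A) \<le> ennreal (exp (- real j / 2) / sqrt (2 * pi)) * emeasure lborel A"
proof -
  have "emeasure gauss (shell j \<inter> A) = (\<integral>\<^sup>+x. ennreal (std_normal_density x) * indicator (shell j \<inter> A) x \<partial>lborel)"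
    unfolding gauss_eq by (subst emeasure_density) auto
  also have "\<dots> \<le> (\<integral>\<^sup>+x. ennreal (exp (- real j / 2) / sqrt (2 * pi)) * indicator A x \<partial>lborel)"
  proof (intro nn_integral_mono)
    fix x
    have "std_normal_density x \<le> exp (- real j / 2) / sqrt (2 * pi)" if "x \<in> shell j"
    proof -
      have "real j \<le> x\<^sup>2" using that by (simp add: shell_def)
      then show ?thesis unfolding std_normal_density_def by (simp add: divide_right_mono)
    qed
    then show "ennreal (std_normal_density x) * indicator (shell j \<inter> A) x \<le> ennreal (exp (- real j / 2) / sqrt (2 * pi)) * indicator A x"
      by (auto simp: indicator_def intro: ennreal_leI)
  qed
  also have "\<dots> = ennreal (exp (- real j / 2) / sqrt (2 * pi)) * emeasure lborel A"
    by (subst nn_integral_cmult_indicator) auto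
  finally show ?thesis .
qed

text \<open>On the fat shell \<open>u^2 < j + 4\<close>, so the density is at least
  \<open>exp (- j / 2 - 2) / sqrt (2 * pi)\<close>: the origin of the exponent
  \<open>j / 2 + 2\<close>.\<close>

lemma fat_shell_restriction:
  assumes f: "integrable gauss f" "\<And>u. 0 \<le> f u"
  shows "integrable lborel (\<lambda>u. f u * indicator (fat_shell j) u)"
    and "(\<integral>u. f u * indicator (fat_shell j) u \<partial>lborel)
      \<le> sqrt (2 * pi) * exp (real j / 2 + 2) * (\<integral>u. f u * indicator (fat_shell j) u \<partial>gauss)"
proof -
  have [measurable]: "f \<in> borel_measurable borel" using borel_measurable_integrable[OF f(1)] by simp
  let ?c = "sqrt (2 * pi) * exp (real j / 2 + 2)"
  have "integrable gauss (\<lambda>u. indicator (fat_shell j) u *\<^sub>R f u)"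
    using f by (intro integrable_mult_indicator) auto
  then have int: "integrable lborel (\<lambda>u. std_normal_density u * (f u * indicator (fat_shell j) u))"
    unfolding gauss_eq by (subst (asm) integrable_density) (auto simp: mult.commute)
  have le: "f u * indicator (fat_shell j) u \<le> ?c * (std_normal_density u * (f u * indicator (fat_shell j) u))" for u
  proof (cases "u \<in> fat_shell j")
    case True
    then have "u\<^sup>2 \<le> real j + 4" by (simp add: fat_shell_def)
    then have "exp 0 \<le> exp (real j / 2 + 2 + - u\<^sup>2 / 2)" by simp
    also have "\<dots> = ?c * std_normal_density u" unfolding std_normal_density_def exp_add by simp
    finally have "1 * f u \<le> (?c * std_normal_density u) * f u" using f(2) by (intro mult_right_mono) auto
    then show ?thesis using True by (simp add: mult_ac)
  qed simp
  show int2: "integrable lborel (\<lambda>u. f u * indicator (fat_shell j) u)"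
  proof (rule Bochner_Integration.integrable_bound)
    show "integrable lborel (\<lambda>u. ?c * (std_normal_density u * (f u * indicator (fat_shell j) u)))"
      using int by simp
    show "AE u in lborel. norm (f u * indicator (fat_shell j) u) \<le> norm (?c * (std_normal_density u * (f u * indicator (fat_shell j) u)))"
    proof (intro AE_I2)
      fix u
      have "0 \<le> f u * indicator (fat_shell j) u" using f(2) by simp
      then show "norm (f u * indicator (fat_shell j) u) \<le> norm (?c * (std_normal_density u * (f u * indicator (fat_shell j) u)))"
        using le[of u] unfolding real_norm_def by (simp only: abs_of_nonneg)
    qed
  qed measurable
  have "(\<integral>u. f u * indicator (fat_shell j) u \<partial>lborel) \<le> (\<integral>u. ?c * (std_normal_density u * (f u * indicator (fat_shell j) u)) \<partial>lborel)"
    using int int2 le by (intro integral_mono) auto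
  also have "\<dots> = ?c * (\<integral>u. f u * indicator (fat_shell j) u \<partial>gauss)"
    unfolding gauss_eq by (subst integral_density) auto
  finally show "(\<integral>u. f u * indicator (fat_shell j) u \<partial>lborel) \<le> ?c * (\<integral>u. f u * indicator (fat_shell j) u \<partial>gauss)" .
qed

lemma OU_add:
  assumes "integrable gauss f" "integrable gauss g" "0 < t"
  shows "OU t (\<lambda>u. f u + g u) x = OU t f x + OU t g x"
  unfolding OU_def distrib_right
  using assms by (intro Bochner_Integration.integral_add integrable_OU_kernel)

text \<open>Split \<open>f\<close> into its part \<open>g\<close> on the fat shell and the rest
  \<open>h\<close>, and time at the \<open>T\<close>, depending on \<open>x\<close>, with
  \<open>sqrt (1 - exp (- 2 * T)) = 1 / (2 * (1 + |x|))\<close>. Only \<open>g\<close> at times up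
  to \<open>T\<close> is local; the other two pieces fall under the kernel bound.\<close>

lemma variation_OU_nonneg_le:
  assumes f: "integrable gauss f" "\<And>u. 0 \<le> f u" and \<beta>: "0 < \<beta>" and \<rho>: "1 \<le> \<rho>"
    and x: "x \<in> shell j"
    and fwd: "avg_controlled \<rho> \<beta> (\<lambda>u. f u * indicator (fat_shell j) u) x"
    and bwd: "avg_controlled \<rho> \<beta> (\<lambda>u. f (- u) * indicator (fat_shell j) (- u)) (- x)"
    and glob: "20 * (\<integral>u. f u \<partial>gauss) * ((1 + \<bar>x\<bar>) * exp (R x)) \<le> \<beta>"
    and t: "\<And>i. i \<le> n \<Longrightarrow> 0 < t i" "\<And>i. i < n \<Longrightarrow> t i \<le> t (Suc i)"
  shows "(\<Sum>i<n. \<bar>OU (t (Suc i)) f x - OU (t i) f x\<bar> powr \<rho>)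
    \<le> 3 powr \<rho> * (9 * (18 * exp (11 / 2)) powr \<rho> + 2) * \<beta> powr \<rho>"
proof -
  define g where "g u = f u * indicator (fat_shell j) u" for u
  define h where "h u = f u * indicator (- fat_shell j) u" for u
  have [measurable]: "f \<in> borel_measurable borel" using borel_measurable_integrable[OF f(1)] by simp
  have g: "integrable gauss g" "\<And>u. 0 \<le> g u"
    using integrable_mult_indicator[of "fat_shell j" gauss f] f by (auto simp: g_def[abs_def] mult.commute)
  have h: "integrable gauss h" "\<And>u. 0 \<le> h u"
    using integrable_mult_indicator[of "- fat_shell j" gauss f] f by (auto simp: h_def[abs_def] mult.commute)
  have gl: "integrable lborel g" unfolding g_def using fat_shell_restriction(1)[OF f] .
  have fgh: "f = (\<lambda>u. g u + h u)" by (auto simp: g_def h_def indicator_def)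
  define s0 where "s0 = 1 / (2 * (1 + \<bar>x\<bar>))"
  define T where "T = - ln (1 - s0\<^sup>2) / 2"
  have "s0 \<le> 1 / 2" by (simp add: s0_def field_simps)
  moreover have s0: "0 < s0" by (simp add: s0_def add_pos_nonneg)
  ultimately have "s0\<^sup>2 \<le> (1/2)\<^sup>2" by (intro power_mono) auto
  then have s1: "0 < s0\<^sup>2" "s0\<^sup>2 < 1" using s0 by (auto simp: power2_eq_square)
  have T: "0 < T" using s1 by (simp add: T_def)
  have sT: "sqrt (1 - exp (- 2 * T)) = s0" using s1 s0 by (simp add: T_def)
  let ?d = "\<lambda>F i. F (t (Suc i)) - F (t i) :: real"
  \<comment> \<open>Truncating the time argument instead of the sequence keeps all \<open>n\<close>
    steps in each piece. \<open>A + B\<close> contains the value at \<open>T\<close> once too often,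
    a constant that drops out of differences.\<close>
  define A where "A t = OU (min t T) g x" for t
  define B where "B t = OU (max t T) g x" for t
  define D where "D t = OU t h x" for t
  have OU_ABD: "OU t f x = A t + B t + D t - OU T g x" if "0 < t" for t
    using OU_add[OF g(1) h(1) that] unfolding fgh[symmetric] A_def B_def D_def
    by (cases "t \<le> T") (auto simp: min_def max_def)
  define W where "W = (1 + \<bar>x\<bar>) * exp (R x)"
  have W: "0 \<le> W" "4 * (1 + \<bar>x\<bar>) * exp (R x) = 4 * W" by (auto simp: W_def)
  \<comment> \<open>The 20 in the hypothesis is 5 * 4: kernel variation times kernel
    supremum.\<close>
  have Bnd: "(5 * (4 * W) * (\<integral>u. k u \<partial>gauss)) powr \<rho> \<le> \<beta> powr \<rho>"
    if k: "integrable gauss k" "\<And>u. 0 \<le> k u" "\<And>u. k u \<le> f u" for k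
  proof (rule powr_mono2)
    have "(\<integral>u. k u \<partial>gauss) \<le> (\<integral>u. f u \<partial>gauss)" using k f by (intro integral_mono) auto
    then have "20 * W * (\<integral>u. k u \<partial>gauss) \<le> 20 * W * (\<integral>u. f u \<partial>gauss)"
      using W by (intro mult_left_mono) auto
    also have "\<dots> \<le> \<beta>" using glob unfolding W_def[symmetric] by (simp add: mult_ac)
    finally show "5 * (4 * W) * (\<integral>u. k u \<partial>gauss) \<le> \<beta>" by simp
    have "0 \<le> (\<integral>u. k u \<partial>gauss)" using k by (intro Bochner_Integration.integral_nonneg) auto
    then show "0 \<le> 5 * (4 * W) * (\<integral>u. k u \<partial>gauss)" using W by simp
  qed (use \<rho> in simp)
  have a: "(\<Sum>i<n. \<bar>?d A i\<bar> powr \<rho>) \<le> 9 * (18 * exp (11 / 2)) powr \<rho> * \<beta> powr \<rho>"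
    unfolding A_def
  proof (rule local_variation_OU_le[OF gl g(2) \<beta> \<rho>])
    show "avg_controlled \<rho> \<beta> g x" using fwd by (simp add: g_def[abs_def])
    show "avg_controlled \<rho> \<beta> (\<lambda>u. g (- u)) (- x)" using bwd by (simp add: g_def)
    show "sqrt (1 - exp (- 2 * min (t i) T)) \<le> 1 / (2 * (1 + \<bar>x\<bar>))" if "i \<le> n" for i
      unfolding s0_def[symmetric] sT[symmetric] by (intro real_sqrt_le_mono) auto
    show "min (t i) T \<le> min (t (Suc i)) T" if "i < n" for i using t(2)[OF that] by auto
  qed (use t T in auto)
  have b: "(\<Sum>i<n. \<bar>?d B i\<bar> powr \<rho>) \<le> \<beta> powr \<rho>"
  proof -
    have "(\<Sum>i<n. \<bar>?d B i\<bar> powr \<rho>) \<le> (5 * (4 * W) * (\<integral>u. g u \<partial>gauss)) powr \<rho>"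
      unfolding B_def
    proof (rule global_variation_OU_le[OF g \<rho>])
      show "max (t i) T \<le> max (t (Suc i)) T" if "i < n" for i using t(2)[OF that] by auto
      fix i u
      have "s0 \<le> sqrt (1 - exp (- 2 * max (t i) T))"
        unfolding sT[symmetric] by (intro real_sqrt_le_mono) auto
      then show "OU_kernel (max (t i) T) x u \<le> 4 * W"
        unfolding W(2)[symmetric] using T by (intro OU_kernel_le) (auto simp: s0_def)
    qed (use T in auto)
    also have "\<dots> \<le> \<beta> powr \<rho>"
      by (rule Bnd[OF g]) (use f(2) in \<open>auto simp: g_def indicator_def\<close>)
    finally show ?thesis .
  qed
  have c: "(\<Sum>i<n. \<bar>?d D i\<bar> powr \<rho>) \<le> \<beta> powr \<rho>"
  proof -
    have "(\<Sum>i<n. \<bar>?d D i\<bar> powr \<rho>) \<le> (5 * (4 * W) * (\<integral>u. h u \<partial>gauss)) powr \<rho>"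
      unfolding D_def
    proof (rule global_variation_OU_le[OF h \<rho>])
      fix i u assume "i \<le> n" "h u \<noteq> 0"
      then have "1 / (1 + \<bar>x\<bar>) \<le> \<bar>u - x\<bar>" by (intro far_from_shell[OF x]) (auto simp: h_def)
      then show "OU_kernel (t i) x u \<le> 4 * W"
        unfolding W(2)[symmetric] using t(1)[OF \<open>i \<le> n\<close>] by (intro OU_kernel_le) auto
    qed (use t in auto)
    also have "\<dots> \<le> \<beta> powr \<rho>"
      by (rule Bnd[OF h]) (use f(2) in \<open>auto simp: h_def indicator_def\<close>)
    finally show ?thesis .
  qed
  have "(\<Sum>i<n. \<bar>OU (t (Suc i)) f x - OU (t i) f x\<bar> powr \<rho>)
     \<le> (\<Sum>i<n. 3 powr \<rho> * (\<bar>?d A i\<bar> powr \<rho> + \<bar>?d B i\<bar> powr \<rho> + \<bar>?d D i\<bar> powr \<rho>))"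
  proof (rule sum_mono)
    fix i assume "i \<in> {..<n}"
    then have "OU (t (Suc i)) f x - OU (t i) f x = ?d A i + ?d B i + ?d D i"
      using OU_ABD[OF t(1)[of i]] OU_ABD[OF t(1)[of "Suc i"]] by simp
    then have "\<bar>OU (t (Suc i)) f x - OU (t i) f x\<bar> \<le> \<bar>?d A i\<bar> + \<bar>?d B i\<bar> + \<bar>?d D i\<bar>" by linarith
    then have "\<bar>OU (t (Suc i)) f x - OU (t i) f x\<bar> powr \<rho> \<le> (\<bar>?d A i\<bar> + \<bar>?d B i\<bar> + \<bar>?d D i\<bar>) powr \<rho>"
      using \<rho> by (intro powr_mono2) auto
    also have "\<dots> \<le> 3 powr \<rho> * (\<bar>?d A i\<bar> powr \<rho> + \<bar>?d B i\<bar> powr \<rho> + \<bar>?d D i\<bar> powr \<rho>)"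
      using \<rho> by (intro powr_add3_le) auto
    finally show "\<bar>OU (t (Suc i)) f x - OU (t i) f x\<bar> powr \<rho> \<le> 3 powr \<rho> * (\<bar>?d A i\<bar> powr \<rho> + \<bar>?d B i\<bar> powr \<rho> + \<bar>?d D i\<bar> powr \<rho>)" .
  qed
  also have "\<dots> = 3 powr \<rho> * ((\<Sum>i<n. \<bar>?d A i\<bar> powr \<rho>) + (\<Sum>i<n. \<bar>?d B i\<bar> powr \<rho>) + (\<Sum>i<n. \<bar>?d D i\<bar> powr \<rho>))"
    by (simp only: sum_distrib_left[symmetric] sum.distrib)
  also have "\<dots> \<le> 3 powr \<rho> * (9 * (18 * exp (11 / 2)) powr \<rho> * \<beta> powr \<rho> + \<beta> powr \<rho> + \<beta> powr \<rho>)"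
    using a b c by (intro mult_left_mono add_mono) auto
  finally show ?thesis by (simp add: algebra_simps)
qed

section \<open>Assembling the exceptional set\<close>

definition OU_controlled :: "real \<Rightarrow> real \<Rightarrow> (real \<Rightarrow> real) \<Rightarrow> real \<Rightarrow> bool" where
  "OU_controlled \<rho> \<alpha> f x \<longleftrightarrow> (\<forall>n t. (\<forall>i\<le>n. 0 < t i) \<longrightarrow> (\<forall>i<n. t i \<le> t (Suc i)) \<longrightarrow>
     (\<Sum>i<n. \<bar>OU (t (Suc i)) f x - OU (t i) f x\<bar> powr \<rho>) \<le> \<alpha> powr \<rho>)"

text \<open>The Lebesgue estimate is used on each shell separately. The upper density bound on the
  shell meets the lower one on the fat shell with a loss \<open>exp 2\<close> independent of
  \<open>j\<close>, and the overlap bound 7 sums the masses. The global part is exceptional only on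
  a superlevel set of the weight \<open>(1 + |x|) * exp (R x)\<close>.\<close>

lemma weak_type_nonneg:
  assumes \<rho>: "2 < \<rho>"
  shows "\<exists>C>0. \<forall>f \<alpha>. integrable gauss f \<longrightarrow> (\<forall>u. 0 \<le> f u) \<longrightarrow> 0 < \<alpha> \<longrightarrow>
    (\<exists>E\<in>sets borel. emeasure gauss E \<le> ennreal (C * (\<integral>u. f u \<partial>gauss) / \<alpha>) \<and>
      (\<forall>x. x \<notin> E \<longrightarrow> OU_controlled \<rho> \<alpha> f x))"
proof -
  obtain C0 where C0: "C0 > 0" and avg_weak: "\<And>f \<alpha>. integrable lborel f \<Longrightarrow> (\<And>u. 0 \<le> f u) \<Longrightarrow> 0 < \<alpha> \<Longrightarrow>
    (\<exists>E\<in>sets borel. emeasure lborel E \<le> ennreal (C0 * (\<integral>u. f u \<partial>lborel) / \<alpha>) \<and>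
      (\<forall>x. x \<notin> E \<longrightarrow> avg_controlled \<rho> \<alpha> f x))"
    using averages_weak_type[OF \<rho>] by metis
  define D where "D = 9 * (18 * exp (11 / 2)) powr \<rho> + (2::real)"
  \<comment> \<open>\<open>\<kappa> powr \<rho>\<close> is the constant lost in the pointwise
    estimate, so running it at height \<open>\<alpha> / \<kappa>\<close> returns exactly
    \<open>\<alpha> powr \<rho>\<close>.\<close>
  define \<kappa> where "\<kappa> = 3 * D powr (1 / \<rho>)"
  have D: "0 < D" by (simp add: D_def add_nonneg_pos)
  have \<kappa>: "0 < \<kappa>" using D by (simp add: \<kappa>_def)
  have \<kappa>_powr: "\<kappa> powr \<rho> = 3 powr \<rho> * D" using D \<rho> by (simp add: \<kappa>_def powr_mult powr_powr)
  define C1 where "C1 = 2 * C0 * exp 2"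
  have C1: "0 < C1" using C0 by (simp add: C1_def)
  \<comment> \<open>80 = 20 * 4 comes from the weight, 7 from the overlap of fat shells; the 2
    inside \<open>C1\<close> counts the two sides of \<open>x\<close>.\<close>
  define C where "C = (80 + 7 * C1) * \<kappa>"
  have "0 < C" using C1 \<kappa> by (simp add: C_def)
  moreover have "\<exists>E\<in>sets borel. emeasure gauss E \<le> ennreal (C * (\<integral>u. f u \<partial>gauss) / \<alpha>) \<and>
      (\<forall>x. x \<notin> E \<longrightarrow> OU_controlled \<rho> \<alpha> f x)"
    if f: "integrable gauss f" "\<And>u. 0 \<le> f u" and \<alpha>: "0 < \<alpha>" for f \<alpha>
  proof -
    define \<beta> where "\<beta> = \<alpha> / \<kappa>"
    have \<beta>: "0 < \<beta>" using \<alpha> \<kappa> by (simp add: \<beta>_def)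
    have [measurable]: "f \<in> borel_measurable borel" using borel_measurable_integrable[OF f(1)] by simp
    define N where "N = (\<integral>u. f u \<partial>gauss)"
    have N: "0 \<le> N" unfolding N_def using f by (intro Bochner_Integration.integral_nonneg) auto
    define g where "g j u = f u * indicator (fat_shell j) u" for j u
    have gl: "integrable lborel (g j)" for j unfolding g_def using fat_shell_restriction(1)[OF f] .
    have g0: "0 \<le> g j u" for j u using f(2) by (simp add: g_def)
    have gl': "integrable lborel (\<lambda>u. g j (- u))" for j
      using lborel_integrable_real_affine[OF gl[of j], of "-1" 0] by simp
    have gint: "(\<integral>u. g j (- u) \<partial>lborel) = (\<integral>u. g j u \<partial>lborel)" for j
      by (subst (2) lborel_integral_real_affine[where c="-1" and t=0]) auto
    obtain E1 where E1: "\<And>j. E1 j \<in> sets borel" "\<And>j. emeasure lborel (E1 j) \<le> ennreal (C0 * (\<integral>u. g j u \<partial>lborel) / \<beta>)"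
      "\<And>j x. x \<notin> E1 j \<Longrightarrow> avg_controlled \<rho> \<beta> (g j) x"
      using avg_weak[OF gl g0 \<beta>] by metis
    obtain E2 where E2: "\<And>j. E2 j \<in> sets borel" "\<And>j. emeasure lborel (E2 j) \<le> ennreal (C0 * (\<integral>u. g j (- u) \<partial>lborel) / \<beta>)"
      "\<And>j x. x \<notin> E2 j \<Longrightarrow> avg_controlled \<rho> \<beta> (\<lambda>u. g j (- u)) x"
      using avg_weak[OF gl' g0 \<beta>] by metis
    note [measurable] = E1(1) E2(1)
    \<comment> \<open>Averages to the left of \<open>x\<close> are right averages of the reflected
      function at \<open>- x\<close>, so \<open>E2 j\<close> enters through its preimage under
      negation.\<close>
    define A where "A j = E1 j \<union> uminus -` E2 j" for j
    have E2m [measurable]: "uminus -` E2 j \<in> sets borel" for j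
      using measurable_sets[of uminus borel borel "E2 j"] E2(1) by simp
    have Am [measurable]: "A j \<in> sets borel" for j unfolding A_def by simp
    define Gl where "Gl = {x. \<beta> < 20 * N * ((1 + \<bar>x\<bar>) * exp (R x))}"
    have [measurable]: "Gl \<in> sets borel" unfolding Gl_def R_def by measurable
    define E where "E = Gl \<union> (\<Union>j. shell j \<inter> A j)"
    have "emeasure gauss Gl \<le> ennreal (80 * N / \<beta>)"
    proof (cases "N = 0")
      case True
      then show ?thesis using \<beta> by (simp add: Gl_def)
    next
      case False
      then have N': "0 < N" using N by simp
      then have "Gl = {x. \<beta> / (20 * N) < (1 + \<bar>x\<bar>) * exp (R x)}" by (auto simp: Gl_def field_simps)
      also have "emeasure gauss \<dots> \<le> ennreal (4 / (\<beta> / (20 * N)))" using \<beta> N' by (intro emeasure_gauss_weight_le) simp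
      finally show ?thesis by (simp add: mult.commute)
    qed
    moreover have "emeasure gauss (\<Union>j. shell j \<inter> A j) \<le> ennreal (7 * C1 * N / \<beta>)"
    proof -
      have one: "emeasure gauss (shell j \<inter> A j) \<le> ennreal (C1 / \<beta>) * (\<integral>\<^sup>+u. ennreal (f u) * indicator (fat_shell j) u \<partial>gauss)" for j
      proof -
        define n where "n = (\<integral>u. g j u \<partial>lborel)"
        define m where "m = (\<integral>u. g j u \<partial>gauss)"
        have n: "0 \<le> n" "0 \<le> m" unfolding n_def m_def using g0 by (auto intro!: Bochner_Integration.integral_nonneg)
        have nm: "n \<le> sqrt (2 * pi) * exp (real j / 2 + 2) * m"
          unfolding n_def m_def g_def using fat_shell_restriction(2)[OF f] .
        have "emeasure lborel (uminus -` E2 j) = emeasure (distr lborel borel uminus) (E2 j)"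
          by (subst emeasure_distr) auto
        also have "\<dots> = emeasure lborel (E2 j)" by (simp add: lborel_distr_uminus)
        finally have refl: "emeasure lborel (uminus -` E2 j) = emeasure lborel (E2 j)" .
        have "emeasure lborel (A j) \<le> emeasure lborel (E1 j) + emeasure lborel (uminus -` E2 j)"
          unfolding A_def by (intro emeasure_subadditive) auto
        also have "\<dots> \<le> ennreal (C0 * n / \<beta>) + ennreal (C0 * n / \<beta>)"
          unfolding refl using E1(2)[of j] E2(2)[of j] unfolding gint n_def by (rule add_mono)
        also have "\<dots> = ennreal (2 * C0 * n / \<beta>)"
          using C0 n \<beta> by (subst ennreal_plus[symmetric]) auto
        finally have Aj: "emeasure lborel (A j) \<le> ennreal (2 * C0 * n / \<beta>)" .
        have "emeasure gauss (shell j \<inter> A j) \<le> ennreal (exp (- real j / 2) / sqrt (2 * pi)) * emeasure lborel (A j)"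
          by (rule emeasure_gauss_shell_le) simp
        also have "\<dots> \<le> ennreal (exp (- real j / 2) / sqrt (2 * pi)) * ennreal (2 * C0 * n / \<beta>)"
          using Aj by (intro mult_left_mono) auto
        also have "\<dots> = ennreal (exp (- real j / 2) / sqrt (2 * pi) * (2 * C0 * n / \<beta>))"
          using C0 n \<beta> by (subst ennreal_mult[symmetric]) auto
        also have "\<dots> \<le> ennreal (C1 / \<beta> * m)"
        proof (rule ennreal_leI)
          have "exp (- real j / 2) / sqrt (2 * pi) * (2 * C0 * n / \<beta>) \<le> exp (- real j / 2) / sqrt (2 * pi) * (2 * C0 * (sqrt (2 * pi) * exp (real j / 2 + 2) * m) / \<beta>)"
            using nm C0 \<beta> by (intro mult_left_mono divide_right_mono) auto
          also have "\<dots> = (2 * C0) * (exp (- real j / 2) * exp (real j / 2 + 2)) * m / \<beta>" by simp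
          also have "\<dots> = C1 / \<beta> * m" unfolding exp_add[symmetric] by (simp add: C1_def)
          finally show "exp (- real j / 2) / sqrt (2 * pi) * (2 * C0 * n / \<beta>) \<le> C1 / \<beta> * m" .
        qed
        also have "\<dots> = ennreal (C1 / \<beta>) * ennreal m" using C1 \<beta> n by (intro ennreal_mult) auto
        also have "ennreal m = (\<integral>\<^sup>+u. ennreal (g j u) \<partial>gauss)"
        proof -
          have "integrable gauss (g j)"
            using integrable_mult_indicator[of "fat_shell j" gauss f] f by (auto simp: g_def[abs_def] mult.commute)
          then show ?thesis unfolding m_def using g0 by (intro nn_integral_eq_integral[symmetric]) auto
        qed
        also have "\<dots> = (\<integral>\<^sup>+u. ennreal (f u) * indicator (fat_shell j) u \<partial>gauss)"
          by (intro nn_integral_cong) (auto simp: g_def indicator_def)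
        finally show ?thesis .
      qed
      have "emeasure gauss (\<Union>j. shell j \<inter> A j) \<le> (\<Sum>j. emeasure gauss (shell j \<inter> A j))"
        by (rule emeasure_subadditive_countably) auto
      also have "\<dots> \<le> (\<Sum>j. ennreal (C1 / \<beta>) * (\<integral>\<^sup>+u. ennreal (f u) * indicator (fat_shell j) u \<partial>gauss))"
        using one by (intro suminf_le) auto
      also have "\<dots> = ennreal (C1 / \<beta>) * (\<integral>\<^sup>+u. (\<Sum>j. ennreal (f u) * indicator (fat_shell j) u) \<partial>gauss)"
        by (subst nn_integral_suminf) auto
      also have "\<dots> = ennreal (C1 / \<beta>) * (\<integral>\<^sup>+u. ennreal (f u) * (\<Sum>j. indicator (fat_shell j) u) \<partial>gauss)"
        by simp
      also have "\<dots> \<le> ennreal (C1 / \<beta>) * (\<integral>\<^sup>+u. ennreal (f u) * 7 \<partial>gauss)"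
        by (intro mult_left_mono nn_integral_mono suminf_indicator_fat_shell_le) auto
      also have "(\<integral>\<^sup>+u. ennreal (f u) * 7 \<partial>gauss) = ennreal N * 7"
        unfolding N_def using f by (subst nn_integral_multc) (auto simp: nn_integral_eq_integral)
      also have "ennreal (C1 / \<beta>) * (ennreal N * 7) = ennreal (7 * C1 * N / \<beta>)"
      proof -
        have "ennreal N * 7 = ennreal (N * 7)" using N by (simp add: ennreal_mult)
        then show ?thesis using N C1 \<beta> by (simp add: ennreal_mult[symmetric] mult_ac)
      qed
      finally show ?thesis .
    qed
    moreover have "emeasure gauss E \<le> emeasure gauss Gl + emeasure gauss (\<Union>j. shell j \<inter> A j)"
      unfolding E_def by (intro emeasure_subadditive) auto
    ultimately have "emeasure gauss E \<le> ennreal (80 * N / \<beta>) + ennreal (7 * C1 * N / \<beta>)"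
      by (meson add_mono order_trans)
    also have "\<dots> = ennreal (C * N / \<alpha>)"
      using N C1 \<beta> \<kappa> \<alpha> by (subst ennreal_plus[symmetric]) (auto simp: C_def \<beta>_def field_simps)
    finally have "emeasure gauss E \<le> ennreal (C * N / \<alpha>)" .
    moreover have "E \<in> sets borel" unfolding E_def by measurable
    moreover have "OU_controlled \<rho> \<alpha> f x" if x: "x \<notin> E" for x
      unfolding OU_controlled_def
    proof (intro allI impI)
      fix n and t :: "nat \<Rightarrow> real"
      assume t: "\<forall>i\<le>n. 0 < t i" "\<forall>i<n. t i \<le> t (Suc i)"
      define j where "j = nat \<lfloor>x\<^sup>2\<rfloor>"
      have xj: "x \<in> shell j" by (simp add: shell_def j_def of_nat_floor)
      then have "x \<notin> E1 j" "- x \<notin> E2 j" using x by (auto simp: E_def A_def)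
      then have ctl: "avg_controlled \<rho> \<beta> (g j) x" "avg_controlled \<rho> \<beta> (\<lambda>u. g j (- u)) (- x)"
        using E1(3) E2(3) by auto
      have "20 * N * ((1 + \<bar>x\<bar>) * exp (R x)) \<le> \<beta>" using x by (auto simp: E_def Gl_def)
      then have "(\<Sum>i<n. \<bar>OU (t (Suc i)) f x - OU (t i) f x\<bar> powr \<rho>) \<le> 3 powr \<rho> * D * \<beta> powr \<rho>"
        unfolding D_def using ctl t \<rho> unfolding g_def N_def
        by (intro variation_OU_nonneg_le[OF f \<beta> _ xj]) auto
      also have "\<dots> = (\<kappa> * \<beta>) powr \<rho>" unfolding \<kappa>_powr[symmetric] using \<kappa> \<beta> by (simp add: powr_mult)
      also have "\<kappa> * \<beta> = \<alpha>" using \<kappa> by (simp add: \<beta>_def)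
      finally show "(\<Sum>i<n. \<bar>OU (t (Suc i)) f x - OU (t i) f x\<bar> powr \<rho>) \<le> \<alpha> powr \<rho>" .
    qed
    ultimately show ?thesis unfolding N_def by blast
  qed
  ultimately show ?thesis by blast
qed

theorem theorem1p1:
  fixes \<rho> :: real
  assumes "\<rho> > 2"
  shows "\<exists>C>0. \<forall>f::real \<Rightarrow> real. integrable gauss f \<longrightarrow>
           (\<forall>\<alpha>>0.
              {x. variation \<rho> {0<..} (\<lambda>t. OU t f x) > ereal \<alpha>} \<in> sets gauss \<and>
              measure gauss {x. variation \<rho> {0<..} (\<lambda>t. OU t f x) > ereal \<alpha>}
                \<le> C / \<alpha> * (\<integral>u. \<bar>f u\<bar> \<partial>gauss))"
proof -
  interpret G: prob_space gauss by (rule prob_space_gauss)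
  obtain C where C: "C > 0" and weak: "\<And>f \<alpha>. integrable gauss f \<Longrightarrow> (\<And>u. 0 \<le> f u) \<Longrightarrow> 0 < \<alpha> \<Longrightarrow>
    (\<exists>E\<in>sets borel. emeasure gauss E \<le> ennreal (C * (\<integral>u. f u \<partial>gauss) / \<alpha>) \<and>
      (\<forall>x. x \<notin> E \<longrightarrow> OU_controlled \<rho> \<alpha> f x))"
    using weak_type_nonneg[OF assms] by metis
  have "measure gauss {x. variation \<rho> {0<..} (\<lambda>t. OU t f x) > ereal \<alpha>} \<le> 6 * C / \<alpha> * (\<integral>u. \<bar>f u\<bar> \<partial>gauss)"
    if f: "integrable gauss f" and \<alpha>: "0 < \<alpha>" for f :: "real \<Rightarrow> real" and \<alpha>
  proof -
    let ?p = "\<lambda>u. max 0 (f u)" and ?m = "\<lambda>u. max 0 (- f u)"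
    have p: "integrable gauss ?p" "integrable gauss ?m" using f by auto
    \<comment> \<open>The level \<open>\<alpha> / 6\<close> absorbs the factor
      \<open>3 powr \<rho>\<close> from adding the two parts: \<open>2 * (3 * (\<alpha> / 6)) powr
      \<rho> = 2 * (\<alpha> / 2) powr \<rho>\<close> is at most
      \<open>\<alpha> powr \<rho>\<close>.\<close>
    obtain P where P: "P \<in> sets borel" "emeasure gauss P \<le> ennreal (C * (\<integral>u. ?p u \<partial>gauss) / (\<alpha> / 6))"
      "\<And>x. x \<notin> P \<Longrightarrow> OU_controlled \<rho> (\<alpha> / 6) ?p x"
      using weak[OF p(1), of "\<alpha> / 6"] \<alpha> by auto
    obtain M where M: "M \<in> sets borel" "emeasure gauss M \<le> ennreal (C * (\<integral>u. ?m u \<partial>gauss) / (\<alpha> / 6))"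
      "\<And>x. x \<notin> M \<Longrightarrow> OU_controlled \<rho> (\<alpha> / 6) ?m x"
      using weak[OF p(2), of "\<alpha> / 6"] \<alpha> by auto
    have OU_pm: "OU t f x = OU t ?p x - OU t ?m x" if "0 < t" for t x
    proof -
      have "OU t ?p x = OU t (\<lambda>u. f u + ?m u) x"
        by (intro arg_cong[where f="\<lambda>f. OU t f x"]) (auto simp: max_def)
      also have "\<dots> = OU t f x + OU t ?m x" by (rule OU_add[OF f p(2) that])
      finally show ?thesis by simp
    qed
    have "variation \<rho> {0<..} (\<lambda>t. OU t f x) \<le> ereal \<alpha>" if x: "x \<notin> P \<union> M" for x
      unfolding variation_def
    proof (rule SUP_least, clarsimp)
      fix n and t :: "nat \<Rightarrow> real"
      assume t0: "\<forall>i\<le>n. 0 < t i" and t1: "\<forall>i<n. t i < t (Suc i)"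
      let ?d = "\<lambda>g i. \<bar>OU (t (Suc i)) g x - OU (t i) g x\<bar>"
      have t2: "\<forall>i<n. t i \<le> t (Suc i)" using t1 by (auto simp: less_imp_le)
      have "(\<Sum>i\<in>{Suc 0..n}. \<bar>OU (t i) f x - OU (t (i - Suc 0)) f x\<bar> powr \<rho>) = (\<Sum>i<n. ?d f i powr \<rho>)"
        by (rule sum.reindex_bij_witness[where i=Suc and j="\<lambda>i. i - 1"]) auto
      also have "\<dots> \<le> (\<Sum>i<n. 3 powr \<rho> * (?d ?p i powr \<rho> + ?d ?m i powr \<rho>))"
      proof (rule sum_mono)
        fix i assume "i \<in> {..<n}"
        then have "OU (t (Suc i)) f x - OU (t i) f x = (OU (t (Suc i)) ?p x - OU (t i) ?p x) - (OU (t (Suc i)) ?m x - OU (t i) ?m x)"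
          using OU_pm[of "t i" x] OU_pm[of "t (Suc i)" x] t0 by auto
        then have "?d f i \<le> ?d ?p i + ?d ?m i + 0" by linarith
        then have "?d f i powr \<rho> \<le> (?d ?p i + ?d ?m i + 0) powr \<rho>" using assms by (intro powr_mono2) auto
        also have "\<dots> \<le> 3 powr \<rho> * (?d ?p i powr \<rho> + ?d ?m i powr \<rho> + 0 powr \<rho>)"
          using assms by (intro powr_add3_le) auto
        finally show "?d f i powr \<rho> \<le> 3 powr \<rho> * (?d ?p i powr \<rho> + ?d ?m i powr \<rho>)" by simp
      qed
      also have "\<dots> = 3 powr \<rho> * ((\<Sum>i<n. ?d ?p i powr \<rho>) + (\<Sum>i<n. ?d ?m i powr \<rho>))"
        by (simp only: sum_distrib_left[symmetric] sum.distrib)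
      also have "\<dots> \<le> 3 powr \<rho> * ((\<alpha> / 6) powr \<rho> + (\<alpha> / 6) powr \<rho>)"
        using P(3)[of x] M(3)[of x] x t0 t2 unfolding OU_controlled_def
        by (intro mult_left_mono add_mono) auto
      also have "\<dots> = 2 * (3 * (\<alpha> / 6)) powr \<rho>"
        using \<alpha> by (subst powr_mult) auto
      also have "\<dots> = 2 * (\<alpha> / 2) powr \<rho>" by simp
      also have "\<dots> = 2 / 2 powr \<rho> * \<alpha> powr \<rho>" using \<alpha> by (simp add: powr_divide)
      also have "\<dots> \<le> 1 * \<alpha> powr \<rho>"
      proof (rule mult_right_mono)
        have "2 powr 1 \<le> 2 powr \<rho>" using assms by (intro powr_mono) auto
        then show "2 / 2 powr \<rho> \<le> 1" by simp
      qed simp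
      finally have "(\<Sum>i\<in>{Suc 0..n}. \<bar>OU (t i) f x - OU (t (i - Suc 0)) f x\<bar> powr \<rho>) powr (1 / \<rho>) \<le> (\<alpha> powr \<rho>) powr (1 / \<rho>)"
        using assms by (intro powr_mono2 sum_nonneg) auto
      also have "\<dots> = \<alpha>" using assms \<alpha> by (simp add: powr_powr)
      finally show "(\<Sum>i\<in>{Suc 0..n}. \<bar>OU (t i) f x - OU (t (i - Suc 0)) f x\<bar> powr \<rho>) powr (1 / \<rho>) \<le> \<alpha>" .
    qed
    then have "{x. variation \<rho> {0<..} (\<lambda>t. OU t f x) > ereal \<alpha>} \<subseteq> P \<union> M"
      by (auto simp: not_le[symmetric])
    then have "emeasure gauss {x. variation \<rho> {0<..} (\<lambda>t. OU t f x) > ereal \<alpha>} \<le> emeasure gauss (P \<union> M)"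
      using P M by (intro emeasure_mono) auto
    also have "\<dots> \<le> emeasure gauss P + emeasure gauss M"
      using P M by (intro emeasure_subadditive) auto
    also have "\<dots> \<le> ennreal (C * (\<integral>u. ?p u \<partial>gauss) / (\<alpha> / 6)) + ennreal (C * (\<integral>u. ?m u \<partial>gauss) / (\<alpha> / 6))"
      using P M by (intro add_mono)
    also have "\<dots> = ennreal (C * (\<integral>u. ?p u \<partial>gauss) / (\<alpha> / 6) + C * (\<integral>u. ?m u \<partial>gauss) / (\<alpha> / 6))"
      using C \<alpha> by (intro ennreal_plus[symmetric] divide_nonneg_nonneg mult_nonneg_nonneg Bochner_Integration.integral_nonneg) auto
    also have "C * (\<integral>u. ?p u \<partial>gauss) / (\<alpha> / 6) + C * (\<integral>u. ?m u \<partial>gauss) / (\<alpha> / 6)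
      = 6 * C / \<alpha> * ((\<integral>u. ?p u \<partial>gauss) + (\<integral>u. ?m u \<partial>gauss))"
      by (simp add: distrib_left add_divide_distrib mult_ac)
    also have "(\<integral>u. ?p u \<partial>gauss) + (\<integral>u. ?m u \<partial>gauss) = (\<integral>u. ?p u + ?m u \<partial>gauss)"
      using p by (rule Bochner_Integration.integral_add[symmetric])
    also have "\<dots> = (\<integral>u. \<bar>f u\<bar> \<partial>gauss)"
      by (intro Bochner_Integration.integral_cong) auto
    finally show ?thesis unfolding G.emeasure_eq_measure using C \<alpha>
      by (subst (asm) ennreal_le_iff) (auto intro!: Bochner_Integration.integral_nonneg mult_nonneg_nonneg)
  qed
  moreover have "{x. variation \<rho> {0<..} (\<lambda>t. OU t f x) > ereal \<alpha>} \<in> sets gauss"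
    if "integrable gauss f" for f \<alpha>
    using assms by (intro sets_variation_OU that) auto
  ultimately show ?thesis using C by (intro exI[of _ "6 * C"]) auto
qed

end
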